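(* Let $K$ be any field and let $E$ be a finite directed graph. If $S$ is a Chen simple left $L_K(E)$-module such that $\operatorname{Ext}^1_{L_K(E)}(S,S)\neq 0$ and $L$ is a uniserial left $L_K(E)$-module such that $L/\operatorname{Rad}(L)\cong S$, then there exists a uniserial left $L_K(E)$-module $M$ which is an extension of $L$ by $S$. In particular, for any Chen simple $S$ with $\operatorname{Ext}^1_{L_K(E)}(S,S)\neq 0$ and any $n\in\mathbb{N}$, there exists a uniserial left $L_K(E)$-module of length $n$, all of whose composition factors are isomorphic to $S$.
   Context: A directed graph $E=(E^0,E^1,s,r)$ consists of a set $E^0$ of vertices, a set $E^1$ of edges, and maps $s,r:E^1\to E^0$ (source and range); $E$ is finite if $E^0$ and $E^1$ are finite. A sink is a vertex $w$ with $s^{-1}(w)=\emptyset$. The Leavitt path algebra $L_K(E)$ is the $K$-algebra generated by $\{v: v\in E^0\}\cup\{e,e^*: e\in E^1\}$ with relations: (V) $vu=\delta_{v,u}v$ for $v,u\in E^0$; (E1) $s(e)e=er(e)=e$; (E2) $r(e)e^*=e^*s(e)=e^*$ for $e\in E^1$; (CK1) $e^*e'=\delta_{e,e'}r(e)$ for $e,e'\in E^1$; (CK2) $v=\sum_{e\in s^{-1}(v)}ee^*$ for every $v\in E^0$ with $0<|s^{-1}(v)|<\infty$. For $E$ finite it is unital. An infinite path is a sequence $p=e_1e_2e_3\cdots$ of edges with $r(e_i)=s(e_{i+1})$ for all $i$; $\tau_{>n}(p)=e_{n+1}e_{n+2}\cdots$. Infinite paths $p,q$ are tail equivalent if $\tau_{>m}(p)=\tau_{>n}(q)$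 for some $m,n\ge0$; $[p]$ is the class of $p$. For an infinite path $p$, $V_{[p]}$ is the $K$-vector space with basis $[p]$ and left $L_K(E)$-action determined, for $q=f_1f_2\cdots\in[p]$, $v\in E^0$, $e\in E^1$, by: $v\cdot q=q$ if $v=s(f_1)$ and $0$ otherwise; $e\cdot q=eq$ if $r(e)=s(f_1)$ and $0$ otherwise; $e^*\cdot q=\tau_{>1}(q)$ if $e=f_1$ and $0$ otherwise. For a sink $w$, $V_{[w^\infty]}$ denotes the left ideal $L_K(E)w$. A Chen simple module is a module $V_{[p]}$ with $p$ an infinite path, or $V_{[w^\infty]}$ with $w$ a sink. A module is uniserial if its lattice of submodules is totally ordered. $\operatorname{Rad}(L)$ is the radical (intersection of all maximal submodules) of $L$. A module $M$ is an extension of $L$ by $S$ if there is a short exact sequence $0\to L\to M\to S\to 0$. *)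

theory Defs
  imports
    "HOL-Library.Poly_Mapping"
    "Graph_Theory.Digraph"
    "HOL-Algebra.QuotRing"
    "HOL-Algebra.Module"
begin

section \<open>Left modules over a (not necessarily commutative) ring\<close>

text \<open>
  The record type of modules is the one of HOL-Algebra (whose fields \<open>mult\<close> and \<open>one\<close>
  play no role for a module), but the locale \<open>module\<close> there requires a commutative
  ring of scalars. The locale \<open>submodule\<close> has no such restriction and is used as it is.
\<close>

locale left_module = R?: ring R + M?: abelian_group M
  for R :: "('r, 'x) ring_scheme" (structure) and M :: "('r, 'm, 'y) module_scheme" (structure) +
  assumes smult_closed:
      "\<lbrakk>a \<in> carrier R; x \<in> carrier M\<rbrakk> \<Longrightarrow> a \<odot>\<^bsub>M\<^esub> x \<in> carrier M"
    and smult_l_distr: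
      "\<lbrakk>a \<in> carrier R; b \<in> carrier R; x \<in> carrier M\<rbrakk> \<Longrightarrow>
        (a \<oplus>\<^bsub>R\<^esub> b) \<odot>\<^bsub>M\<^esub> x = a \<odot>\<^bsub>M\<^esub> x \<oplus>\<^bsub>M\<^esub> b \<odot>\<^bsub>M\<^esub> x"
    and smult_r_distr:
      "\<lbrakk>a \<in> carrier R; x \<in> carrier M; y \<in> carrier M\<rbrakk> \<Longrightarrow>
        a \<odot>\<^bsub>M\<^esub> (x \<oplus>\<^bsub>M\<^esub> y) = a \<odot>\<^bsub>M\<^esub> x \<oplus>\<^bsub>M\<^esub> a \<odot>\<^bsub>M\<^esub> y"
    and smult_assoc:
      "\<lbrakk>a \<in> carrier R; b \<in> carrier R; x \<in> carrier M\<rbrakk> \<Longrightarrow>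
        (a \<otimes>\<^bsub>R\<^esub> b) \<odot>\<^bsub>M\<^esub> x = a \<odot>\<^bsub>M\<^esub> (b \<odot>\<^bsub>M\<^esub> x)"
    and smult_one:
      "x \<in> carrier M \<Longrightarrow> \<one>\<^bsub>R\<^esub> \<odot>\<^bsub>M\<^esub> x = x"

definition lmod_hom ::
  "('r, 'x) ring_scheme \<Rightarrow> ('r, 'm) module \<Rightarrow> ('r, 'n) module \<Rightarrow> ('m \<Rightarrow> 'n) set" where
  "lmod_hom R M N =
     {f \<in> carrier M \<rightarrow> carrier N.
        (\<forall>x\<in>carrier M. \<forall>y\<in>carrier M. f (x \<oplus>\<^bsub>M\<^esub> y) = f x \<oplus>\<^bsub>N\<^esub> f y) \<and>
        (\<forall>a\<in>carrier R. \<forall>x\<in>carrier M. f (a \<odot>\<^bsub>M\<^esub> x) = a \<odot>\<^bsub>N\<^esub> f x)}"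

definition lmod_iso ::
  "('r, 'x) ring_scheme \<Rightarrow> ('r, 'm) module \<Rightarrow> ('r, 'n) module \<Rightarrow> bool" where
  "lmod_iso R M N \<longleftrightarrow> (\<exists>f \<in> lmod_hom R M N. bij_betw f (carrier M) (carrier N))"

definition quot_module :: "('r, 'm) module \<Rightarrow> 'm set \<Rightarrow> ('r, 'm set) module" where
  "quot_module M N =
     \<lparr>carrier = a_rcosets\<^bsub>M\<^esub> N, mult = undefined, one = undefined,
      zero = N, add = set_add M,
      smult = (\<lambda>a U. \<Union>x\<in>U. N +>\<^bsub>M\<^esub> (a \<odot>\<^bsub>M\<^esub> x))\<rparr>"

definition uniserial :: "('r, 'x) ring_scheme \<Rightarrow> ('r, 'm) module \<Rightarrow> bool" where
  "uniserial R M \<longleftrightarrow> left_module R M \<and>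
     (\<forall>N N'. submodule N R M \<longrightarrow> submodule N' R M \<longrightarrow> N \<subseteq> N' \<or> N' \<subseteq> N)"

definition maximal_submodule ::
  "('r, 'x) ring_scheme \<Rightarrow> ('r, 'm) module \<Rightarrow> 'm set \<Rightarrow> bool" where
  "maximal_submodule R M N \<longleftrightarrow> submodule N R M \<and> N \<noteq> carrier M \<and>
     (\<forall>N'. submodule N' R M \<longrightarrow> N \<subseteq> N' \<longrightarrow> N' = N \<or> N' = carrier M)"

text \<open>The intersection of the empty family of maximal submodules is the whole module.\<close>

definition module_rad :: "('r, 'x) ring_scheme \<Rightarrow> ('r, 'm) module \<Rightarrow> 'm set" where
  "module_rad R M = carrier M \<inter> \<Inter>{N. maximal_submodule R M N}"

text \<open>\<open>M\<close> is an extension of \<open>L\<close> by \<open>S\<close>: there is a short exact sequence \<open>0 \<rightarrow> L \<rightarrow> M \<rightarrow> S \<rightarrow> 0\<close>.\<close>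

definition is_extension ::
  "('r, 'x) ring_scheme \<Rightarrow> ('r, 'm) module \<Rightarrow> ('r, 'l) module \<Rightarrow> ('r, 's) module \<Rightarrow> bool" where
  "is_extension R M L S \<longleftrightarrow>
     left_module R L \<and> left_module R M \<and> left_module R S \<and>
     (\<exists>f \<in> lmod_hom R L M. \<exists>g \<in> lmod_hom R M S.
        inj_on f (carrier L) \<and> f ` carrier L = a_kernel M S g \<and> g ` carrier M = carrier S)"

definition simple_module :: "('r, 'x) ring_scheme \<Rightarrow> ('r, 'm) module \<Rightarrow> bool" where
  "simple_module R M \<longleftrightarrow> left_module R M \<and> carrier M \<noteq> {\<zero>\<^bsub>M\<^esub>} \<and>
     (\<forall>N. submodule N R M \<longrightarrow> N = {\<zero>\<^bsub>M\<^esub>} \<or> N = carrier M)"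

definition subquot :: "('r, 'm) module \<Rightarrow> 'm set \<Rightarrow> 'm set \<Rightarrow> ('r, 'm set) module" where
  "subquot M A B = quot_module (M\<lparr>carrier := A\<rparr>) B"

text \<open>Only the values \<open>N 0, \<dots>, N n\<close> of the filtration \<open>N\<close> matter.\<close>

definition composition_series ::
  "('r, 'x) ring_scheme \<Rightarrow> ('r, 'm) module \<Rightarrow> nat \<Rightarrow> (nat \<Rightarrow> 'm set) \<Rightarrow> bool" where
  "composition_series R M n N \<longleftrightarrow> left_module R M \<and>
     N 0 = {\<zero>\<^bsub>M\<^esub>} \<and> N n = carrier M \<and> (\<forall>i\<le>n. submodule (N i) R M) \<and>
     (\<forall>i<n. N i \<subseteq> N (Suc i) \<and> simple_module R (subquot M (N (Suc i)) (N i)))"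

definition has_length :: "('r, 'x) ring_scheme \<Rightarrow> ('r, 'm) module \<Rightarrow> nat \<Rightarrow> bool" where
  "has_length R M n \<longleftrightarrow> (\<exists>N. composition_series R M n N)"

definition composition_factors ::
  "('r, 'x) ring_scheme \<Rightarrow> ('r, 'm) module \<Rightarrow> ('r, 'm set) module set" where
  "composition_factors R M =
     {subquot M (N (Suc i)) (N i) | N n i. composition_series R M n N \<and> i < n}"


section \<open>The group \<open>Ext\<^sup>1\<close>\<close>

text \<open>
  \<open>Ext\<^sup>1(S, T)\<close> is the cokernel of the restriction map \<open>Hom(F, T) \<rightarrow> Hom(\<Omega>, T)\<close>, for the
  canonical free presentation \<open>0 \<rightarrow> \<Omega> \<rightarrow> F \<rightarrow> S \<rightarrow> 0\<close> in which \<open>F\<close> is the free module on the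
  underlying set of \<open>S\<close> and \<open>F \<rightarrow> S\<close> sends the basis element at \<open>x\<close> to \<open>x\<close>.
\<close>

definition free_module :: "('r, 'x) ring_scheme \<Rightarrow> 's set \<Rightarrow> ('r, 's \<Rightarrow> 'r) module" where
  "free_module R U =
     \<lparr>carrier = {f. range f \<subseteq> carrier R \<and> finite {x. f x \<noteq> \<zero>\<^bsub>R\<^esub>} \<and> {x. f x \<noteq> \<zero>\<^bsub>R\<^esub>} \<subseteq> U},
      mult = undefined, one = undefined,
      zero = (\<lambda>_. \<zero>\<^bsub>R\<^esub>), add = (\<lambda>f g x. f x \<oplus>\<^bsub>R\<^esub> g x),
      smult = (\<lambda>a f x. a \<otimes>\<^bsub>R\<^esub> f x)\<rparr>"

definition free_cover :: "('r, 'x) ring_scheme \<Rightarrow> ('r, 's) module \<Rightarrow> ('s \<Rightarrow> 'r) \<Rightarrow> 's" where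
  "free_cover R S f = (\<Oplus>\<^bsub>S\<^esub>x\<in>{x. f x \<noteq> \<zero>\<^bsub>R\<^esub>}. f x \<odot>\<^bsub>S\<^esub> x)"

definition syzygy :: "('r, 'x) ring_scheme \<Rightarrow> ('r, 's) module \<Rightarrow> ('r, 's \<Rightarrow> 'r) module" where
  "syzygy R S = (free_module R (carrier S))
     \<lparr>carrier := a_kernel (free_module R (carrier S)) S (free_cover R S)\<rparr>"

definition hom_group ::
  "('r, 'x) ring_scheme \<Rightarrow> ('r, 'm) module \<Rightarrow> ('r, 'n) module \<Rightarrow> ('m \<Rightarrow> 'n) monoid" where
  "hom_group R M N =
     \<lparr>carrier = lmod_hom R M N \<inter> extensional (carrier M),
      mult = (\<lambda>f g. \<lambda>x\<in>carrier M. f x \<oplus>\<^bsub>N\<^esub> g x),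
      one = (\<lambda>x\<in>carrier M. \<zero>\<^bsub>N\<^esub>)\<rparr>"

definition Ext1 ::
  "('r, 'x) ring_scheme \<Rightarrow> ('r, 's) module \<Rightarrow> ('r, 't) module \<Rightarrow> (('s \<Rightarrow> 'r) \<Rightarrow> 't) set monoid" where
  "Ext1 R S T = hom_group R (syzygy R S) T Mod
     ((\<lambda>f. restrict f (carrier (syzygy R S))) ` carrier (hom_group R (free_module R (carrier S)) T))"


section \<open>Leavitt path algebras\<close>

text \<open>
  A graph is a \<open>pre_digraph\<close>: \<open>verts\<close> is \<open>E\<^sup>0\<close>, \<open>arcs\<close> is \<open>E\<^sup>1\<close>, \<open>tail\<close> is the source map
  and \<open>head\<close> is the range map. Finite graphs are those with \<open>fin_digraph\<close>.
\<close>

datatype ('v, 'e) lpa_gen = Vertex 'v | Edge 'e | Ghost 'e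

definition lpa_gens :: "('v, 'e) pre_digraph \<Rightarrow> ('v, 'e) lpa_gen set" where
  "lpa_gens E = Vertex ` verts E \<union> Edge ` arcs E \<union> Ghost ` arcs E"

text \<open>
  Noncommutative monomials. The monoid of words is written additively, so that the product of
  \<open>'g free_word \<Rightarrow>\<^sub>0 'k\<close> (convolution) is the product of the free unital algebra on \<open>'g\<close>.
\<close>

datatype 'g free_word = Word (letters: "'g list")

instantiation free_word :: (type) monoid_add
begin

definition zero_free_word :: "'a free_word" where
  "0 = Word []"

definition plus_free_word :: "'a free_word \<Rightarrow> 'a free_word \<Rightarrow> 'a free_word" where
  "u + v = Word (letters u @ letters v)"

instance
  by intro_classes (simp_all add: zero_free_word_def plus_free_word_def)

end

definition free_algebra :: "'g set \<Rightarrow> ('g free_word \<Rightarrow>\<^sub>0 'k::field) ring" where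
  "free_algebra U =
     \<lparr>carrier = {f. \<forall>w \<in> Poly_Mapping.keys f. set (letters w) \<subseteq> U},
      mult = (*), one = 1, zero = 0, add = (+)\<rparr>"

definition gen :: "'g \<Rightarrow> ('g free_word \<Rightarrow>\<^sub>0 'k::field)" where
  "gen g = Poly_Mapping.single (Word [g]) 1"

text \<open>
  The relations (V), (E1), (E2), (CK1), (CK2), in this order. The last set states that the sum of
  the vertices is the unit. This is needed because the presentation is one of unital algebras;
  for a finite graph, the (possibly nonunital) algebra presented by the other relations
  has that sum as its unit. The definition is meant for finite graphs only.
\<close>

definition lpa_relations ::
  "('v, 'e) pre_digraph \<Rightarrow> (('v, 'e) lpa_gen free_word \<Rightarrow>\<^sub>0 'k::field) set" where
  "lpa_relations E =
     {gen (Vertex v) * gen (Vertex u) - (if v = u then gen (Vertex v) else 0)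
        | v u. v \<in> verts E \<and> u \<in> verts E} \<union>
     {gen (Vertex (tail E e)) * gen (Edge e) - gen (Edge e) | e. e \<in> arcs E} \<union>
     {gen (Edge e) * gen (Vertex (head E e)) - gen (Edge e) | e. e \<in> arcs E} \<union>
     {gen (Vertex (head E e)) * gen (Ghost e) - gen (Ghost e) | e. e \<in> arcs E} \<union>
     {gen (Ghost e) * gen (Vertex (tail E e)) - gen (Ghost e) | e. e \<in> arcs E} \<union>
     {gen (Ghost e) * gen (Edge e') - (if e = e' then gen (Vertex (head E e)) else 0)
        | e e'. e \<in> arcs E \<and> e' \<in> arcs E} \<union>
     {gen (Vertex v) - (\<Sum>e\<in>out_arcs E v. gen (Edge e) * gen (Ghost e))
        | v. v \<in> verts E \<and> finite (out_arcs E v) \<and> out_arcs E v \<noteq> {}} \<union>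
     {(\<Sum>v\<in>verts E. gen (Vertex v)) - 1}"

definition lpa_ideal ::
  "('v, 'e) pre_digraph \<Rightarrow> (('v, 'e) lpa_gen free_word \<Rightarrow>\<^sub>0 'k::field) set" where
  "lpa_ideal E = Idl\<^bsub>free_algebra (lpa_gens E)\<^esub> (lpa_relations E)"

type_synonym ('v, 'e, 'k) lpa_elem = "(('v, 'e) lpa_gen free_word \<Rightarrow>\<^sub>0 'k) set"

definition LPA :: "('v, 'e) pre_digraph \<Rightarrow> ('v, 'e, 'k::field) lpa_elem ring" where
  "LPA E = free_algebra (lpa_gens E) Quot lpa_ideal E"


section \<open>Chen simple modules\<close>

definition infinite_path :: "('v, 'e) pre_digraph \<Rightarrow> (nat \<Rightarrow> 'e) \<Rightarrow> bool" where
  "infinite_path E p \<longleftrightarrow> (\<forall>i. p i \<in> arcs E \<and> head E (p i) = tail E (p (Suc i)))"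

definition path_tail :: "nat \<Rightarrow> (nat \<Rightarrow> 'e) \<Rightarrow> (nat \<Rightarrow> 'e)" where
  "path_tail n p = (\<lambda>i. p (n + i))"

definition tail_class :: "('v, 'e) pre_digraph \<Rightarrow> (nat \<Rightarrow> 'e) \<Rightarrow> (nat \<Rightarrow> 'e) set" where
  "tail_class E p = {q. infinite_path E q \<and> (\<exists>m n. path_tail m p = path_tail n q)}"

text \<open>
  \<open>path_act E g q c\<close> is the generator \<open>g\<close> applied to \<open>c\<close> times the basis vector \<open>q\<close>; the path
  \<open>case_nat e q\<close> is \<open>q\<close> with \<open>e\<close> prepended.
\<close>

fun path_act ::
  "('v, 'e) pre_digraph \<Rightarrow> ('v, 'e) lpa_gen \<Rightarrow> (nat \<Rightarrow> 'e) \<Rightarrow> 'k \<Rightarrow> ((nat \<Rightarrow> 'e) \<Rightarrow>\<^sub>0 'k::field)" where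
  "path_act E (Vertex v) q c = (if v = tail E (q 0) then Poly_Mapping.single q c else 0)"
| "path_act E (Edge e) q c =
     (if head E e = tail E (q 0) then Poly_Mapping.single (case_nat e q) c else 0)"
| "path_act E (Ghost e) q c = (if e = q 0 then Poly_Mapping.single (path_tail 1 q) c else 0)"

definition gen_act ::
  "('v, 'e) pre_digraph \<Rightarrow> ('v, 'e) lpa_gen \<Rightarrow>
     ((nat \<Rightarrow> 'e) \<Rightarrow>\<^sub>0 'k::field) \<Rightarrow> ((nat \<Rightarrow> 'e) \<Rightarrow>\<^sub>0 'k)" where
  "gen_act E g x = (\<Sum>q \<in> Poly_Mapping.keys x. path_act E g q (Poly_Mapping.lookup x q))"

definition free_algebra_act ::
  "('v, 'e) pre_digraph \<Rightarrow> (('v, 'e) lpa_gen free_word \<Rightarrow>\<^sub>0 'k::field) \<Rightarrow>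
     ((nat \<Rightarrow> 'e) \<Rightarrow>\<^sub>0 'k) \<Rightarrow> ((nat \<Rightarrow> 'e) \<Rightarrow>\<^sub>0 'k)" where
  "free_algebra_act E f x =
     (\<Sum>w \<in> Poly_Mapping.keys f.
        Poly_Mapping.map ((*) (Poly_Mapping.lookup f w)) (foldr (gen_act E) (letters w) x))"

text \<open>
  \<open>V\<^bsub>[p]\<^esub>\<close>: a residue class in the Leavitt path algebra acts through any of its representatives
  (all of them act in the same way on the span of \<open>[p]\<close>).
\<close>

definition path_module ::
  "('v, 'e) pre_digraph \<Rightarrow> (nat \<Rightarrow> 'e) \<Rightarrow> (('v, 'e, 'k::field) lpa_elem, (nat \<Rightarrow> 'e) \<Rightarrow>\<^sub>0 'k) module" where
  "path_module E p =
     \<lparr>carrier = {x. Poly_Mapping.keys x \<subseteq> tail_class E p}, mult = undefined, one = undefined,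
      zero = 0, add = (+),
      smult = (\<lambda>U x. the_elem ((\<lambda>f. free_algebra_act E f x) ` U))\<rparr>"

definition principal_left_ideal :: "'r ring \<Rightarrow> 'r \<Rightarrow> ('r, 'r) module" where
  "principal_left_ideal R a =
     \<lparr>carrier = {b \<otimes>\<^bsub>R\<^esub> a | b. b \<in> carrier R}, mult = undefined, one = undefined,
      zero = \<zero>\<^bsub>R\<^esub>, add = add R, smult = mult R\<rparr>"

definition sink :: "('v, 'e) pre_digraph \<Rightarrow> 'v \<Rightarrow> bool" where
  "sink E w \<longleftrightarrow> w \<in> verts E \<and> out_arcs E w = {}"

definition lpa_vertex :: "('v, 'e) pre_digraph \<Rightarrow> 'v \<Rightarrow> ('v, 'e, 'k::field) lpa_elem" where
  "lpa_vertex E v = lpa_ideal E +>\<^bsub>free_algebra (lpa_gens E)\<^esub> gen (Vertex v)"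

text \<open>Chen simple modules are taken up to isomorphism, so that they may live on any carrier type.\<close>

definition chen_simple ::
  "('v, 'e) pre_digraph \<Rightarrow> (('v, 'e, 'k::field) lpa_elem, 's) module \<Rightarrow> bool" where
  "chen_simple E S \<longleftrightarrow> left_module (LPA E) S \<and>
     ((\<exists>p. infinite_path E p \<and> lmod_iso (LPA E) S (path_module E p)) \<or>
      (\<exists>w. sink E w \<and>
        lmod_iso (LPA E) S (principal_left_ideal (LPA E) (lpa_vertex E w))))"

end

theory Submission
  imports Defs
begin

text \<open>
  A left \<open>L\<^sub>K(E)\<close>-module structure can be twisted: if \<open>T\<close> is a \<open>K\<close>-linear automorphism commuting with
  all vertices, letting \<open>e\<close> act as \<open>T e\<close> and \<open>e\<^sup>*\<close> as \<open>e\<^sup>* T\<^sup>-\<^sup>1\<close> preserves all relations. Taking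
  \<open>T (l, x) = (l + h x, x)\<close> on \<open>L \<oplus> S\<close> yields an extension of \<open>L\<close> by \<open>S\<close> for every linear map
  \<open>h : S \<rightarrow> L\<close> commuting with the vertices. For a Chen module \<open>S\<close> every class in \<open>Ext\<^sup>1(S, S)\<close> arises in this
  way, and since \<open>S\<close> has a basis of infinite paths, \<open>h : S \<rightarrow> S\<close> lifts along any surjection \<open>L \<rightarrow> S\<close>.
  This replaces the vanishing of \<open>Ext\<^sup>2\<close>. Lift a nonzero class along \<open>L \<rightarrow> L/Rad L \<cong> S\<close>. If a submodule \<open>N\<close>
  of the resulting \<open>M\<close> is not contained in \<open>L\<close>, then \<open>N\<close> maps onto \<open>S\<close>, and \<open>N \<inter> L \<subseteq> Rad L\<close> would split
  the original class; hence \<open>N \<supseteq> L\<close> and \<open>N = M\<close>, so \<open>M\<close> is uniserial. At a sink, \<open>S\<close> is projective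
  and \<open>Ext\<^sup>1(S, S) = 0\<close>.
\<close>

section \<open>Modules over a ring\<close>

text \<open>Why a twist reaches every class: take a K-linear section \<sigma> of the free cover that
  commutes with the vertices. A homomorphism f from the syzygy to S becomes the derivation d a x = f
  (a \<sigma>(x) - \<sigma>(a x)), which vanishes on scalars and vertices, and f extends to the free
  module as soon as d is inner. An infinite path has exactly one first edge, so it is e q' for a
  unique e and q', and the rule h(e q') = d(e)(q') prescribes h on the basis with no consistency
  condition beyond the source vertex. This matches d on the edges, and (CK1) then settles its values
  on the ghost edges. Lifting a class along L -> S is in general obstructed in Ext^2(S, Rad L),
  which is zero because Leavitt path algebras are hereditary. Here the obstruction never shows up: a
  map that only has to be linear and compatible with the vertices is lifted one basis path at a
  time. A different obstacle is the type of the carrier, which grows with every extension; iteration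
  therefore encodes pairs as lists after each step.\<close>

lemma a_kernel_eq: "a_kernel M N f = {x \<in> carrier M. f x = \<zero>\<^bsub>N\<^esub>}"
  by (simp add: a_kernel_def kernel_def)

lemma abelian_group_homI':
  assumes "abelian_group M" "abelian_group N" "f \<in> carrier M \<rightarrow> carrier N"
    and "\<And>x y. \<lbrakk>x \<in> carrier M; y \<in> carrier M\<rbrakk> \<Longrightarrow> f (x \<oplus>\<^bsub>M\<^esub> y) = f x \<oplus>\<^bsub>N\<^esub> f y"
  shows "abelian_group_hom M N f"
proof -
  interpret M: abelian_group M by fact
  interpret N: abelian_group N by fact
  show ?thesis
    by (intro abelian_group_homI assms(1,2) group_hom.intro group_hom_axioms.intro
        M.a_group N.a_group homI) (use assms in auto)
qed

lemma (in abelian_group_hom) hom_finsum: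
  assumes "finite A" "g \<in> A \<rightarrow> carrier G"
  shows "h (finsum G g A) = finsum H (\<lambda>i. h (g i)) A"
  using assms
proof (induction A rule: finite_induct)
  case (insert a A)
  then have g: "g \<in> A \<rightarrow> carrier G" "g a \<in> carrier G" by auto
  then have "(\<lambda>i. h (g i)) \<in> A \<rightarrow> carrier H" by (auto dest: Pi_mem)
  with insert g show ?case by simp
qed simp

lemma (in abelian_group_hom) hom_minus:
  "\<lbrakk>x \<in> carrier G; y \<in> carrier G\<rbrakk> \<Longrightarrow> h (x \<ominus>\<^bsub>G\<^esub> y) = h x \<ominus>\<^bsub>H\<^esub> h y"
  by (simp add: a_minus_def)

context left_module
begin

lemma smult_zero: "a \<in> carrier R \<Longrightarrow> a \<odot>\<^bsub>M\<^esub> \<zero>\<^bsub>M\<^esub> = \<zero>\<^bsub>M\<^esub>"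
  by (metis smult_closed smult_r_distr M.zero_closed M.add.r_cancel_one' M.l_zero)

lemma zero_smult: "x \<in> carrier M \<Longrightarrow> \<zero>\<^bsub>R\<^esub> \<odot>\<^bsub>M\<^esub> x = \<zero>\<^bsub>M\<^esub>"
  by (metis smult_closed smult_l_distr R.zero_closed M.add.r_cancel_one' R.l_zero)

lemma neg_one_smult: "x \<in> carrier M \<Longrightarrow> (\<ominus>\<^bsub>R\<^esub> \<one>\<^bsub>R\<^esub>) \<odot>\<^bsub>M\<^esub> x = \<ominus>\<^bsub>M\<^esub> x"
  by (metis M.minus_equality R.a_inv_closed R.l_neg R.one_closed smult_closed smult_l_distr
      smult_one zero_smult)

lemma smult_hom: "a \<in> carrier R \<Longrightarrow> abelian_group_hom M M (\<lambda>x. a \<odot>\<^bsub>M\<^esub> x)"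
  by (intro abelian_group_homI') (auto intro: smult_closed smult_r_distr M.abelian_group_axioms)

lemma smult_minus:
  "\<lbrakk>a \<in> carrier R; x \<in> carrier M; y \<in> carrier M\<rbrakk> \<Longrightarrow>
     a \<odot>\<^bsub>M\<^esub> (x \<ominus>\<^bsub>M\<^esub> y) = a \<odot>\<^bsub>M\<^esub> x \<ominus>\<^bsub>M\<^esub> a \<odot>\<^bsub>M\<^esub> y"
  by (rule abelian_group_hom.hom_minus[OF smult_hom])

lemma smult_finsum:
  "\<lbrakk>a \<in> carrier R; finite A; g \<in> A \<rightarrow> carrier M\<rbrakk> \<Longrightarrow>
     a \<odot>\<^bsub>M\<^esub> finsum M g A = finsum M (\<lambda>i. a \<odot>\<^bsub>M\<^esub> g i) A"
  by (rule abelian_group_hom.hom_finsum[OF smult_hom])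

text \<open>Negatives are multiples by the scalar -1, so closure under them follows from closure
  under scalars.\<close>

lemma submoduleI:
  assumes "N \<subseteq> carrier M" "\<zero>\<^bsub>M\<^esub> \<in> N"
    and "\<And>x y. \<lbrakk>x \<in> N; y \<in> N\<rbrakk> \<Longrightarrow> x \<oplus>\<^bsub>M\<^esub> y \<in> N"
    and "\<And>a x. \<lbrakk>a \<in> carrier R; x \<in> N\<rbrakk> \<Longrightarrow> a \<odot>\<^bsub>M\<^esub> x \<in> N"
  shows "submodule N R M"
proof -
  have "\<ominus>\<^bsub>M\<^esub> x \<in> N" if "x \<in> N" for x
    using assms(1) assms(4)[of "\<ominus>\<^bsub>R\<^esub> \<one>\<^bsub>R\<^esub>" x] that neg_one_smult[of x] by auto
  then show ?thesis
    by (intro submodule.intro subgroup.intro submodule_axioms.intro)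
      (use assms in \<open>auto simp flip: a_inv_def\<close>)
qed

lemma submodule_carrier: "submodule (carrier M) R M"
  by (rule submoduleI) (auto intro: smult_closed)

lemma submodule_zero: "submodule {\<zero>\<^bsub>M\<^esub>} R M"
  by (rule submoduleI) (auto simp: smult_zero)

end

lemma submoduleD:
  assumes "submodule N R M"
  shows "N \<subseteq> carrier M" "\<zero>\<^bsub>M\<^esub> \<in> N" "\<And>x y. \<lbrakk>x \<in> N; y \<in> N\<rbrakk> \<Longrightarrow> x \<oplus>\<^bsub>M\<^esub> y \<in> N"
    "\<And>x. x \<in> N \<Longrightarrow> \<ominus>\<^bsub>M\<^esub> x \<in> N"
    "\<And>a x. \<lbrakk>a \<in> carrier R; x \<in> N\<rbrakk> \<Longrightarrow> a \<odot>\<^bsub>M\<^esub> x \<in> N"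
proof -
  interpret submodule N R M by fact
  show "N \<subseteq> carrier M" "\<zero>\<^bsub>M\<^esub> \<in> N" "\<And>x y. \<lbrakk>x \<in> N; y \<in> N\<rbrakk> \<Longrightarrow> x \<oplus>\<^bsub>M\<^esub> y \<in> N"
    "\<And>x. x \<in> N \<Longrightarrow> \<ominus>\<^bsub>M\<^esub> x \<in> N"
    "\<And>a x. \<lbrakk>a \<in> carrier R; x \<in> N\<rbrakk> \<Longrightarrow> a \<odot>\<^bsub>M\<^esub> x \<in> N"
    using subset one_closed m_closed m_inv_closed by (auto simp: a_inv_def)
qed

lemma submodule_abelian_subgroup:
  assumes "left_module R M" "submodule N R M"
  shows "abelian_subgroup N M"
proof -
  interpret left_module R M by fact
  show ?thesis
    using assms(2) M.abelian_group_axioms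
    by (intro abelian_subgroupI3 additive_subgroup.intro) (auto simp: submodule_def)
qed

lemma submodule_diff:
  "\<lbrakk>submodule N R M; x \<in> N; y \<in> N\<rbrakk> \<Longrightarrow> x \<ominus>\<^bsub>M\<^esub> y \<in> N"
  by (simp add: a_minus_def submoduleD)

section \<open>Homomorphisms, transfer of structure, images and preimages of submodules\<close>

lemma lmod_homD:
  assumes "f \<in> lmod_hom R M N"
  shows "f \<in> carrier M \<rightarrow> carrier N"
    "\<And>x. x \<in> carrier M \<Longrightarrow> f x \<in> carrier N"
    "\<And>x y. \<lbrakk>x \<in> carrier M; y \<in> carrier M\<rbrakk> \<Longrightarrow> f (x \<oplus>\<^bsub>M\<^esub> y) = f x \<oplus>\<^bsub>N\<^esub> f y"
    "\<And>a x. \<lbrakk>a \<in> carrier R; x \<in> carrier M\<rbrakk> \<Longrightarrow> f (a \<odot>\<^bsub>M\<^esub> x) = a \<odot>\<^bsub>N\<^esub> f x"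
  using assms by (auto simp: lmod_hom_def)

lemma lmod_homI:
  assumes "\<And>x. x \<in> carrier M \<Longrightarrow> f x \<in> carrier N"
    "\<And>x y. \<lbrakk>x \<in> carrier M; y \<in> carrier M\<rbrakk> \<Longrightarrow> f (x \<oplus>\<^bsub>M\<^esub> y) = f x \<oplus>\<^bsub>N\<^esub> f y"
    "\<And>a x. \<lbrakk>a \<in> carrier R; x \<in> carrier M\<rbrakk> \<Longrightarrow> f (a \<odot>\<^bsub>M\<^esub> x) = a \<odot>\<^bsub>N\<^esub> f x"
  shows "f \<in> lmod_hom R M N"
  using assms by (auto simp: lmod_hom_def)

lemma left_module_abelian_group: "left_module R M \<Longrightarrow> abelian_group M"
  by (rule left_module.axioms)

lemma lmod_hom_abelian_group_hom:
  assumes "f \<in> lmod_hom R M N" "left_module R M" "left_module R N"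
  shows "abelian_group_hom M N f"
  by (intro abelian_group_homI' left_module_abelian_group[OF assms(2)]
      left_module_abelian_group[OF assms(3)] lmod_homD[OF assms(1)])

lemma lmod_hom_comp:
  "\<lbrakk>f \<in> lmod_hom R M N; g \<in> lmod_hom R N P\<rbrakk> \<Longrightarrow> g \<circ> f \<in> lmod_hom R M P"
  by (auto simp: lmod_hom_def Pi_iff)

lemma lmod_hom_inv:
  assumes f: "f \<in> lmod_hom R M N" and bij: "bij_betw f (carrier M) (carrier N)"
    and M: "left_module R M"
  shows "inv_into (carrier M) f \<in> lmod_hom R N M"
proof -
  interpret left_module R M by fact
  let ?g = "inv_into (carrier M) f"
  have g: "?g y \<in> carrier M" "f (?g y) = y" if "y \<in> carrier N" for y
    using that bij by (auto simp: bij_betw_def inv_into_into f_inv_into_f)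
  have gf: "?g (f x) = x" if "x \<in> carrier M" for x
    using that bij by (simp add: bij_betw_def)
  show ?thesis
  proof (rule lmod_homI)
    fix x y assume "x \<in> carrier N" "y \<in> carrier N"
    then show "?g (x \<oplus>\<^bsub>N\<^esub> y) = ?g x \<oplus>\<^bsub>M\<^esub> ?g y"
      using gf[of "?g x \<oplus>\<^bsub>M\<^esub> ?g y"] g lmod_homD[OF f] by simp
  next
    fix a y assume "a \<in> carrier R" "y \<in> carrier N"
    then show "?g (a \<odot>\<^bsub>N\<^esub> y) = a \<odot>\<^bsub>M\<^esub> ?g y"
      using gf[of "a \<odot>\<^bsub>M\<^esub> ?g y"] g lmod_homD[OF f] smult_closed by simp
  qed (use g in auto)
qed

text \<open>Every module law is an equation that may be checked after applying the injective map
  \<open>f\<close>; negatives exist because \<open>f\<close> is onto. This avoids verifying the laws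
  directly for quotients and renamed modules, whose operations are awkward to compute with.\<close>

lemma left_module_pullback:
  assumes N: "left_module R N"
    and bij: "bij_betw f (carrier M) (carrier N)"
    and zero: "\<zero>\<^bsub>M\<^esub> \<in> carrier M" "f \<zero>\<^bsub>M\<^esub> = \<zero>\<^bsub>N\<^esub>"
    and add: "\<And>x y. \<lbrakk>x \<in> carrier M; y \<in> carrier M\<rbrakk> \<Longrightarrow>
      x \<oplus>\<^bsub>M\<^esub> y \<in> carrier M \<and> f (x \<oplus>\<^bsub>M\<^esub> y) = f x \<oplus>\<^bsub>N\<^esub> f y"
    and smult: "\<And>a x. \<lbrakk>a \<in> carrier R; x \<in> carrier M\<rbrakk> \<Longrightarrow>
      a \<odot>\<^bsub>M\<^esub> x \<in> carrier M \<and> f (a \<odot>\<^bsub>M\<^esub> x) = a \<odot>\<^bsub>N\<^esub> f x"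
  shows "left_module R M"
proof -
  interpret N: left_module R N by fact
  have f: "f x \<in> carrier N" if "x \<in> carrier M" for x using that bij by (auto simp: bij_betw_def)
  have eq: "x = y" if "f x = f y" "x \<in> carrier M" "y \<in> carrier M" for x y
    using that bij by (auto simp: bij_betw_def inj_on_def)
  have "abelian_group M"
  proof (rule abelian_groupI)
    fix x assume x: "x \<in> carrier M"
    then have "\<ominus>\<^bsub>N\<^esub> f x \<in> f ` carrier M" using f bij by (simp add: bij_betw_def)
    then obtain y where y: "y \<in> carrier M" "f y = \<ominus>\<^bsub>N\<^esub> f x" by auto
    then have "y \<oplus>\<^bsub>M\<^esub> x = \<zero>\<^bsub>M\<^esub>"
      by (intro eq) (use x f add zero in \<open>auto simp: N.M.l_neg\<close>)
    with y show "\<exists>y\<in>carrier M. y \<oplus>\<^bsub>M\<^esub> x = \<zero>\<^bsub>M\<^esub>" by auto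
  next
    fix x y z assume x: "x \<in> carrier M" "y \<in> carrier M" "z \<in> carrier M"
    show "x \<oplus>\<^bsub>M\<^esub> y \<oplus>\<^bsub>M\<^esub> z = x \<oplus>\<^bsub>M\<^esub> (y \<oplus>\<^bsub>M\<^esub> z)"
      by (intro eq) (use x f add in \<open>auto simp: N.M.a_assoc\<close>)
  next
    fix x y assume x: "x \<in> carrier M" "y \<in> carrier M"
    show "x \<oplus>\<^bsub>M\<^esub> y = y \<oplus>\<^bsub>M\<^esub> x"
      by (intro eq) (use x f add N.M.a_comm in \<open>auto\<close>)
  next
    fix x assume x: "x \<in> carrier M"
    show "\<zero>\<^bsub>M\<^esub> \<oplus>\<^bsub>M\<^esub> x = x"
      by (intro eq) (use x f add zero in \<open>auto\<close>)
  qed (use zero add in auto)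
  then interpret M: abelian_group M .
  show ?thesis
  proof (intro left_module.intro left_module_axioms.intro N.R.ring_axioms M.abelian_group_axioms)
    fix a b x assume a: "a \<in> carrier R" "b \<in> carrier R" "x \<in> carrier M"
    show "(a \<oplus>\<^bsub>R\<^esub> b) \<odot>\<^bsub>M\<^esub> x = a \<odot>\<^bsub>M\<^esub> x \<oplus>\<^bsub>M\<^esub> b \<odot>\<^bsub>M\<^esub> x"
      by (intro eq) (use a add smult f in \<open>auto simp: N.smult_l_distr\<close>)
    show "(a \<otimes>\<^bsub>R\<^esub> b) \<odot>\<^bsub>M\<^esub> x = a \<odot>\<^bsub>M\<^esub> (b \<odot>\<^bsub>M\<^esub> x)"
      by (intro eq) (use a add smult f in \<open>auto simp: N.smult_assoc\<close>)
  next
    fix a x y assume a: "a \<in> carrier R" "x \<in> carrier M" "y \<in> carrier M"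
    show "a \<odot>\<^bsub>M\<^esub> (x \<oplus>\<^bsub>M\<^esub> y) = a \<odot>\<^bsub>M\<^esub> x \<oplus>\<^bsub>M\<^esub> a \<odot>\<^bsub>M\<^esub> y"
      by (intro eq) (use a add smult f in \<open>auto simp: N.smult_r_distr\<close>)
  next
    fix x assume a: "x \<in> carrier M"
    show "\<one>\<^bsub>R\<^esub> \<odot>\<^bsub>M\<^esub> x = x"
      by (intro eq) (use a smult f N.smult_one in \<open>auto\<close>)
  qed (use smult in auto)
qed

lemma submodule_vimage:
  assumes f: "f \<in> lmod_hom R M N" and M: "left_module R M" and N: "left_module R N"
    and U: "submodule U R N"
  shows "submodule {x \<in> carrier M. f x \<in> U} R M"
proof -
  interpret M: left_module R M by fact
  interpret f: abelian_group_hom M N f by (rule lmod_hom_abelian_group_hom[OF f M N])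
  show ?thesis
    by (rule M.submoduleI) (use submoduleD[OF U] lmod_homD[OF f] M.smult_closed in auto)
qed

lemma submodule_image:
  assumes f: "f \<in> lmod_hom R M N" and M: "left_module R M" and N: "left_module R N"
    and U: "submodule U R M"
  shows "submodule (f ` U) R N"
proof -
  interpret M: left_module R M by fact
  interpret N: left_module R N by fact
  interpret f: abelian_group_hom M N f by (rule lmod_hom_abelian_group_hom[OF f M N])
  note U = submoduleD[OF U]
  have "f x \<oplus>\<^bsub>N\<^esub> f y \<in> f ` U" if "x \<in> U" "y \<in> U" for x y
    using that U f.hom_add[of x y] by (metis imageI subsetD)
  moreover have "a \<odot>\<^bsub>N\<^esub> f x \<in> f ` U" if "a \<in> carrier R" "x \<in> U" for a x
    using that U lmod_homD(4)[OF f, of a x] by (metis imageI subsetD)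
  moreover have "\<zero>\<^bsub>N\<^esub> \<in> f ` U" using U f.hom_zero by (metis imageI)
  ultimately show ?thesis by (intro N.submoduleI) (use U in auto)
qed

lemma submodule_kernel:
  assumes f: "f \<in> lmod_hom R M N" and M: "left_module R M" and N: "left_module R N"
  shows "submodule (a_kernel M N f) R M"
  using submodule_vimage[OF f M N left_module.submodule_zero[OF N]] by (simp add: a_kernel_eq)

lemma simple_module_iso:
  assumes "lmod_iso R M N" "left_module R M" "simple_module R N"
  shows "simple_module R M"
proof -
  interpret M: left_module R M by fact
  from assms(3) have N: "left_module R N" by (simp add: simple_module_def)
  then interpret N: left_module R N .
  obtain f where f: "f \<in> lmod_hom R M N" and bij: "bij_betw f (carrier M) (carrier N)"
    using assms(1) by (auto simp: lmod_iso_def)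
  interpret f: abelian_group_hom M N f by (rule lmod_hom_abelian_group_hom[OF f assms(2) N])
  have inj: "inj_on f (carrier M)" and surj: "f ` carrier M = carrier N"
    using bij by (auto simp: bij_betw_def)
  have "carrier M \<noteq> {\<zero>\<^bsub>M\<^esub>}"
    using assms(3) surj by (auto simp: simple_module_def)
  moreover have "U = {\<zero>\<^bsub>M\<^esub>} \<or> U = carrier M" if U: "submodule U R M" for U
  proof -
    have "U \<subseteq> carrier M" by (rule submoduleD[OF U])
    have "f ` U = {\<zero>\<^bsub>N\<^esub>} \<or> f ` U = carrier N"
      using submodule_image[OF f assms(2) N U] assms(3) by (simp add: simple_module_def)
    then have "f ` U = f ` {\<zero>\<^bsub>M\<^esub>} \<or> f ` U = f ` carrier M" using surj by auto
    then show ?thesis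
      using inj_on_image_eq_iff[OF inj] \<open>U \<subseteq> carrier M\<close> M.M.zero_closed
      by (metis empty_subsetI insert_subset subset_refl)
  qed
  ultimately show ?thesis using assms(2) by (simp add: simple_module_def)
qed

section \<open>Submodules and quotients as modules\<close>

lemma left_module_submodule:
  assumes M: "left_module R M" and U: "submodule U R M"
  shows "left_module R (M\<lparr>carrier := U\<rparr>)"
proof -
  interpret left_module R M by fact
  note U = submoduleD[OF U]
  have [simp]: "x \<in> carrier M" if "x \<in> U" for x using U that by auto
  show ?thesis
  proof (intro left_module.intro left_module_axioms.intro abelian_groupI R.ring_axioms)
    fix x assume "x \<in> carrier (M\<lparr>carrier := U\<rparr>)"
    then show "\<exists>y\<in>carrier (M\<lparr>carrier := U\<rparr>). y \<oplus>\<^bsub>M\<lparr>carrier := U\<rparr>\<^esub> x = \<zero>\<^bsub>M\<lparr>carrier := U\<rparr>\<^esub>"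
      using U by (intro bexI[of _ "\<ominus>\<^bsub>M\<^esub> x"]) (auto simp: M.l_neg)
  qed (use U in \<open>auto simp: M.a_ac smult_l_distr smult_r_distr smult_assoc smult_one\<close>)
qed

text \<open>The first isomorphism theorem. The cosets of the kernel are the fibres of
  \<open>g\<close>, so the induced map to \<open>S\<close> is a bijection, and the quotient receives
  its module laws from \<open>S\<close> through \<open>left_module_pullback\<close>.\<close>

lemma quot_module_iso:
  assumes M: "left_module R M" and S: "left_module R S"
    and g: "g \<in> lmod_hom R M S" "g ` carrier M = carrier S"
  shows "left_module R (quot_module M (a_kernel M S g))"
    "lmod_iso R (quot_module M (a_kernel M S g)) S"
proof -
  let ?K = "a_kernel M S g"
  interpret M: left_module R M by fact
  interpret S: left_module R S by fact
  interpret g: abelian_group_hom M S g by (rule lmod_hom_abelian_group_hom[OF g(1) M S])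
  have carr: "carrier (quot_module M ?K) = {?K +>\<^bsub>M\<^esub> x |x. x \<in> carrier M}"
    by (auto simp: quot_module_def A_RCOSETS_def')
  have coset_eq: "?K +>\<^bsub>M\<^esub> x = {y \<in> carrier M. g y = g x}" if "x \<in> carrier M" for x
  proof (intro Set.set_eqI iffI)
    fix y assume "y \<in> ?K +>\<^bsub>M\<^esub> x"
    then obtain k where "k \<in> carrier M" "g k = \<zero>\<^bsub>S\<^esub>" "y = k \<oplus>\<^bsub>M\<^esub> x"
      unfolding a_r_coset_def' a_kernel_eq by blast
    then show "y \<in> {y \<in> carrier M. g y = g x}" using that by simp
  next
    fix y assume "y \<in> {y \<in> carrier M. g y = g x}"
    then have y: "y \<in> carrier M" "g y = g x" by auto
    have "g (y \<ominus>\<^bsub>M\<^esub> x) = g x \<oplus>\<^bsub>S\<^esub> \<ominus>\<^bsub>S\<^esub> g x"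
      using that y g.hom_minus[of y x] by (simp only: a_minus_def)
    then have "y \<ominus>\<^bsub>M\<^esub> x \<in> ?K"
      unfolding a_kernel_eq using that y g.hom_closed[OF that] by (simp add: S.M.r_neg del: g.hom_minus)
    moreover have "y = (y \<ominus>\<^bsub>M\<^esub> x) \<oplus>\<^bsub>M\<^esub> x"
      using that y by (simp add: M.M.a_assoc M.M.l_neg a_minus_def)
    ultimately show "y \<in> ?K +>\<^bsub>M\<^esub> x" unfolding a_r_coset_def' by blast
  qed
  interpret K: abelian_subgroup ?K M by (rule g.abelian_subgroup_a_kernel)
  define q where "q X = the_elem (g ` X)" for X
  have q: "q (?K +>\<^bsub>M\<^esub> x) = g x" if "x \<in> carrier M" for x
  proof -
    have "g ` (?K +>\<^bsub>M\<^esub> x) = {g x}" using that by (auto simp: coset_eq)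
    then show ?thesis by (simp add: q_def)
  qed
  have add: "(?K +>\<^bsub>M\<^esub> x) \<oplus>\<^bsub>quot_module M ?K\<^esub> (?K +>\<^bsub>M\<^esub> y) = ?K +>\<^bsub>M\<^esub> (x \<oplus>\<^bsub>M\<^esub> y)"
    if "x \<in> carrier M" "y \<in> carrier M" for x y
    using that by (simp add: quot_module_def K.a_rcos_sum)
  have smult: "a \<odot>\<^bsub>quot_module M ?K\<^esub> (?K +>\<^bsub>M\<^esub> x) = ?K +>\<^bsub>M\<^esub> (a \<odot>\<^bsub>M\<^esub> x)"
    if "a \<in> carrier R" "x \<in> carrier M" for a x
  proof -
    have "?K +>\<^bsub>M\<^esub> (a \<odot>\<^bsub>M\<^esub> y) = ?K +>\<^bsub>M\<^esub> (a \<odot>\<^bsub>M\<^esub> x)" if "y \<in> ?K +>\<^bsub>M\<^esub> x" for y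
      using that \<open>a \<in> carrier R\<close> \<open>x \<in> carrier M\<close>
      by (auto simp: coset_eq M.smult_closed lmod_homD[OF g(1)])
    moreover have "?K +>\<^bsub>M\<^esub> x \<noteq> {}" using that by (auto simp: coset_eq)
    ultimately show ?thesis by (simp add: quot_module_def)
  qed
  have bij: "bij_betw q (carrier (quot_module M ?K)) (carrier S)"
  proof (rule bij_betw_imageI)
    show "inj_on q (carrier (quot_module M ?K))"
    proof (rule inj_onI)
      fix X Y assume "X \<in> carrier (quot_module M ?K)" "Y \<in> carrier (quot_module M ?K)" "q X = q Y"
      then obtain x y where "x \<in> carrier M" "X = ?K +>\<^bsub>M\<^esub> x" "y \<in> carrier M" "Y = ?K +>\<^bsub>M\<^esub> y"
        "g x = g y" using q by (auto simp: carr)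
      then show "X = Y" using coset_eq by simp
    qed
    show "q ` carrier (quot_module M ?K) = carrier S"
      unfolding carr g(2)[symmetric] by (force simp: q image_iff)
  qed
  have zero: "\<zero>\<^bsub>quot_module M ?K\<^esub> = ?K +>\<^bsub>M\<^esub> \<zero>\<^bsub>M\<^esub>"
    by (simp add: quot_module_def K.a_subset)
  show "left_module R (quot_module M ?K)"
    by (rule left_module_pullback[OF S bij]) (auto simp: carr zero add smult q lmod_homD[OF g(1)]
       M.smult_closed intro: exI[of _ "\<zero>\<^bsub>M\<^esub>"])
  show "lmod_iso R (quot_module M ?K) S"
    unfolding lmod_iso_def
    by (rule bexI[of _ q], rule bij, rule lmod_homI)
      (auto simp: carr add smult q lmod_homD[OF g(1)] M.smult_closed)
qed

text \<open>Needed where no surjection onto a known module is at hand, for the radical quotient and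
  for arbitrary composition factors. Only coset arithmetic in \<open>M\<close> enters; the module
  laws of the quotient do not.\<close>

lemma quot_module_proj:
  assumes M: "left_module R M" and K: "submodule K R M"
  shows "(\<lambda>x. K +>\<^bsub>M\<^esub> x) \<in> lmod_hom R M (quot_module M K)"
    "(\<lambda>x. K +>\<^bsub>M\<^esub> x) ` carrier M = carrier (quot_module M K)"
    "{x \<in> carrier M. K +>\<^bsub>M\<^esub> x = K} = K"
proof -
  interpret M: left_module R M by fact
  interpret K: abelian_subgroup K M by (rule submodule_abelian_subgroup[OF M K])
  note K' = submoduleD[OF K]
  show "(\<lambda>x. K +>\<^bsub>M\<^esub> x) ` carrier M = carrier (quot_module M K)"
    by (auto simp: quot_module_def A_RCOSETS_def')
  show "(\<lambda>x. K +>\<^bsub>M\<^esub> x) \<in> lmod_hom R M (quot_module M K)"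
  proof (rule lmod_homI)
    fix a x assume a: "a \<in> carrier R" "x \<in> carrier M"
    have "K +>\<^bsub>M\<^esub> (a \<odot>\<^bsub>M\<^esub> y) = K +>\<^bsub>M\<^esub> (a \<odot>\<^bsub>M\<^esub> x)" if "y \<in> K +>\<^bsub>M\<^esub> x" for y
    proof -
      from that obtain k where k: "k \<in> K" "y = k \<oplus>\<^bsub>M\<^esub> x"
        unfolding a_r_coset_def' by blast
      with K' have "k \<in> carrier M" by auto
      with a k have "a \<odot>\<^bsub>M\<^esub> y = a \<odot>\<^bsub>M\<^esub> k \<oplus>\<^bsub>M\<^esub> a \<odot>\<^bsub>M\<^esub> x" by (simp add: M.smult_r_distr)
      moreover have "a \<odot>\<^bsub>M\<^esub> k \<in> K" using a k K' by auto
      ultimately have "a \<odot>\<^bsub>M\<^esub> y \<in> K +>\<^bsub>M\<^esub> (a \<odot>\<^bsub>M\<^esub> x)" by (auto simp: a_r_coset_def')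
      then show ?thesis
        using M.M.a_repr_independence[OF _ _ K.a_subgroup] a M.smult_closed by metis
    qed
    moreover have "K +>\<^bsub>M\<^esub> x \<noteq> {}" using K.a_rcos_self[OF a(2)] by blast
    ultimately show "K +>\<^bsub>M\<^esub> (a \<odot>\<^bsub>M\<^esub> x) = a \<odot>\<^bsub>quot_module M K\<^esub> (K +>\<^bsub>M\<^esub> x)"
      by (simp add: quot_module_def)
  qed (auto simp: quot_module_def K.a_rcos_sum A_RCOSETS_def')
  show "{x \<in> carrier M. K +>\<^bsub>M\<^esub> x = K} = K"
  proof (intro Set.set_eqI iffI)
    fix x assume "x \<in> {x \<in> carrier M. K +>\<^bsub>M\<^esub> x = K}"
    then show "x \<in> K" using K.a_rcos_self[of x] by auto
  next
    fix x assume "x \<in> K"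
    then show "x \<in> {x \<in> carrier M. K +>\<^bsub>M\<^esub> x = K}"
      using K'(1) K.a_rcos_const[of x] by auto
  qed
qed

section \<open>Scalar actions and linear combinations\<close>

text \<open>This is how identities between additive maps are reduced to basis elements, for words in
  the generators as well as for infinite paths; \<open>A\<close> keeps track of the admissible basis
  elements.\<close>

lemma poly_mapping_single_induct [consumes 1, case_names zero add]:
  assumes "Poly_Mapping.keys f \<subseteq> A" "P 0"
    and "\<And>k c f. \<lbrakk>k \<in> A; Poly_Mapping.keys f \<subseteq> A; P f\<rbrakk> \<Longrightarrow> P (Poly_Mapping.single k c + f)"
  shows "P f"
  using assms(1)
proof (induction f rule: update_induct)
  case (update f a b)
  have "Poly_Mapping.update a b f = Poly_Mapping.single a b + f"
    using update(1)
    by (intro poly_mapping_eqI) (auto simp: lookup_update lookup_add lookup_single when_def in_keys_iff)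
  moreover have "insert a (Poly_Mapping.keys f) \<subseteq> A" using update by (simp add: keys_update)
  ultimately show ?case using assms(3)[of a f b] update by simp
qed (use assms(2) in auto)

text \<open>A vector space over the field type, without a record of scalars: on a module over the
  algebra, K acts only through the algebra, so its action is kept as a plain function
  \<open>sc\<close>.\<close>

locale scalar_action = abelian_group M for M (structure) +
  fixes sc :: "'k::field \<Rightarrow> 'a \<Rightarrow> 'a"
  assumes sc_closed: "x \<in> carrier M \<Longrightarrow> sc c x \<in> carrier M"
    and sc_add_left: "x \<in> carrier M \<Longrightarrow> sc (c + d) x = sc c x \<oplus> sc d x"
    and sc_add: "\<lbrakk>x \<in> carrier M; y \<in> carrier M\<rbrakk> \<Longrightarrow> sc c (x \<oplus> y) = sc c x \<oplus> sc c y"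
    and sc_mult: "x \<in> carrier M \<Longrightarrow> sc (c * d) x = sc c (sc d x)"
    and sc_one: "x \<in> carrier M \<Longrightarrow> sc 1 x = x"
begin

text \<open>The linear map that sends the basis vector \<open>k\<close> to \<open>z k\<close>. It
  serves twice: for polynomials acting through their words, and for maps prescribed on a basis of
  paths.\<close>

definition lincomb :: "('i \<Rightarrow> 'a) \<Rightarrow> ('i \<Rightarrow>\<^sub>0 'k) \<Rightarrow> 'a" where
  "lincomb z y = (\<Oplus>k\<in>Poly_Mapping.keys y. sc (Poly_Mapping.lookup y k) (z k))"

lemma sc_zero_left: "x \<in> carrier M \<Longrightarrow> sc 0 x = \<zero>"
  by (metis add.r_cancel_one' add_0 sc_add_left sc_closed)

lemma sc_hom: "abelian_group_hom M M (sc c)"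
  by (intro abelian_group_homI') (auto intro: sc_closed sc_add abelian_group_axioms)

lemma sc_zero: "sc c \<zero> = \<zero>"
  by (rule abelian_group_hom.hom_zero[OF sc_hom])

text \<open>Supports shrink under addition because of cancellation; summands are therefore compared
  over a common finite set, with zero coefficients allowed.\<close>

lemma lincomb_superset:
  assumes "finite A" "Poly_Mapping.keys y \<subseteq> A" "z \<in> A \<rightarrow> carrier M"
  shows "lincomb z y = (\<Oplus>k\<in>A. sc (Poly_Mapping.lookup y k) (z k))"
  unfolding lincomb_def
  by (rule add.finprod_mono_neutral_cong_left)
    (use assms in \<open>auto simp: in_keys_iff sc_zero_left sc_closed Pi_iff\<close>)

lemma lincomb_closed: "z \<in> Poly_Mapping.keys y \<rightarrow> carrier M \<Longrightarrow> lincomb z y \<in> carrier M"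
  unfolding lincomb_def by (rule finsum_closed) (auto simp: sc_closed Pi_iff)

lemma lincomb_single:
  assumes "z k \<in> carrier M"
  shows "lincomb z (Poly_Mapping.single k c) = sc c (z k)"
proof -
  have "lincomb z (Poly_Mapping.single k c) = (\<Oplus>j\<in>{k}. sc (Poly_Mapping.lookup (Poly_Mapping.single k c) j) (z j))"
    by (rule lincomb_superset) (use assms in auto)
  then show ?thesis using assms sc_closed by simp
qed

lemma lincomb_add:
  assumes "z \<in> Poly_Mapping.keys f \<rightarrow> carrier M" "z \<in> Poly_Mapping.keys g \<rightarrow> carrier M"
  shows "lincomb z (f + g) = lincomb z f \<oplus> lincomb z g"
proof -
  let ?A = "Poly_Mapping.keys f \<union> Poly_Mapping.keys g"
  have z: "z \<in> ?A \<rightarrow> carrier M" using assms by auto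
  have eq: "lincomb z h = (\<Oplus>k\<in>?A. sc (Poly_Mapping.lookup h k) (z k))"
    if "Poly_Mapping.keys h \<subseteq> ?A" for h
    by (rule lincomb_superset) (use that z in auto)
  have "lincomb z (f + g) = (\<Oplus>k\<in>?A. sc (Poly_Mapping.lookup f k) (z k) \<oplus> sc (Poly_Mapping.lookup g k) (z k))"
    unfolding eq[OF keys_add]
    by (rule finsum_cong') (use z in \<open>auto simp: lookup_add sc_add_left sc_closed Pi_iff\<close>)
  also have "\<dots> = lincomb z f \<oplus> lincomb z g"
    by (subst finsum_addf) (use z in \<open>auto simp: sc_closed eq Pi_iff\<close>)
  finally show ?thesis .
qed

lemma lincomb_scale:
  assumes "z \<in> Poly_Mapping.keys y \<rightarrow> carrier M"
  shows "lincomb z (Poly_Mapping.map ((*) c) y) = sc c (lincomb z y)"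
proof -
  have "lincomb z (Poly_Mapping.map ((*) c) y) =
      (\<Oplus>k\<in>Poly_Mapping.keys y. sc (Poly_Mapping.lookup (Poly_Mapping.map ((*) c) y) k) (z k))"
    by (rule lincomb_superset) (use assms in \<open>auto simp: in_keys_iff Poly_Mapping.map.rep_eq when_def Pi_iff\<close>)
  also have "\<dots> = (\<Oplus>k\<in>Poly_Mapping.keys y. sc c (sc (Poly_Mapping.lookup y k) (z k)))"
    by (rule finsum_cong') (use assms in \<open>auto simp: Poly_Mapping.map.rep_eq in_keys_iff sc_closed sc_mult Pi_iff\<close>)
  also have "\<dots> = sc c (lincomb z y)"
    unfolding lincomb_def
    by (rule abelian_group_hom.hom_finsum[OF sc_hom, symmetric]) (use assms sc_closed in \<open>auto simp: Pi_iff\<close>)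
  finally show ?thesis .
qed

end

section \<open>The free algebra and its quotient\<close>

lemma free_algebra_simps [simp]:
  "add (free_algebra U) = (+)" "mult (free_algebra U) = (*)"
  "zero (free_algebra U) = 0" "one (free_algebra U) = 1"
  by (simp_all add: free_algebra_def)

lemma free_algebra_carrier:
  "f \<in> carrier (free_algebra U) \<longleftrightarrow> Poly_Mapping.keys f \<subseteq> {w. set (letters w) \<subseteq> U}"
  by (auto simp: free_algebra_def)

lemma letters_simps [simp]: "letters (u + v) = letters u @ letters v" "letters 0 = []"
  by (simp_all add: plus_free_word_def zero_free_word_def)

lemma free_algebra_closed:
  assumes "f \<in> carrier (free_algebra U)" "g \<in> carrier (free_algebra U)"
  shows "f + g \<in> carrier (free_algebra U)" "f * g \<in> carrier (free_algebra U)"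
    "- f \<in> carrier (free_algebra U)" "f - g \<in> carrier (free_algebra U)"
proof -
  have *: "f + g \<in> carrier (free_algebra U)" if "f \<in> carrier (free_algebra U)" "g \<in> carrier (free_algebra U)" for f g
    using that keys_add[of f g] by (auto simp: free_algebra_carrier)
  show "f * g \<in> carrier (free_algebra U)"
    unfolding free_algebra_carrier
  proof
    fix w assume "w \<in> Poly_Mapping.keys (f * g)"
    then obtain u v where "w = u + v" "u \<in> Poly_Mapping.keys f" "v \<in> Poly_Mapping.keys g"
      using keys_mult[of f g] by auto
    with assms show "w \<in> {w. set (letters w) \<subseteq> U}" by (auto simp: free_algebra_carrier)
  qed
  have **: "- f \<in> carrier (free_algebra U)" if "f \<in> carrier (free_algebra U)" for f
    using that by (simp add: free_algebra_carrier in_keys_iff subset_iff)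
  show "f + g \<in> carrier (free_algebra U)" "- f \<in> carrier (free_algebra U)"
    using * ** assms by auto
  show "f - g \<in> carrier (free_algebra U)" using *[OF assms(1) **[OF assms(2)]] by simp
qed

lemma free_algebra_single: "set (letters w) \<subseteq> U \<Longrightarrow> Poly_Mapping.single w c \<in> carrier (free_algebra U)"
  by (simp add: free_algebra_carrier)

lemma free_algebra_gen: "g \<in> U \<Longrightarrow> gen g \<in> carrier (free_algebra U)"
  by (simp add: gen_def free_algebra_single)

lemma free_algebra_one: "1 \<in> carrier (free_algebra U)"
  by (simp add: free_algebra_carrier)

lemma free_algebra_zero: "0 \<in> carrier (free_algebra U)"
  by (simp add: free_algebra_carrier)

lemma free_algebra_sum:
  "(\<And>i. i \<in> A \<Longrightarrow> f i \<in> carrier (free_algebra U)) \<Longrightarrow> sum f A \<in> carrier (free_algebra U)"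
  by (induction A rule: infinite_finite_induct) (auto simp: free_algebra_closed free_algebra_zero)

lemma ring_free_algebra: "ring (free_algebra U :: ('g free_word \<Rightarrow>\<^sub>0 'k::field) ring)"
  by (rule ringI; (rule abelian_groupI)?; (rule monoidI)?)
    (auto simp: free_algebra_closed free_algebra_one free_algebra_zero algebra_simps
       intro!: bexI[of _ "- x" for x])

lemma free_algebra_a_inv: "f \<in> carrier (free_algebra U) \<Longrightarrow> \<ominus>\<^bsub>free_algebra U\<^esub> f = - f"
  using ring.is_abelian_group[OF ring_free_algebra[of U]]
  by (intro abelian_group.minus_equality) (auto simp: free_algebra_closed)

lemma free_algebra_finsum:
  assumes "\<And>i. i \<in> A \<Longrightarrow> f i \<in> carrier (free_algebra U)" "finite A"
  shows "finsum (free_algebra U) f A = sum f A"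
proof -
  interpret ring "free_algebra U" by (rule ring_free_algebra)
  show ?thesis using assms(2,1)
    by (induction A rule: finite_induct) (simp_all add: Pi_iff)
qed

lemma free_algebra_induct [consumes 1, case_names single add]:
  assumes "f \<in> carrier (free_algebra U)"
    and single: "\<And>w c. set (letters w) \<subseteq> U \<Longrightarrow> P (Poly_Mapping.single w c)"
    and add: "\<And>f g. \<lbrakk>f \<in> carrier (free_algebra U); g \<in> carrier (free_algebra U); P f; P g\<rbrakk> \<Longrightarrow> P (f + g)"
  shows "P f"
proof -
  have "Poly_Mapping.keys f \<subseteq> {w. set (letters w) \<subseteq> U}" using assms(1) by (simp add: free_algebra_carrier)
  then show ?thesis
  proof (induction f rule: poly_mapping_single_induct)
    case zero
    show ?case using single[of 0 0] by simp
  next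
    case (add k c f)
    then show ?case by (intro assms(3)) (auto simp: free_algebra_single free_algebra_carrier intro: single)
  qed
qed

section \<open>The Leavitt path algebra as a quotient of the free algebra\<close>

definition lpa_class :: "('v, 'e) pre_digraph \<Rightarrow> (('v, 'e) lpa_gen free_word \<Rightarrow>\<^sub>0 'k::field) \<Rightarrow> ('v, 'e, 'k) lpa_elem"
  where "lpa_class E f = lpa_ideal E +>\<^bsub>free_algebra (lpa_gens E)\<^esub> f"

lemma gens_simps [simp]:
  "Vertex v \<in> lpa_gens E \<longleftrightarrow> v \<in> verts E" "Edge e \<in> lpa_gens E \<longleftrightarrow> e \<in> arcs E"
  "Ghost e \<in> lpa_gens E \<longleftrightarrow> e \<in> arcs E"
  by (auto simp: lpa_gens_def)

lemma (in fin_digraph) lpa_relations_subset: "lpa_relations G \<subseteq> carrier (free_algebra (lpa_gens G))"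
  unfolding lpa_relations_def
  by (auto intro!: free_algebra_closed free_algebra_gen free_algebra_sum free_algebra_one free_algebra_zero
      simp: out_arcs_def)

lemma (in fin_digraph) ideal_lpa_ideal: "ideal (lpa_ideal G) (free_algebra (lpa_gens G))"
  unfolding lpa_ideal_def by (rule ring.genideal_ideal[OF ring_free_algebra lpa_relations_subset])

lemma (in fin_digraph) lpa_relations_lpa_ideal: "lpa_relations G \<subseteq> lpa_ideal G"
  unfolding lpa_ideal_def by (rule ring.genideal_self[OF ring_free_algebra lpa_relations_subset])

lemma (in fin_digraph) ring_LPA: "ring (LPA G)"
  unfolding LPA_def by (rule ideal.quotient_is_ring[OF ideal_lpa_ideal])

lemma carrier_LPA: "carrier (LPA E) = lpa_class E ` carrier (free_algebra (lpa_gens E))"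
  by (auto simp: LPA_def FactRing_def A_RCOSETS_def' lpa_class_def)

lemma lpa_class_closed:
  "f \<in> carrier (free_algebra (lpa_gens E)) \<Longrightarrow> lpa_class E f \<in> carrier (LPA E)"
  by (simp add: carrier_LPA)

lemma (in fin_digraph) lpa_class_simps:
  assumes "f \<in> carrier (free_algebra (lpa_gens G))" "g \<in> carrier (free_algebra (lpa_gens G))"
  shows "lpa_class G (f + g) = lpa_class G f \<oplus>\<^bsub>LPA G\<^esub> lpa_class G g"
    "lpa_class G (f * g) = lpa_class G f \<otimes>\<^bsub>LPA G\<^esub> lpa_class G g"
    "lpa_class G 1 = \<one>\<^bsub>LPA G\<^esub>"
proof -
  note h = ideal.rcos_ring_hom[OF ideal_lpa_ideal]
  show "lpa_class G (f + g) = lpa_class G f \<oplus>\<^bsub>LPA G\<^esub> lpa_class G g"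
    "lpa_class G (f * g) = lpa_class G f \<otimes>\<^bsub>LPA G\<^esub> lpa_class G g"
    "lpa_class G 1 = \<one>\<^bsub>LPA G\<^esub>"
    using ring_hom_add[OF h assms] ring_hom_mult[OF h assms] ring_hom_one[OF h]
    by (simp_all add: lpa_class_def LPA_def)
qed

lemma (in fin_digraph) lpa_class_one: "lpa_class G 1 = \<one>\<^bsub>LPA G\<^esub>"
  by (rule lpa_class_simps(3)[OF free_algebra_one free_algebra_one])

lemma (in fin_digraph) lpa_class_hom:
  "abelian_group_hom (free_algebra (lpa_gens G)) (LPA G) (lpa_class G)"
  using ring.is_abelian_group[OF ring_free_algebra] ring.is_abelian_group[OF ring_LPA]
  by (intro abelian_group_homI') (auto simp: lpa_class_simps lpa_class_closed)

lemma (in fin_digraph) lpa_class_zero: "lpa_class G 0 = \<zero>\<^bsub>LPA G\<^esub>"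
  using abelian_group_hom.hom_zero[OF lpa_class_hom] by simp

lemma (in fin_digraph) lpa_class_eqI:
  assumes "f - g \<in> lpa_relations G" "f \<in> carrier (free_algebra (lpa_gens G))"
    "g \<in> carrier (free_algebra (lpa_gens G))"
  shows "lpa_class G f = lpa_class G g"
proof -
  interpret I: ideal "lpa_ideal G" "free_algebra (lpa_gens G)" by (rule ideal_lpa_ideal)
  have "f - g \<in> lpa_ideal G" using assms(1) lpa_relations_lpa_ideal by blast
  then have "f \<in> lpa_ideal G +>\<^bsub>free_algebra (lpa_gens G)\<^esub> g"
    by (auto simp: a_r_coset_def' intro!: bexI[of _ "f - g"])
  then show ?thesis
    unfolding lpa_class_def using I.a_repr_independence[OF _ assms(3) I.a_subgroup] by metis
qed

lemma (in fin_digraph) lpa_class_sum: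
  assumes "\<And>i. i \<in> A \<Longrightarrow> f i \<in> carrier (free_algebra (lpa_gens G))" "finite A"
  shows "lpa_class G (sum f A) = finsum (LPA G) (\<lambda>i. lpa_class G (f i)) A"
  using abelian_group_hom.hom_finsum[OF lpa_class_hom, of A f] assms free_algebra_finsum[of A f]
  by (simp add: Pi_iff)

text \<open>A monomial is peeled off letter by letter until only its coefficient at the empty word
  is left, so scalars and generators generate the algebra as a ring. Homomorphisms and derivations
  are thereby determined by their behaviour on generators.\<close>

lemma (in fin_digraph) LPA_induct [consumes 1, case_names scalar gen add mult]:
  assumes "U \<in> carrier (LPA G)"
    and scalar: "\<And>c. P (lpa_class G (Poly_Mapping.single 0 c))"
    and gen: "\<And>g. g \<in> lpa_gens G \<Longrightarrow> P (lpa_class G (gen g))"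
    and add: "\<And>U V. \<lbrakk>U \<in> carrier (LPA G); V \<in> carrier (LPA G); P U; P V\<rbrakk> \<Longrightarrow> P (U \<oplus>\<^bsub>LPA G\<^esub> V)"
    and mult: "\<And>U V. \<lbrakk>U \<in> carrier (LPA G); V \<in> carrier (LPA G); P U; P V\<rbrakk> \<Longrightarrow> P (U \<otimes>\<^bsub>LPA G\<^esub> V)"
  shows "P U"
proof -
  have single: "P (lpa_class G (Poly_Mapping.single (Word w) c))" if "set w \<subseteq> lpa_gens G" for w c
    using that
  proof (induction w)
    case Nil
    show ?case using scalar[of c] by (simp add: zero_free_word_def)
  next
    case (Cons g w)
    have "Poly_Mapping.single (Word (g # w)) c = gen g * Poly_Mapping.single (Word w) c"
      by (simp add: gen_def mult_single plus_free_word_def)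
    with Cons gen[of g] show ?case
      by (auto simp: lpa_class_simps lpa_class_closed free_algebra_gen free_algebra_single intro!: mult)
  qed
  obtain f where U: "U = lpa_class G f" and f: "f \<in> carrier (free_algebra (lpa_gens G))"
    using assms(1) by (auto simp: carrier_LPA)
  from f have "P (lpa_class G f)"
  proof (induction rule: free_algebra_induct)
    case (single w c)
    then show ?case using \<open>\<And>w c. _ \<Longrightarrow> P (lpa_class G (Poly_Mapping.single (Word w) c))\<close>[of "letters w" c] by simp
  qed (auto simp: lpa_class_simps lpa_class_closed intro!: add)
  then show ?thesis by (simp add: U)
qed

section \<open>Representations of the generators\<close>

text \<open>A module unfolded into one operator per generator. In this form it can be modified by
  hand, which the action of residue classes does not permit. \<open>CK2\<close> carries no
  finiteness condition because the graph is finite, and \<open>sum_verts\<close> makes the action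
  unital.\<close>

locale lpa_rep = fin_digraph E + scalar_action M sc
  for E :: "('v, 'e) pre_digraph" and M (structure) and sc :: "'k::field \<Rightarrow> 'm \<Rightarrow> 'm" +
  fixes act :: "('v, 'e) lpa_gen \<Rightarrow> 'm \<Rightarrow> 'm"
  assumes act_closed: "\<lbrakk>g \<in> lpa_gens E; x \<in> carrier M\<rbrakk> \<Longrightarrow> act g x \<in> carrier M"
    and act_add: "\<lbrakk>g \<in> lpa_gens E; x \<in> carrier M; y \<in> carrier M\<rbrakk> \<Longrightarrow> act g (x \<oplus> y) = act g x \<oplus> act g y"
    and act_sc: "\<lbrakk>g \<in> lpa_gens E; x \<in> carrier M\<rbrakk> \<Longrightarrow> act g (sc c x) = sc c (act g x)"
    and V: "\<lbrakk>v \<in> verts E; u \<in> verts E; x \<in> carrier M\<rbrakk> \<Longrightarrow>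
      act (Vertex v) (act (Vertex u) x) = (if v = u then act (Vertex v) x else \<zero>)"
    and E1_tail: "\<lbrakk>e \<in> arcs E; x \<in> carrier M\<rbrakk> \<Longrightarrow> act (Vertex (tail E e)) (act (Edge e) x) = act (Edge e) x"
    and E1_head: "\<lbrakk>e \<in> arcs E; x \<in> carrier M\<rbrakk> \<Longrightarrow> act (Edge e) (act (Vertex (head E e)) x) = act (Edge e) x"
    and E2_head: "\<lbrakk>e \<in> arcs E; x \<in> carrier M\<rbrakk> \<Longrightarrow> act (Vertex (head E e)) (act (Ghost e) x) = act (Ghost e) x"
    and E2_tail: "\<lbrakk>e \<in> arcs E; x \<in> carrier M\<rbrakk> \<Longrightarrow> act (Ghost e) (act (Vertex (tail E e)) x) = act (Ghost e) x"
    and CK1: "\<lbrakk>e \<in> arcs E; e' \<in> arcs E; x \<in> carrier M\<rbrakk> \<Longrightarrow>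
      act (Ghost e) (act (Edge e') x) = (if e = e' then act (Vertex (head E e)) x else \<zero>)"
    and CK2: "\<lbrakk>v \<in> verts E; out_arcs E v \<noteq> {}; x \<in> carrier M\<rbrakk> \<Longrightarrow>
      (\<Oplus>e\<in>out_arcs E v. act (Edge e) (act (Ghost e) x)) = act (Vertex v) x"
    and sum_verts: "x \<in> carrier M \<Longrightarrow> (\<Oplus>v\<in>verts E. act (Vertex v) x) = x"
begin

definition word_act :: "('v, 'e) lpa_gen free_word \<Rightarrow> 'm \<Rightarrow> 'm" where
  "word_act w x = foldr act (letters w) x"

definition alg_act :: "(('v, 'e) lpa_gen free_word \<Rightarrow>\<^sub>0 'k) \<Rightarrow> 'm \<Rightarrow> 'm" where
  "alg_act f x = lincomb (\<lambda>w. word_act w x) f"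

abbreviation FA :: "(('v, 'e) lpa_gen free_word \<Rightarrow>\<^sub>0 'k) set" where
  "FA \<equiv> carrier (free_algebra (lpa_gens E))"

lemma act_hom: "g \<in> lpa_gens E \<Longrightarrow> abelian_group_hom M M (act g)"
  by (intro abelian_group_homI') (auto intro: act_closed act_add abelian_group_axioms)

lemma foldr_act:
  assumes "set w \<subseteq> lpa_gens E" "x \<in> carrier M"
  shows "foldr act w x \<in> carrier M" "foldr act w (sc c x) = sc c (foldr act w x)"
    "y \<in> carrier M \<Longrightarrow> foldr act w (x \<oplus> y) = foldr act w x \<oplus> foldr act w y"
proof -
  have *: "foldr act w x \<in> carrier M" if "set w \<subseteq> lpa_gens E" "x \<in> carrier M" for w x
    using that by (induction w) (auto intro: act_closed)
  then show "foldr act w x \<in> carrier M" using assms .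
  show "foldr act w (sc c x) = sc c (foldr act w x)"
    using assms by (induction w) (auto simp: act_sc *)
  show "foldr act w (x \<oplus> y) = foldr act w x \<oplus> foldr act w y" if "y \<in> carrier M"
    using assms that by (induction w) (auto simp: act_add *)
qed

lemma word_act:
  assumes "set (letters w) \<subseteq> lpa_gens E" "x \<in> carrier M"
  shows "word_act w x \<in> carrier M" "word_act w (sc c x) = sc c (word_act w x)"
    "y \<in> carrier M \<Longrightarrow> word_act w (x \<oplus> y) = word_act w x \<oplus> word_act w y"
  using foldr_act[OF assms] by (auto simp: word_act_def)

lemma word_act_Pi:
  "\<lbrakk>f \<in> FA; x \<in> carrier M\<rbrakk> \<Longrightarrow> (\<lambda>w. word_act w x) \<in> Poly_Mapping.keys f \<rightarrow> carrier M"
  by (auto simp: free_algebra_carrier intro: word_act)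

lemma alg_act_closed: "\<lbrakk>f \<in> FA; x \<in> carrier M\<rbrakk> \<Longrightarrow> alg_act f x \<in> carrier M"
  unfolding alg_act_def by (intro lincomb_closed word_act_Pi)

lemma alg_act_add_left:
  "\<lbrakk>f \<in> FA; g \<in> FA; x \<in> carrier M\<rbrakk> \<Longrightarrow> alg_act (f + g) x = alg_act f x \<oplus> alg_act g x"
  unfolding alg_act_def by (intro lincomb_add word_act_Pi)

lemma alg_act_single:
  "\<lbrakk>set (letters w) \<subseteq> lpa_gens E; x \<in> carrier M\<rbrakk> \<Longrightarrow>
     alg_act (Poly_Mapping.single w c) x = sc c (word_act w x)"
  unfolding alg_act_def by (rule lincomb_single) (rule word_act)

lemma alg_act_add:
  assumes "f \<in> FA" "x \<in> carrier M" "y \<in> carrier M"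
  shows "alg_act f (x \<oplus> y) = alg_act f x \<oplus> alg_act f y"
  using assms(1)
proof (induction rule: free_algebra_induct)
  case (single w c)
  with assms show ?case by (simp add: alg_act_single word_act sc_add)
next
  case (add f g)
  with assms show ?case by (simp add: alg_act_add_left alg_act_closed a_ac)
qed

lemma alg_act_hom: "f \<in> FA \<Longrightarrow> abelian_group_hom M M (alg_act f)"
  by (intro abelian_group_homI') (auto intro: alg_act_closed alg_act_add abelian_group_axioms)

lemma alg_act_hom_left: "x \<in> carrier M \<Longrightarrow> abelian_group_hom (free_algebra (lpa_gens E)) M (\<lambda>f. alg_act f x)"
  using ring.is_abelian_group[OF ring_free_algebra[of "lpa_gens E"]]
  by (intro abelian_group_homI') (auto intro: alg_act_closed alg_act_add_left abelian_group_axioms)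

lemma alg_act_mult:
  assumes "f \<in> FA" "g \<in> FA" "x \<in> carrier M"
  shows "alg_act (f * g) x = alg_act f (alg_act g x)"
  using assms(1)
proof (induction rule: free_algebra_induct)
  case (single w c)
  from assms(2) show ?case
  proof (induction rule: free_algebra_induct)
    case (single v d)
    then show ?case using assms(3) \<open>set (letters w) \<subseteq> lpa_gens E\<close>
      by (simp add: mult_single alg_act_single word_act sc_closed sc_mult) (simp add: word_act_def)
  next
    case (add f g)
    then show ?case using assms(3) single
      by (simp add: distrib_left alg_act_add_left alg_act_closed alg_act_add free_algebra_closed
          free_algebra_single)
  qed
next
  case (add f h)
  then show ?case using assms
    by (simp add: distrib_right alg_act_add_left alg_act_closed free_algebra_closed)
qed

lemma alg_act_gen: "\<lbrakk>g \<in> lpa_gens E; x \<in> carrier M\<rbrakk> \<Longrightarrow> alg_act (gen g) x = act g x"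
  by (simp add: gen_def alg_act_single word_act_def sc_one act_closed)

lemma alg_act_scalar: "x \<in> carrier M \<Longrightarrow> alg_act (Poly_Mapping.single 0 c) x = sc c x"
  by (simp add: alg_act_single word_act_def)

lemma alg_act_one: "x \<in> carrier M \<Longrightarrow> alg_act 1 x = x"
  using alg_act_scalar[of x 1] by (simp add: sc_one)

lemma alg_act_zero: "x \<in> carrier M \<Longrightarrow> alg_act 0 x = \<zero>"
  using abelian_group_hom.hom_zero[OF alg_act_hom_left[of x]] by simp

lemma alg_act_sum:
  assumes "finite A" "\<And>i. i \<in> A \<Longrightarrow> f i \<in> FA" "x \<in> carrier M"
  shows "alg_act (sum f A) x = (\<Oplus>i\<in>A. alg_act (f i) x)"
  using abelian_group_hom.hom_finsum[OF alg_act_hom_left[of x], of A f] assms free_algebra_finsum[of A f]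
  by (simp add: Pi_iff)

lemma alg_act_minus:
  assumes "f \<in> FA" "g \<in> FA" "x \<in> carrier M" "alg_act f x = alg_act g x"
  shows "alg_act (f - g) x = \<zero>"
proof -
  have "f - g \<in> FA" using assms by (simp add: free_algebra_closed)
  then have "alg_act f x = alg_act (f - g) x \<oplus> alg_act g x"
    using alg_act_add_left[of "f - g" g x] assms by simp
  then show ?thesis using assms \<open>f - g \<in> FA\<close> by (simp add: alg_act_closed)
qed

lemma alg_act_relation:
  assumes "r \<in> lpa_relations E" "x \<in> carrier M"
  shows "alg_act r x = \<zero>"
proof -
  note [simp] = free_algebra_gen free_algebra_closed free_algebra_sum alg_act_mult alg_act_gen
    act_closed free_algebra_zero free_algebra_one alg_act_zero alg_act_one
  have arcs: "e \<in> arcs E" if "e \<in> out_arcs E v" for e v using that by (auto simp: out_arcs_def)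
  have fin: "finite (out_arcs E v)" for v using finite_out_arcs .
  have sum_vertex: "alg_act (\<Sum>v\<in>verts E. gen (Vertex v)) x = x" if "x \<in> carrier M" for x
    using that by (simp add: finite_verts sum_verts alg_act_sum cong: finsum_cong)
  have sum_edge: "alg_act (\<Sum>e\<in>out_arcs E v. gen (Edge e) * gen (Ghost e)) x = act (Vertex v) x"
    "(\<Sum>e\<in>out_arcs E v. gen (Edge e) * gen (Ghost e) :: _ \<Rightarrow>\<^sub>0 'k) \<in> FA"
    if "v = tail E a" "a \<in> arcs E" "x \<in> carrier M" for v x a
  proof -
    have "alg_act (\<Sum>e\<in>out_arcs E v. gen (Edge e) * gen (Ghost e)) x =
        (\<Oplus>e\<in>out_arcs E v. alg_act (gen (Edge e) * gen (Ghost e)) x)"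
      by (rule alg_act_sum) (use that arcs in \<open>auto simp: fin\<close>)
    also have "\<dots> = (\<Oplus>e\<in>out_arcs E v. act (Edge e) (act (Ghost e) x))"
      by (rule finsum_cong') (use that(3) arcs in auto)
    moreover have "v \<in> verts E" "out_arcs E v \<noteq> {}" using that by (auto simp: out_arcs_def)
    ultimately show "alg_act (\<Sum>e\<in>out_arcs E v. gen (Edge e) * gen (Ghost e)) x = act (Vertex v) x"
      using CK2 that by simp
    show "(\<Sum>e\<in>out_arcs E v. gen (Edge e) * gen (Ghost e) :: _ \<Rightarrow>\<^sub>0 'k) \<in> FA"
      by (rule free_algebra_sum) (use arcs in auto)
  qed
  show ?thesis
    using assms unfolding lpa_relations_def
    by (auto intro!: alg_act_minus simp: arcs V E1_tail E1_head E2_tail E2_head CK1 sum_vertex sum_edge)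
qed

end

context lpa_rep
begin

text \<open>The polynomials that annihilate the whole module form a two-sided ideal containing the
  relations, and \<open>lpa_ideal\<close> is the least such ideal.\<close>

lemma alg_act_lpa_ideal:
  assumes "f \<in> lpa_ideal E" "x \<in> carrier M"
  shows "alg_act f x = \<zero>"
proof -
  let ?A = "{f \<in> FA. \<forall>x\<in>carrier M. alg_act f x = \<zero>}"
  have "ideal ?A (free_algebra (lpa_gens E))"
  proof (rule idealI[OF ring_free_algebra])
    have "alg_act (- f) x = \<zero>" if "f \<in> ?A" "x \<in> carrier M" for f x
      using alg_act_minus[of 0 f x] that by (auto simp: alg_act_zero free_algebra_zero)
    then show "subgroup ?A (add_monoid (free_algebra (lpa_gens E)))"
      by (intro subgroup.intro)
        (auto simp: free_algebra_closed free_algebra_zero alg_act_zero alg_act_add_left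
          free_algebra_a_inv[unfolded a_inv_def, simplified])
  qed (auto simp: free_algebra_closed alg_act_mult alg_act_closed
      abelian_group_hom.hom_zero[OF alg_act_hom])
  moreover have "lpa_relations E \<subseteq> ?A"
    using alg_act_relation lpa_relations_subset by auto
  ultimately have "lpa_ideal E \<subseteq> ?A"
    unfolding lpa_ideal_def by (rule ring.genideal_minimal[OF ring_free_algebra])
  with assms show ?thesis by auto
qed

lemma alg_act_lpa_class:
  assumes "f \<in> FA" "g \<in> lpa_class E f" "x \<in> carrier M"
  shows "g \<in> FA" "alg_act g x = alg_act f x"
proof -
  obtain i where i: "i \<in> lpa_ideal E" "g = i + f"
    using assms(2) by (auto simp: lpa_class_def a_r_coset_def')
  then have "i \<in> FA"
    using ideal_lpa_ideal by (auto dest: additive_subgroup.a_Hcarr[OF ideal.axioms(1)])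
  with i assms show "g \<in> FA" "alg_act g x = alg_act f x"
    by (auto simp: free_algebra_closed alg_act_add_left alg_act_lpa_ideal alg_act_closed)
qed

text \<open>All representatives of a residue class act alike, so the set under
  \<open>the_elem\<close> is a singleton. This justifies defining scalar multiplication by a class
  through \<open>the_elem\<close>.\<close>

lemma the_elem_alg_act:
  assumes "f \<in> FA" "x \<in> carrier M"
  shows "the_elem ((\<lambda>g. alg_act g x) ` lpa_class E f) = alg_act f x"
proof -
  interpret I: ideal "lpa_ideal E" "free_algebra (lpa_gens E)" by (rule ideal_lpa_ideal)
  have "f \<in> lpa_class E f"
    unfolding lpa_class_def by (rule I.a_rcos_self[OF assms(1)])
  moreover have "(\<lambda>g. alg_act g x) ` lpa_class E f = (\<lambda>_. alg_act f x) ` lpa_class E f"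
    by (rule image_cong[OF refl]) (rule alg_act_lpa_class(2)[OF assms(1) _ assms(2)])
  ultimately show ?thesis by (simp only: image_constant the_elem_eq)
qed

text \<open>In a ghost edge followed by an edge the factors \<open>T'\<close> and \<open>T\<close>
  meet and cancel, which gives (CK1). In an edge followed by a ghost edge they stand at the two
  ends, so the sum in (CK2) becomes \<open>T v T'\<close>, which is \<open>v\<close> because
  \<open>T\<close> commutes with the vertices. The same commutation gives (E1) and (E2).\<close>

lemma lpa_rep_twist:
  assumes T: "abelian_group_hom M M T" and T': "abelian_group_hom M M T'"
    and inv: "\<And>x. x \<in> carrier M \<Longrightarrow> T (T' x) = x" "\<And>x. x \<in> carrier M \<Longrightarrow> T' (T x) = x"
    and sc: "\<And>c x. x \<in> carrier M \<Longrightarrow> T (sc c x) = sc c (T x)"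
    and vert: "\<And>v x. \<lbrakk>v \<in> verts E; x \<in> carrier M\<rbrakk> \<Longrightarrow> T (act (Vertex v) x) = act (Vertex v) (T x)"
    and act': "\<And>v x. act' (Vertex v) x = act (Vertex v) x" "\<And>e x. act' (Edge e) x = T (act (Edge e) x)"
      "\<And>e x. act' (Ghost e) x = act (Ghost e) (T' x)"
  shows "lpa_rep E M sc act'"
proof -
  interpret T: abelian_group_hom M M T by fact
  interpret T': abelian_group_hom M M T' by fact
  have sc': "T' (sc c x) = sc c (T' x)" if "x \<in> carrier M" for c x
    using inv(1)[OF that] inv(2)[of "sc c (T' x)"] sc[of "T' x" c] that sc_closed by simp
  have vert': "T' (act (Vertex v) x) = act (Vertex v) (T' x)" if "v \<in> verts E" "x \<in> carrier M" for v x
    using inv(1)[OF that(2)] inv(2)[of "act (Vertex v) (T' x)"] vert[of v "T' x"] that act_closed by simp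
  have gens: "g \<in> lpa_gens E \<longleftrightarrow> (\<exists>v\<in>verts E. g = Vertex v) \<or> (\<exists>e\<in>arcs E. g = Edge e) \<or> (\<exists>e\<in>arcs E. g = Ghost e)" for g
    by (cases g) auto
  show ?thesis
  proof (unfold_locales)
    fix v x assume *: "v \<in> verts E" "out_arcs E v \<noteq> {}" "x \<in> carrier M"
    have "(\<Oplus>e\<in>out_arcs E v. act' (Edge e) (act' (Ghost e) x)) = T (\<Oplus>e\<in>out_arcs E v. act (Edge e) (act (Ghost e) (T' x)))"
      using * by (subst T.hom_finsum) (auto simp: act' finite_out_arcs act_closed)
    then show "(\<Oplus>e\<in>out_arcs E v. act' (Edge e) (act' (Ghost e) x)) = act' (Vertex v) x"
      using * by (simp add: CK2 act' vert inv)
  qed (auto simp: gens act' act_closed act_add act_sc sc sc' V E1_tail E1_head E2_tail E2_head CK1 sum_verts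
       inv vert' simp flip: vert)
qed

end

text \<open>Each element of the algebra is the class of a polynomial, so the laws follow from those
  of \<open>alg_act\<close>. The assumption \<open>smult\<close> leaves open how scalar
  multiplication is defined, so that path modules and twisted modules are both covered.\<close>

lemma left_module_of_rep:
  assumes "lpa_rep E Z sc act"
    and eq: "carrier M = carrier Z" "add M = add Z" "zero M = zero Z"
    and smult: "\<And>f x. \<lbrakk>f \<in> carrier (free_algebra (lpa_gens E)); x \<in> carrier Z\<rbrakk> \<Longrightarrow>
      lpa_class E f \<odot>\<^bsub>M\<^esub> x = lpa_rep.alg_act Z sc act f x"
  shows "left_module (LPA E) M"
proof -
  interpret lpa_rep E Z sc act by fact
  have "abelian_group M"
    by (rule abelian_groupI) (auto simp: eq a_ac intro: bexI[of _ "\<ominus>\<^bsub>Z\<^esub> x" for x] l_neg)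
  then show ?thesis
  proof (intro left_module.intro left_module_axioms.intro ring_LPA)
    fix x assume "x \<in> carrier M"
    then show "\<one>\<^bsub>LPA E\<^esub> \<odot>\<^bsub>M\<^esub> x = x"
      using smult[of 1 x] by (simp add: eq lpa_class_one free_algebra_one alg_act_one)
  qed (auto simp: carrier_LPA smult eq alg_act_closed alg_act_add alg_act_add_left alg_act_mult
      free_algebra_closed simp flip: lpa_class_simps)
qed

section \<open>Recovering the generator action from a module\<close>

locale lpa_module = fin_digraph E + left_module "LPA E" M
  for E :: "('v, 'e) pre_digraph" and M :: "(('v, 'e, 'k::field) lpa_elem, 'm, 'y) module_scheme" (structure)
begin

definition scal :: "'k \<Rightarrow> 'm \<Rightarrow> 'm" where
  "scal c x = lpa_class E (Poly_Mapping.single 0 c) \<odot>\<^bsub>M\<^esub> x"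

definition gact :: "('v, 'e) lpa_gen \<Rightarrow> 'm \<Rightarrow> 'm" where
  "gact g x = lpa_class E (gen g) \<odot>\<^bsub>M\<^esub> x"

lemma smult_left_hom: "x \<in> carrier M \<Longrightarrow> abelian_group_hom (LPA E) M (\<lambda>a. a \<odot>\<^bsub>M\<^esub> x)"
  by (intro abelian_group_homI')
    (auto intro: smult_closed smult_l_distr R.is_abelian_group M.abelian_group_axioms)

lemma single0_FA: "Poly_Mapping.single 0 c \<in> carrier (free_algebra (lpa_gens E))"
  by (rule free_algebra_single) simp

lemma gact_gact:
  "\<lbrakk>g \<in> lpa_gens E; h \<in> lpa_gens E; x \<in> carrier M\<rbrakk> \<Longrightarrow>
     gact g (gact h x) = lpa_class E (gen g * gen h) \<odot>\<^bsub>M\<^esub> x"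
  by (simp add: gact_def lpa_class_simps free_algebra_gen smult_assoc lpa_class_closed)

text \<open>The converse of \<open>left_module_of_rep\<close>: each defining relation is an equation
  between residue classes and hence between the operators by which they act. Any module can thus be
  taken apart, twisted and reassembled.\<close>

lemma lpa_rep: "lpa_rep E M scal gact"
proof -
  have class_eq: "lpa_class E f = lpa_class E g"
    if "f - g \<in> lpa_relations E" "f \<in> carrier (free_algebra (lpa_gens E))"
      "g \<in> carrier (free_algebra (lpa_gens E))" for f g :: "_ \<Rightarrow>\<^sub>0 'k"
    using lpa_class_eqI that by metis
  have gen2: "gen g * gen h \<in> carrier (free_algebra (lpa_gens E) :: (_ \<Rightarrow>\<^sub>0 'k) ring)" if "g \<in> lpa_gens E" "h \<in> lpa_gens E"
    for g h using that by (simp add: free_algebra_closed free_algebra_gen)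
  note [simp] = lpa_class_closed single0_FA free_algebra_gen gen2 free_algebra_sum free_algebra_one
    free_algebra_zero lpa_class_zero zero_smult smult_closed smult_r_distr
  show ?thesis
  proof (unfold_locales)
    fix x c d assume x: "x \<in> carrier M"
    show "scal (c + d) x = scal c x \<oplus> scal d x"
      using x by (simp add: scal_def single_add lpa_class_simps smult_l_distr)
    have "Poly_Mapping.single 0 (c * d) = Poly_Mapping.single 0 c * Poly_Mapping.single (0::('v, 'e) lpa_gen free_word) d"
      by (simp add: mult_single)
    then show "scal (c * d) x = scal c (scal d x)"
      using x by (simp add: scal_def lpa_class_simps smult_assoc)
    show "scal 1 x = x"
      using x by (simp add: scal_def lpa_class_one smult_one)
  next
    fix g x and c :: 'k assume "g \<in> lpa_gens E" "x \<in> carrier M"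
    moreover have "Poly_Mapping.single 0 c * gen g = gen g * Poly_Mapping.single 0 c"
      by (simp add: gen_def mult_single)
    ultimately show "gact g (scal c x) = scal c (gact g x)"
      by (simp add: gact_def scal_def flip: smult_assoc lpa_class_simps)
  next
    fix v u x assume *: "v \<in> verts E" "u \<in> verts E" "x \<in> carrier M"
    have "lpa_class E (gen (Vertex v) * gen (Vertex u)) =
        lpa_class E (if v = u then gen (Vertex v) else (0 :: _ \<Rightarrow>\<^sub>0 'k))"
      by (rule class_eq) (use * in \<open>auto simp: lpa_relations_def\<close>)
    with * show "gact (Vertex v) (gact (Vertex u) x) = (if v = u then gact (Vertex v) x else \<zero>)"
      by (simp add: gact_gact) (simp add: gact_def)
  next
    fix e x assume *: "e \<in> arcs E" "x \<in> carrier M"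
    have "lpa_class E (gen (Vertex (tail E e)) * gen (Edge e)) = lpa_class E (gen (Edge e) :: _ \<Rightarrow>\<^sub>0 'k)"
      by (rule class_eq) (use * in \<open>auto simp: lpa_relations_def\<close>)
    with * show "gact (Vertex (tail E e)) (gact (Edge e) x) = gact (Edge e) x"
      by (simp add: gact_gact) (simp add: gact_def)
    have "lpa_class E (gen (Edge e) * gen (Vertex (head E e))) = lpa_class E (gen (Edge e) :: _ \<Rightarrow>\<^sub>0 'k)"
      by (rule class_eq) (use * in \<open>auto simp: lpa_relations_def\<close>)
    with * show "gact (Edge e) (gact (Vertex (head E e)) x) = gact (Edge e) x"
      by (simp add: gact_gact) (simp add: gact_def)
    have "lpa_class E (gen (Vertex (head E e)) * gen (Ghost e)) = lpa_class E (gen (Ghost e) :: _ \<Rightarrow>\<^sub>0 'k)"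
      by (rule class_eq) (use * in \<open>auto simp: lpa_relations_def\<close>)
    with * show "gact (Vertex (head E e)) (gact (Ghost e) x) = gact (Ghost e) x"
      by (simp add: gact_gact) (simp add: gact_def)
    have "lpa_class E (gen (Ghost e) * gen (Vertex (tail E e))) = lpa_class E (gen (Ghost e) :: _ \<Rightarrow>\<^sub>0 'k)"
      by (rule class_eq) (use * in \<open>auto simp: lpa_relations_def\<close>)
    with * show "gact (Ghost e) (gact (Vertex (tail E e)) x) = gact (Ghost e) x"
      by (simp add: gact_gact) (simp add: gact_def)
  next
    fix e e' x assume *: "e \<in> arcs E" "e' \<in> arcs E" "x \<in> carrier M"
    have "lpa_class E (gen (Ghost e) * gen (Edge e')) =
        lpa_class E (if e = e' then gen (Vertex (head E e)) else (0 :: _ \<Rightarrow>\<^sub>0 'k))"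
      by (rule class_eq) (use * in \<open>auto simp: lpa_relations_def\<close>)
    with * show "gact (Ghost e) (gact (Edge e') x) = (if e = e' then gact (Vertex (head E e)) x else \<zero>)"
      by (simp add: gact_gact) (simp add: gact_def)
  next
    fix v x assume *: "v \<in> verts E" "out_arcs E v \<noteq> {}" "x \<in> carrier M"
    have arcs: "e \<in> arcs E" if "e \<in> out_arcs E v" for e using that by (auto simp: out_arcs_def)
    have "lpa_class E (\<Sum>e\<in>out_arcs E v. gen (Edge e) * gen (Ghost e)) = lpa_class E (gen (Vertex v) :: _ \<Rightarrow>\<^sub>0 'k)"
    proof (rule class_eq[symmetric])
      show "gen (Vertex v) - (\<Sum>e\<in>out_arcs E v. gen (Edge e) * gen (Ghost e)) \<in> (lpa_relations E :: (_ \<Rightarrow>\<^sub>0 'k) set)"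
        unfolding lpa_relations_def
        by (rule UnI1, rule UnI2) (use * finite_out_arcs in blast)
    qed (use * in \<open>auto intro!: free_algebra_sum gen2\<close>)
    then have "gact (Vertex v) x = lpa_class E (\<Sum>e\<in>out_arcs E v. gen (Edge e) * gen (Ghost e)) \<odot>\<^bsub>M\<^esub> x"
      by (simp add: gact_def)
    also have "\<dots> = (\<Oplus>e\<in>out_arcs E v. lpa_class E (gen (Edge e) * gen (Ghost e)) \<odot>\<^bsub>M\<^esub> x)"
    proof -
      have "lpa_class E (\<Sum>e\<in>out_arcs E v. gen (Edge e) * gen (Ghost e) :: _ \<Rightarrow>\<^sub>0 'k) =
          finsum (LPA E) (\<lambda>e. lpa_class E (gen (Edge e) * gen (Ghost e))) (out_arcs E v)"
        by (rule lpa_class_sum) (use arcs in \<open>auto simp: finite_out_arcs intro!: gen2\<close>)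
      also have "\<dots> \<odot>\<^bsub>M\<^esub> x = (\<Oplus>e\<in>out_arcs E v. lpa_class E (gen (Edge e) * gen (Ghost e)) \<odot>\<^bsub>M\<^esub> x)"
        by (rule abelian_group_hom.hom_finsum[OF smult_left_hom[OF *(3)]])
          (use arcs in \<open>auto simp: finite_out_arcs intro!: lpa_class_closed gen2\<close>)
      finally show ?thesis .
    qed
    also have "\<dots> = (\<Oplus>e\<in>out_arcs E v. gact (Edge e) (gact (Ghost e) x))"
      by (rule M.finsum_cong') (use * arcs in \<open>auto simp: gact_gact\<close>)
    finally show "(\<Oplus>e\<in>out_arcs E v. gact (Edge e) (gact (Ghost e) x)) = gact (Vertex v) x" by simp
  next
    fix x assume *: "x \<in> carrier M"
    have "lpa_class E (\<Sum>v\<in>verts E. gen (Vertex v)) = lpa_class E (1 :: _ \<Rightarrow>\<^sub>0 'k)"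
      by (rule class_eq) (use * in \<open>auto simp: lpa_relations_def\<close>)
    then have "x = lpa_class E (\<Sum>v\<in>verts E. gen (Vertex v)) \<odot>\<^bsub>M\<^esub> x"
      using * by (simp add: lpa_class_one smult_one)
    also have "\<dots> = (\<Oplus>v\<in>verts E. lpa_class E (gen (Vertex v)) \<odot>\<^bsub>M\<^esub> x)"
      using abelian_group_hom.hom_finsum[OF smult_left_hom[OF *], of "verts E"
          "\<lambda>v. lpa_class E (gen (Vertex v))"]
      by (simp add: lpa_class_sum finite_verts)
    finally show "(\<Oplus>v\<in>verts E. gact (Vertex v) x) = x" by (simp add: gact_def)
  qed (auto simp: scal_def gact_def)
qed

end

sublocale lpa_module \<subseteq> rep: lpa_rep E M scal gact
  by (rule lpa_rep)

text \<open>The elements of the algebra that \<open>f\<close> respects at all vectors simultaneously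
  are closed under sums and products, so \<open>LPA_induct\<close> applies.\<close>

lemma lmod_hom_gensI:
  fixes E :: "('v, 'e) pre_digraph" and M :: "(('v, 'e, 'k::field) lpa_elem, 'm) module"
    and N :: "(('v, 'e, 'k) lpa_elem, 'n) module"
  assumes M: "lpa_module E M" and N: "lpa_module E N" and f: "abelian_group_hom M N f"
    and scal: "\<And>c x. x \<in> carrier M \<Longrightarrow> f (lpa_module.scal E M c x) = lpa_module.scal E N c (f x)"
    and gact: "\<And>g x. \<lbrakk>g \<in> lpa_gens E; x \<in> carrier M\<rbrakk> \<Longrightarrow>
      f (lpa_module.gact E M g x) = lpa_module.gact E N g (f x)"
  shows "f \<in> lmod_hom (LPA E) M N"
proof -
  interpret M: lpa_module E M by fact
  interpret N: lpa_module E N by fact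
  interpret f: abelian_group_hom M N f by fact
  show ?thesis
  proof (rule lmod_homI)
    fix a :: "('v, 'e, 'k) lpa_elem" and x assume "a \<in> carrier (LPA E)" and x: "x \<in> carrier M"
    then show "f (a \<odot>\<^bsub>M\<^esub> x) = a \<odot>\<^bsub>N\<^esub> f x"
    proof (induction arbitrary: x rule: M.LPA_induct)
      case (scalar c)
      then show ?case using scal by (simp add: M.scal_def N.scal_def)
    next
      case (gen g)
      then show ?case using gact by (simp add: M.gact_def N.gact_def)
    next
      case (add U V)
      then show ?case by (simp add: M.smult_l_distr N.smult_l_distr M.smult_closed)
    next
      case (mult U V)
      then show ?case by (simp add: M.smult_assoc N.smult_assoc M.smult_closed)
    qed
  qed auto
qed

section \<open>The module of a tail equivalence class\<close>

lemma lookup_scale [simp]: "Poly_Mapping.lookup (Poly_Mapping.map ((*) c) x) q = c * Poly_Mapping.lookup x (q :: _) "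
  for c :: "'k::field"
  by (simp add: Poly_Mapping.map.rep_eq when_def)

lemma keys_scale: "Poly_Mapping.keys (Poly_Mapping.map ((*) c) x) \<subseteq> Poly_Mapping.keys x"
  for c :: "'k::field"
  by (auto simp: in_keys_iff)

lemma gen_act_add: "gen_act E g (x + y) = gen_act E g x + gen_act E g (y :: _ \<Rightarrow>\<^sub>0 'k::field)"
  unfolding gen_act_def by (rule setsum_keys_plus_distrib) (cases g; simp add: single_add)+

lemma gen_act_zero [simp]: "gen_act E g 0 = 0"
  by (simp add: gen_act_def)

lemma gen_act_single [simp]: "gen_act E g (Poly_Mapping.single q c) = path_act E g q (c :: 'k::field)"
  by (cases "c = 0"; cases g) (auto simp: gen_act_def)

lemma scale_add: "Poly_Mapping.map ((*) c) (x + y) = Poly_Mapping.map ((*) c) x + Poly_Mapping.map ((*) (c :: 'k::field)) y"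
  by (rule poly_mapping_eqI) (simp add: lookup_add distrib_left)

lemma scale_zero [simp]: "Poly_Mapping.map ((*) c) 0 = (0 :: _ \<Rightarrow>\<^sub>0 'k::field)"
  by (rule poly_mapping_eqI) simp

lemma scale_single [simp]:
  "Poly_Mapping.map ((*) c) (Poly_Mapping.single q d) = Poly_Mapping.single q (c * d :: 'k::field)"
  by (rule map_single) simp

lemma gen_act_scale:
  "gen_act E g (Poly_Mapping.map ((*) c) x) = Poly_Mapping.map ((*) (c :: 'k::field)) (gen_act E g x)"
proof -
  have "Poly_Mapping.keys x \<subseteq> UNIV" by simp
  then show ?thesis
  proof (induction x rule: poly_mapping_single_induct)
    case (add k d f)
    then show ?case by (cases g) (simp_all add: scale_add gen_act_add)
  qed simp
qed

lemma path_tail_simps [simp]: "path_tail 0 q = q" "path_tail m (path_tail n q) = path_tail (n + m) q"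
  by (simp_all add: path_tail_def add.assoc)

lemma path_tail_apply: "path_tail n q i = q (n + i)"
  by (simp add: path_tail_def)

lemma path_tail_apply_0 [simp]: "path_tail n q 0 = q n"
  by (simp add: path_tail_def)

lemma path_tail_case_nat [simp]:
  "path_tail (Suc 0) (case_nat e q) = q" "case_nat (q 0) (path_tail (Suc 0) q) = q"
  by (auto simp: path_tail_def split: nat.split)

lemma tail_classD:
  assumes "q \<in> tail_class E p"
  shows "q i \<in> arcs E" "head E (q i) = tail E (q (Suc i))"
  using assms by (auto simp: tail_class_def infinite_path_def)

lemma path_tail_tail_class: "q \<in> tail_class E p \<Longrightarrow> path_tail n q \<in> tail_class E p"
proof -
  assume q: "q \<in> tail_class E p"
  then obtain m k where "path_tail m p = path_tail k q" by (auto simp: tail_class_def)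
  then have "path_tail n (path_tail m p) = path_tail n (path_tail k q)" by simp
  then have "path_tail (m + n) p = path_tail k (path_tail n q)" by (simp add: add.commute)
  with q show ?thesis by (auto simp: tail_class_def infinite_path_def path_tail_apply)
qed

lemma case_nat_tail_class:
  assumes "q \<in> tail_class E p" "e \<in> arcs E" "head E e = tail E (q 0)"
  shows "case_nat e q \<in> tail_class E p"
proof -
  obtain m n where "path_tail m p = path_tail n q" using assms(1) by (auto simp: tail_class_def)
  also have "\<dots> = path_tail (Suc n) (case_nat e q)" by (simp add: path_tail_def)
  finally show ?thesis
    using assms by (auto simp: tail_class_def infinite_path_def split: nat.split)
qed

lemma path_module_simps [simp]:
  "x \<in> carrier (path_module E p) \<longleftrightarrow> Poly_Mapping.keys x \<subseteq> tail_class E p"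
  "zero (path_module E p) = 0" "add (path_module E p) = (+)"
  by (simp_all add: path_module_def)

lemma gen_act_carrier:
  assumes "g \<in> lpa_gens E" "Poly_Mapping.keys x \<subseteq> tail_class E p"
  shows "Poly_Mapping.keys (gen_act E g x) \<subseteq> tail_class E (p :: nat \<Rightarrow> 'e)"
  using assms(2)
proof (induction x rule: poly_mapping_single_induct)
  case (add k c f)
  have "Poly_Mapping.keys (path_act E g k c) \<subseteq> tail_class E p"
    using assms(1) add(1) by (cases g) (auto simp: path_tail_tail_class case_nat_tail_class)
  with add show ?case
    using keys_add[of "path_act E g k c" "gen_act E g f"] by (auto simp: gen_act_add)
qed simp

lemma abelian_group_path_module: "abelian_group (path_module E p :: (('v, 'e, 'k::field) lpa_elem, _) module)"
proof (rule abelian_groupI)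
  fix x :: "(nat \<Rightarrow> 'e) \<Rightarrow>\<^sub>0 'k" assume "x \<in> carrier (path_module E p)"
  then show "\<exists>y\<in>carrier (path_module E p). y \<oplus>\<^bsub>path_module E p\<^esub> x = \<zero>\<^bsub>path_module E p\<^esub>"
    by (intro bexI[of _ "- x"]) (auto simp: in_keys_iff)
qed (use keys_add in \<open>fastforce simp: algebra_simps\<close>)+

lemma path_module_finsum:
  assumes "\<And>i. i \<in> A \<Longrightarrow> f i \<in> carrier (path_module E p)" "finite A"
  shows "finsum (path_module E p :: (('v, 'e, 'k::field) lpa_elem, _) module) f A = sum f A"
proof -
  interpret abelian_group "path_module E p :: (('v, 'e, 'k::field) lpa_elem, _) module"
    by (rule abelian_group_path_module)
  show ?thesis using assms(2,1)
    by (induction A rule: finite_induct) (simp_all add: Pi_iff)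
qed

text \<open>Both sides of each relation are additive in \<open>x\<close>, so \<open>ext\<close>
  reduces the relation to a multiple of a single path, where \<open>path_act\<close> computes
  it.\<close>

lemma (in fin_digraph) lpa_rep_path_module:
  "lpa_rep G (path_module G p :: (('a, 'b, 'k::field) lpa_elem, _) module) (\<lambda>c. Poly_Mapping.map ((*) c)) (gen_act G)"
proof -
  let ?M = "path_module G p :: (('a, 'b, 'k) lpa_elem, _) module"
  interpret abelian_group ?M
    by (rule abelian_group_path_module)
  have ext: "f x = g x" if "x \<in> carrier ?M"
    "f 0 = 0" "g 0 = 0" "\<And>x y. f (x + y) = f x + f y" "\<And>x y. g (x + y) = g x + g y"
    "\<And>q c. q \<in> tail_class G p \<Longrightarrow> f (Poly_Mapping.single q c) = g (Poly_Mapping.single q c)"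
    for f g :: "_ \<Rightarrow> (nat \<Rightarrow> 'b) \<Rightarrow>\<^sub>0 'k" and x
  proof -
    have "Poly_Mapping.keys x \<subseteq> tail_class G p" using that(1) by simp
    then show ?thesis by (induction x rule: poly_mapping_single_induct) (simp_all add: that)
  qed
  have closed: "gen_act G g x \<in> carrier ?M"
    if "g \<in> lpa_gens G" "x \<in> carrier ?M" for g x
    using that gen_act_carrier by simp
  show ?thesis
  proof (unfold_locales)
    fix v x assume *: "v \<in> verts G" "out_arcs G v \<noteq> {}" "x \<in> carrier ?M"
    have "(\<Oplus>\<^bsub>?M\<^esub>e\<in>out_arcs G v. gen_act G (Edge e) (gen_act G (Ghost e) x))
        = (\<Sum>e\<in>out_arcs G v. gen_act G (Edge e) (gen_act G (Ghost e) x))"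
      by (rule path_module_finsum)
        (use * in \<open>auto simp: finite_out_arcs closed simp del: path_module_simps(1)\<close>)
    also have "\<dots> = gen_act G (Vertex v) x"
    proof (rule ext[OF *(3)])
      fix q c assume q: "q \<in> tail_class G p"
      \<comment> \<open>Removing the first edge and putting it back fixes \<open>q\<close>; every
        other edge contributes zero. The sum is therefore nonzero only when the first edge of
        \<open>q\<close> leaves \<open>v\<close>.\<close>
      have "(\<Sum>e\<in>out_arcs G v. gen_act G (Edge e) (gen_act G (Ghost e) (Poly_Mapping.single q c))) =
          (\<Sum>e\<in>out_arcs G v. if e = q 0 then Poly_Mapping.single q c else 0)"
        by (rule sum.cong) (auto simp: tail_classD[OF q])
      then show "(\<Sum>e\<in>out_arcs G v. gen_act G (Edge e) (gen_act G (Ghost e) (Poly_Mapping.single q c))) =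
          gen_act G (Vertex v) (Poly_Mapping.single q c)"
        using tail_classD[OF q] by (auto simp: finite_out_arcs)
    qed (auto simp: gen_act_add sum.distrib)
    finally show "(\<Oplus>\<^bsub>?M\<^esub>e\<in>out_arcs G v. gen_act G (Edge e) (gen_act G (Ghost e) x)) =
      gen_act G (Vertex v) x" .
  next
    fix x assume *: "x \<in> carrier ?M"
    have "(\<Oplus>\<^bsub>?M\<^esub>v\<in>verts G. gen_act G (Vertex v) x)
        = (\<Sum>v\<in>verts G. gen_act G (Vertex v) x)"
      by (rule path_module_finsum)
        (use * in \<open>auto simp: finite_verts closed simp del: path_module_simps(1)\<close>)
    also have "\<dots> = x"
    proof (rule ext[OF *])
      fix q c assume q: "q \<in> tail_class G p"
      show "(\<Sum>v\<in>verts G. gen_act G (Vertex v) (Poly_Mapping.single q c)) = Poly_Mapping.single q c"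
        using tail_classD[OF q] by (auto simp: finite_verts)
    qed (auto simp: gen_act_add sum.distrib)
    finally show "(\<Oplus>\<^bsub>?M\<^esub>v\<in>verts G. gen_act G (Vertex v) x) = x" .
  next
    fix g x assume "g \<in> lpa_gens G" "x \<in> carrier ?M"
    then show "gen_act G g x \<in> carrier ?M"
      using gen_act_carrier by simp
  next
    fix x :: "(nat \<Rightarrow> 'b) \<Rightarrow>\<^sub>0 'k" and c
    assume "x \<in> carrier ?M"
    then show "Poly_Mapping.map ((*) c) x \<in> carrier ?M"
      using keys_scale[of c x] by auto
  next
    fix v u x assume *: "v \<in> verts G" "u \<in> verts G" "x \<in> carrier ?M"
    show "gen_act G (Vertex v) (gen_act G (Vertex u) x) = (if v = u then gen_act G (Vertex v) x
        else \<zero>\<^bsub>?M\<^esub>)"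
      by (rule ext[OF *(3)]) (auto simp: gen_act_add)
  next
    fix e x assume *: "e \<in> arcs G" "x \<in> carrier ?M"
    show "gen_act G (Vertex (tail G e)) (gen_act G (Edge e) x) = gen_act G (Edge e) x"
      by (rule ext[OF *(2)]) (auto simp: gen_act_add)
    show "gen_act G (Edge e) (gen_act G (Vertex (head G e)) x) = gen_act G (Edge e) x"
      by (rule ext[OF *(2)]) (auto simp: gen_act_add)
    show "gen_act G (Vertex (head G e)) (gen_act G (Ghost e) x) = gen_act G (Ghost e) x"
      by (rule ext[OF *(2)]) (auto simp: gen_act_add tail_classD)
    show "gen_act G (Ghost e) (gen_act G (Vertex (tail G e)) x) = gen_act G (Ghost e) x"
      by (rule ext[OF *(2)]) (auto simp: gen_act_add)
  next
    fix e e' x assume *: "e \<in> arcs G" "e' \<in> arcs G" "x \<in> carrier ?M"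
    show "gen_act G (Ghost e) (gen_act G (Edge e') x) = (if e = e' then gen_act G (Vertex (head G e)) x
        else \<zero>\<^bsub>?M\<^esub>)"
      by (rule ext[OF *(3)]) (auto simp: gen_act_add)
  qed (simp_all add: gen_act_add gen_act_scale scale_add, (rule poly_mapping_eqI, simp add: lookup_add algebra_simps)+)
qed

text \<open>\<open>free_algebra_act\<close> sums in the type of all finitely supported functions,
  \<open>alg_act\<close> in the group of the module. The two agree because the generators keep the
  span of the tail class invariant.\<close>

lemma (in fin_digraph) path_module_smult:
  fixes f :: "('a, 'b) lpa_gen free_word \<Rightarrow>\<^sub>0 'k::field"
  assumes f: "f \<in> carrier (free_algebra (lpa_gens G))"
    and x: "x \<in> carrier (path_module G p :: (('a, 'b, 'k) lpa_elem, _) module)"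
  shows "lpa_class G f \<odot>\<^bsub>path_module G p\<^esub> x =
    lpa_rep.alg_act (path_module G p :: (('a, 'b, 'k) lpa_elem, _) module)
      (\<lambda>c. Poly_Mapping.map ((*) c)) (gen_act G) f x"
proof -
  let ?M = "path_module G p :: (('a, 'b, 'k) lpa_elem, _) module"
  interpret rep: lpa_rep G ?M "\<lambda>c. Poly_Mapping.map ((*) c)" "gen_act G"
    by (rule lpa_rep_path_module)
  have eq: "free_algebra_act G g x = rep.alg_act g x" if "g \<in> rep.FA" for g
  proof -
    have "rep.alg_act g x = (\<Sum>w\<in>Poly_Mapping.keys g.
        Poly_Mapping.map ((*) (Poly_Mapping.lookup g w)) (rep.word_act w x))"
      unfolding rep.alg_act_def rep.lincomb_def
      by (rule path_module_finsum)
        (use that x in \<open>auto simp: free_algebra_carrier simp del: path_module_simps(1) intro!: rep.sc_closed rep.word_act\<close>)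
    then show ?thesis by (simp add: free_algebra_act_def rep.word_act_def)
  qed
  have "(\<lambda>g. free_algebra_act G g x) ` lpa_class G f = (\<lambda>g. rep.alg_act g x) ` lpa_class G f"
    by (rule image_cong[OF refl], rule eq) (rule rep.alg_act_lpa_class(1)[OF f _ x])
  then show ?thesis
    using rep.the_elem_alg_act[OF f x] by (simp add: path_module_def)
qed

lemma (in fin_digraph) lpa_module_path_module:
  "lpa_module G (path_module G p :: (('a, 'b, 'k::field) lpa_elem, _) module)"
  by (intro lpa_module.intro fin_digraph_axioms left_module_of_rep[OF lpa_rep_path_module refl refl refl]
      path_module_smult)

lemma (in fin_digraph) path_module_gact:
  fixes x :: "_ \<Rightarrow>\<^sub>0 'k::field"
  assumes "x \<in> carrier (path_module G p :: (('a, 'b, 'k) lpa_elem, _) module)"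
  shows "lpa_module.scal G (path_module G p :: (('a, 'b, 'k) lpa_elem, _) module) c x = Poly_Mapping.map ((*) c) x"
    "g \<in> lpa_gens G \<Longrightarrow>
      lpa_module.gact G (path_module G p :: (('a, 'b, 'k) lpa_elem, _) module) g x = gen_act G g x"
proof -
  let ?M = "path_module G p :: (('a, 'b, 'k) lpa_elem, _) module"
  interpret M: lpa_module G ?M by (rule lpa_module_path_module)
  interpret rep: lpa_rep G ?M "\<lambda>c. Poly_Mapping.map ((*) c)" "gen_act G"
    by (rule lpa_rep_path_module)
  show "M.scal c x = Poly_Mapping.map ((*) c) x"
    using assms by (simp add: M.scal_def path_module_smult M.single0_FA rep.alg_act_scalar
        del: path_module_simps(1))
  show "M.gact g x = gen_act G g x" if "g \<in> lpa_gens G"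
    using assms that by (simp add: M.gact_def path_module_smult free_algebra_gen rep.alg_act_gen
        del: path_module_simps(1))
qed

section \<open>Simplicity of the path modules\<close>

lemma tail_class_common_tail:
  assumes "q \<in> tail_class E p" "r \<in> tail_class E p"
  shows "\<exists>a b. path_tail a q = path_tail b r"
proof -
  obtain m n m' n' where 1: "path_tail m p = path_tail n q" and 2: "path_tail m' p = path_tail n' r"
    using assms by (auto simp: tail_class_def)
  \<comment> \<open>Shifting each of the two tails of \<open>p\<close> by the offset of the other
    produces the same tail of \<open>p\<close>.\<close>
  have "path_tail m' (path_tail n q) = path_tail m (path_tail n' r)"
    unfolding 1[symmetric] 2[symmetric] by (simp add: add.commute)
  then show ?thesis by auto
qed

text \<open>
  Removing an initial segment that distinguishes one path in the support from all the others
  isolates a basis vector, from which all of them are reached.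
\<close>

lemma (in fin_digraph) simple_path_module:
  assumes p: "infinite_path G p"
  shows "simple_module (LPA G) (path_module G p :: (('a, 'b, 'k::field) lpa_elem, _) module)"
proof -
  let ?M = "path_module G p :: (('a, 'b, 'k) lpa_elem, _) module"
  let ?T = "tail_class G p"
  interpret M: lpa_module G ?M by (rule lpa_module_path_module)
  have "p \<in> ?T" using p by (auto simp: tail_class_def)
  then have "Poly_Mapping.single p 1 \<in> carrier ?M" by simp
  moreover have "Poly_Mapping.single p 1 \<noteq> (0 :: _ \<Rightarrow>\<^sub>0 'k)"
    by (auto simp: poly_mapping_eq_iff fun_eq_iff lookup_single when_def)
  ultimately have nonzero: "carrier ?M \<noteq> {\<zero>\<^bsub>?M\<^esub>}"
    unfolding path_module_simps(2) by blast
  have "U = {\<zero>\<^bsub>?M\<^esub>} \<or> U = carrier ?M" if U: "submodule U (LPA G) ?M" for U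
  proof (cases "U \<subseteq> {0}")
    case True
    then show ?thesis using submoduleD(2)[OF U] by auto
  next
    case False
    then obtain x where x: "x \<in> U" "x \<noteq> 0" by auto
    have UM: "U \<subseteq> carrier ?M" by (rule submoduleD[OF U])
    have act: "gen_act G g y \<in> U" if "y \<in> U" "g \<in> lpa_gens G" for y g
      using submoduleD(5)[OF U lpa_class_closed[OF free_algebra_gen[OF that(2)]] that(1)]
        path_module_gact(2)[of y p g] UM that by (auto simp: M.gact_def)
    have scale: "Poly_Mapping.map ((*) c) y \<in> U" if "y \<in> U" for y c
      using submoduleD(5)[OF U lpa_class_closed[OF M.single0_FA[of c]] that(1)]
        path_module_gact(1)[of y p c] UM that by (auto simp: M.scal_def)
    have add: "y + z \<in> U" if "y \<in> U" "z \<in> U" for y z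
      using submoduleD(3)[OF U that] by simp
    from x(2) have "Poly_Mapping.keys x \<noteq> {}" by simp
    then obtain q where q: "q \<in> Poly_Mapping.keys x" by blast
    then have "q \<in> ?T" using subsetD[OF UM x(1)] by auto
    \<comment> \<open>The ghost edges of the first \<open>m\<close> edges of \<open>q\<close>,
      applied in order: a path that does not begin with these edges is sent to zero.\<close>
    define strip where "strip m y = fold (\<lambda>i. gen_act G (Ghost (q i))) [0..<m] y"
      for m and y :: "(nat \<Rightarrow> 'b) \<Rightarrow>\<^sub>0 'k"
    have strip_add: "strip m (y + z) = strip m y + strip m z" for m and y z :: "(nat \<Rightarrow> 'b) \<Rightarrow>\<^sub>0 'k"
      by (induction m) (simp_all add: strip_def gen_act_add)
    have strip_single: "strip m (Poly_Mapping.single r c) =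
        (if \<forall>i<m. q i = r i then Poly_Mapping.single (path_tail m r) c else 0)" for m r and c :: 'k
      by (induction m) (auto simp: strip_def less_Suc_eq)
    have strip_U: "strip m y \<in> U" if "y \<in> U" for m y
      using that by (induction m) (auto simp: strip_def intro!: act tail_classD[OF \<open>q \<in> ?T\<close>])
    define y where "y = x - Poly_Mapping.single q (Poly_Mapping.lookup x q)"
    have xy: "x = Poly_Mapping.single q (Poly_Mapping.lookup x q) + y" by (simp add: y_def)
    have qy: "q \<notin> Poly_Mapping.keys y" by (simp add: y_def in_keys_iff lookup_minus)
    have "\<exists>m. \<forall>r\<in>Poly_Mapping.keys y. \<exists>i<m. q i \<noteq> r i"
    proof -
      have "\<exists>i. q i \<noteq> r i" if "r \<in> Poly_Mapping.keys y" for r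
      proof -
        have "q \<noteq> r" using that qy by auto
        then show ?thesis by (simp add: fun_eq_iff)
      qed
      then have "\<forall>r\<in>Poly_Mapping.keys y. \<exists>i. q i \<noteq> r i" by blast
      from bchoice[OF this] obtain d where d: "\<forall>r\<in>Poly_Mapping.keys y. q (d r) \<noteq> r (d r)" ..
      \<comment> \<open>One length works for all paths in the finite support: one more than the
        largest chosen position of disagreement. For empty support the claim is vacuous.\<close>
      have "\<forall>r\<in>Poly_Mapping.keys y. d r < Suc (Max (d ` Poly_Mapping.keys y))"
        by (auto simp: less_Suc_eq_le)
      with d show ?thesis by blast
    qed
    then obtain m where m: "Poly_Mapping.keys y \<subseteq> {r. \<exists>i<m. q i \<noteq> r i}" by auto
    then have "strip m y = 0"
    proof (induction y rule: poly_mapping_single_induct)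
      case zero
      show ?case using strip_single[of m q 0] by simp
    next
      case (add k c f)
      then show ?case by (auto simp: strip_add strip_single)
    qed
    then have "strip m x = Poly_Mapping.single (path_tail m q) (Poly_Mapping.lookup x q)"
      by (subst xy) (simp add: strip_add strip_single)
    then have "Poly_Mapping.single (path_tail m q) (Poly_Mapping.lookup x q) \<in> U"
      using strip_U[OF x(1), of m] by simp
    from scale[OF this, of "inverse (Poly_Mapping.lookup x q)"]
    have base: "Poly_Mapping.single (path_tail m q) 1 \<in> U" using q by (simp add: in_keys_iff)
    have down: "Poly_Mapping.single (path_tail n r) 1 \<in> U" if "Poly_Mapping.single r 1 \<in> U" "r \<in> ?T" for r n
    proof (induction n)
      case (Suc n)
      from act[OF this, of "Ghost (r n)"] tail_classD[OF that(2)] show ?case by simp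
    qed (use that in simp)
    have up: "Poly_Mapping.single r 1 \<in> U" if "Poly_Mapping.single (path_tail n r) 1 \<in> U" "r \<in> ?T" for r n
      using that
    proof (induction n arbitrary: r)
      case (Suc n)
      then have "Poly_Mapping.single (path_tail (Suc 0) r) 1 \<in> U"
        using Suc.IH[of "path_tail (Suc 0) r"] path_tail_tail_class[of r G p "Suc 0"] by simp
      from act[OF this, of "Edge (r 0)"] tail_classD[OF Suc.prems(2)] show ?case by simp
    qed simp
    \<comment> \<open>From the isolated tail of \<open>q\<close>, ghost edges lead down to a tail
      shared with \<open>r\<close>, and the edges of \<open>r\<close> lead back up to
      \<open>r\<close>.\<close>
    have basis: "Poly_Mapping.single r 1 \<in> U" if r: "r \<in> ?T" for r
    proof -
      obtain a b where "path_tail a r = path_tail b (path_tail m q)"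
        using tail_class_common_tail[OF r path_tail_tail_class[OF \<open>q \<in> ?T\<close>, of m]] by auto
      then have "Poly_Mapping.single (path_tail a r) 1 \<in> U"
        using down[OF base path_tail_tail_class[OF \<open>q \<in> ?T\<close>], of b] by simp
      then show ?thesis by (rule up[OF _ r])
    qed
    have "z \<in> U" if "z \<in> carrier ?M" for z
    proof -
      have "Poly_Mapping.keys z \<subseteq> ?T" using that by simp
      then show ?thesis
      proof (induction z rule: poly_mapping_single_induct)
        case zero
        show ?case using submoduleD(2)[OF U] by simp
      next
        case (add k c f)
        then show ?case using scale[OF basis[of k], of c] assms by (intro \<open>\<And>y z. _ \<Longrightarrow> _ \<Longrightarrow> y + z \<in> U\<close>) auto
      qed
    qed
    with UM show ?thesis by auto
  qed
  with nonzero show ?thesis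
    unfolding simple_module_def using M.left_module_axioms by blast
qed

section \<open>Free covers and \<open>Ext\<close>\<close>

lemma (in abelian_group) minus_telescope:
  "\<lbrakk>x \<in> carrier G; y \<in> carrier G; z \<in> carrier G\<rbrakk> \<Longrightarrow> (x \<ominus> y) \<oplus> (y \<ominus> z) = x \<ominus> z"
  by (simp add: minus_eq a_assoc r_neg1)

lemma (in abelian_group) minus_zero_right: "x \<in> carrier G \<Longrightarrow> x \<ominus> \<zero> = x"
  using add.inv_one by (simp add: minus_eq)

lemma left_module_free_module:
  fixes R (structure)
  assumes "ring R"
  shows "left_module R (free_module R U)"
proof -
  interpret ring R by fact
  have supp_add: "{x. f x \<oplus> g x \<noteq> \<zero>} \<subseteq> {x. f x \<noteq> \<zero>} \<union> {x. g x \<noteq> \<zero>}" for f g by auto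
  have supp_smult: "{x. a \<otimes> f x \<noteq> \<zero>} \<subseteq> {x. f x \<noteq> \<zero>}" if "a \<in> carrier R" for a f
    using that by auto
  have carr: "f \<in> carrier (free_module R U) \<longleftrightarrow>
      (\<forall>x. f x \<in> carrier R) \<and> finite {x. f x \<noteq> \<zero>} \<and> {x. f x \<noteq> \<zero>} \<subseteq> U" for f
    by (auto simp: free_module_def)
  show ?thesis
  proof (intro left_module.intro left_module_axioms.intro abelian_groupI ring_axioms)
    fix f g assume "f \<in> carrier (free_module R U)" "g \<in> carrier (free_module R U)"
    then show "f \<oplus>\<^bsub>free_module R U\<^esub> g \<in> carrier (free_module R U)"
      using finite_subset[OF supp_add[of f g]] supp_add[of f g]
      unfolding carr by (simp add: free_module_def) blast
  next
    fix a f assume "a \<in> carrier R" "f \<in> carrier (free_module R U)"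
    then show "a \<odot>\<^bsub>free_module R U\<^esub> f \<in> carrier (free_module R U)"
      using finite_subset[OF supp_smult[of a f]] supp_smult[of a f]
      unfolding carr by (simp add: free_module_def) blast
  next
    fix f assume f: "f \<in> carrier (free_module R U)"
    then have "{x. \<ominus> f x \<noteq> \<zero>} = {x. f x \<noteq> \<zero>}"
      unfolding carr using minus_zero minus_minus by metis
    moreover have "f x \<in> carrier R" for x using f unfolding carr by blast
    ultimately show "\<exists>g\<in>carrier (free_module R U). g \<oplus>\<^bsub>free_module R U\<^esub> f = \<zero>\<^bsub>free_module R U\<^esub>"
      using f by (intro bexI[of _ "\<lambda>x. \<ominus> f x"]) (auto simp: carr l_neg free_module_def fun_eq_iff)
  next
    show "\<zero>\<^bsub>free_module R U\<^esub> \<in> carrier (free_module R U)" by (auto simp: free_module_def)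
  qed (auto simp: carr; auto simp: free_module_def fun_eq_iff a_ac l_distr r_distr m_assoc)+
qed

lemma free_module_simps:
  "f \<in> carrier (free_module R U) \<longleftrightarrow>
      (\<forall>x. f x \<in> carrier R) \<and> finite {x. f x \<noteq> \<zero>\<^bsub>R\<^esub>} \<and> {x. f x \<noteq> \<zero>\<^bsub>R\<^esub>} \<subseteq> U"
  "\<zero>\<^bsub>free_module R U\<^esub> = (\<lambda>_. \<zero>\<^bsub>R\<^esub>)"
  "f \<oplus>\<^bsub>free_module R U\<^esub> g = (\<lambda>x. f x \<oplus>\<^bsub>R\<^esub> g x)" "a \<odot>\<^bsub>free_module R U\<^esub> f = (\<lambda>x. a \<otimes>\<^bsub>R\<^esub> f x)"
  by (auto simp: free_module_def)

locale covered_module = left_module R M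
  for R :: "('r, 'x) ring_scheme" (structure) and M :: "('r, 'm) module" (structure)
begin

abbreviation "F \<equiv> free_module R (carrier M)"

abbreviation "cover \<equiv> free_cover R M"

lemma left_module_F: "left_module R F"
  by (rule left_module_free_module[OF R.ring_axioms])

lemma cover_superset:
  assumes "finite A" "A \<subseteq> carrier M" "f \<in> carrier F" "{x. f x \<noteq> \<zero>\<^bsub>R\<^esub>} \<subseteq> A"
  shows "cover f = (\<Oplus>\<^bsub>M\<^esub>x\<in>A. f x \<odot>\<^bsub>M\<^esub> x)"
  unfolding free_cover_def
  by (rule M.add.finprod_mono_neutral_cong_left)
    (use assms in \<open>auto simp: free_module_simps zero_smult subset_iff intro: smult_closed\<close>)

lemma cover_hom: "cover \<in> lmod_hom R F M"
proof (rule lmod_homI)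
  fix f assume f: "f \<in> carrier F"
  then show "cover f \<in> carrier M"
    unfolding free_cover_def by (intro M.finsum_closed) (auto simp: free_module_simps intro: smult_closed)
  fix a assume a: "a \<in> carrier R"
  let ?A = "{x. f x \<noteq> \<zero>\<^bsub>R\<^esub>}"
  have A: "finite ?A" "?A \<subseteq> carrier M" "\<And>x. f x \<in> carrier R" using f by (auto simp: free_module_simps)
  have "cover (a \<odot>\<^bsub>F\<^esub> f) = (\<Oplus>\<^bsub>M\<^esub>x\<in>?A. (a \<odot>\<^bsub>F\<^esub> f) x \<odot>\<^bsub>M\<^esub> x)"
    by (rule cover_superset)
      (use A a f left_module.smult_closed[OF left_module_F] in \<open>auto simp: free_module_simps(4)\<close>)
  also have "\<dots> = (\<Oplus>\<^bsub>M\<^esub>x\<in>?A. a \<odot>\<^bsub>M\<^esub> (f x \<odot>\<^bsub>M\<^esub> x))"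
    by (rule M.finsum_cong') (use A a in \<open>auto simp: free_module_simps(4) smult_assoc intro!: smult_closed\<close>)
  also have "\<dots> = a \<odot>\<^bsub>M\<^esub> cover f"
    unfolding free_cover_def by (rule smult_finsum[symmetric]) (use A a in \<open>auto intro!: smult_closed\<close>)
  finally show "cover (a \<odot>\<^bsub>F\<^esub> f) = a \<odot>\<^bsub>M\<^esub> cover f" .
next
  fix f g assume f: "f \<in> carrier F" and g: "g \<in> carrier F"
  let ?A = "{x. f x \<noteq> \<zero>\<^bsub>R\<^esub>} \<union> {x. g x \<noteq> \<zero>\<^bsub>R\<^esub>}"
  interpret F: left_module R F by (rule left_module_F)
  have A: "finite ?A" "?A \<subseteq> carrier M" "\<And>x. f x \<in> carrier R" "\<And>x. g x \<in> carrier R"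
    using f g by (auto simp: free_module_simps)
  have "cover (f \<oplus>\<^bsub>F\<^esub> g) = (\<Oplus>\<^bsub>M\<^esub>x\<in>?A. (f \<oplus>\<^bsub>F\<^esub> g) x \<odot>\<^bsub>M\<^esub> x)"
    by (rule cover_superset) (use A F.M.a_closed[OF f g] in \<open>auto simp: free_module_simps(3)\<close>)
  also have "\<dots> = (\<Oplus>\<^bsub>M\<^esub>x\<in>?A. f x \<odot>\<^bsub>M\<^esub> x \<oplus>\<^bsub>M\<^esub> g x \<odot>\<^bsub>M\<^esub> x)"
    by (rule M.finsum_cong') (use A in \<open>auto simp: free_module_simps(3) smult_l_distr intro!: smult_closed\<close>)
  also have "\<dots> = (\<Oplus>\<^bsub>M\<^esub>x\<in>?A. f x \<odot>\<^bsub>M\<^esub> x) \<oplus>\<^bsub>M\<^esub> (\<Oplus>\<^bsub>M\<^esub>x\<in>?A. g x \<odot>\<^bsub>M\<^esub> x)"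
    by (rule M.finsum_addf) (use A in \<open>auto intro!: smult_closed\<close>)
  also have "\<dots> = cover f \<oplus>\<^bsub>M\<^esub> cover g"
    using A by (simp add: cover_superset[of ?A, symmetric] f g)
  finally show "cover (f \<oplus>\<^bsub>F\<^esub> g) = cover f \<oplus>\<^bsub>M\<^esub> cover g" .
qed

definition point :: "'m \<Rightarrow> 'r \<Rightarrow> 'm \<Rightarrow> 'r" where
  "point x a = (\<lambda>y. if y = x then a else \<zero>\<^bsub>R\<^esub>)"

lemma point:
  assumes "x \<in> carrier M" "a \<in> carrier R"
  shows "point x a \<in> carrier F" "cover (point x a) = a \<odot>\<^bsub>M\<^esub> x"
proof -
  have "finite {y. point x a y \<noteq> \<zero>\<^bsub>R\<^esub>}" by (rule finite_subset[of _ "{x}"]) (auto simp: point_def)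
  then show *: "point x a \<in> carrier F"
    using assms by (auto simp: free_module_simps point_def split: if_splits)
  have "cover (point x a) = (\<Oplus>\<^bsub>M\<^esub>y\<in>{x}. point x a y \<odot>\<^bsub>M\<^esub> y)"
    by (rule cover_superset) (use assms * in \<open>auto simp: point_def\<close>)
  then show "cover (point x a) = a \<odot>\<^bsub>M\<^esub> x" using assms by (simp add: point_def smult_closed)
qed

lemma carrier_syzygy: "carrier (syzygy R M) = {u \<in> carrier F. cover u = \<zero>\<^bsub>M\<^esub>}"
  by (simp add: syzygy_def a_kernel_eq)

lemma syzygy_simps:
  "add (syzygy R M) = add F" "smult (syzygy R M) = smult F" "zero (syzygy R M) = zero F"
  by (simp_all add: syzygy_def)

lemma left_module_syzygy: "left_module R (syzygy R M)"
  unfolding syzygy_def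
  by (intro left_module_submodule submodule_kernel left_module_F cover_hom left_module_axioms)

text \<open>\<open>f\<close> is a coboundary: its restriction to the syzygy lies in the image of
  Hom(F, M), the subgroup that \<open>Ext1\<close> factors out.\<close>

definition extends :: "(('m \<Rightarrow> 'r) \<Rightarrow> 'm) \<Rightarrow> bool" where
  "extends f \<longleftrightarrow> (\<exists>g\<in>lmod_hom R F M. \<forall>u\<in>carrier (syzygy R M). g u = f u)"

end

text \<open>If every homomorphism on the syzygy extended, the subgroup \<open>?B\<close> would be
  the whole group, each of its cosets would equal \<open>?B\<close>, and the quotient would be
  trivial.\<close>

lemma Ext1_nonzeroD:
  assumes S: "left_module R S" and ext: "carrier (Ext1 R S S) \<noteq> {\<one>\<^bsub>Ext1 R S S\<^esub>}"
  shows "\<exists>f\<in>lmod_hom R (syzygy R S) S. \<not> covered_module.extends R S f"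
proof (rule ccontr)
  assume *: "\<not> ?thesis"
  interpret S: covered_module R S by (rule covered_module.intro[OF S])
  let ?Om = "syzygy R S" and ?F = "free_module R (carrier S)"
  let ?H = "hom_group R ?Om S"
  let ?B = "(\<lambda>f. restrict f (carrier ?Om)) ` carrier (hom_group R ?F S)"
  interpret Om: left_module R ?Om by (rule S.left_module_syzygy)
  have OmF: "carrier ?Om \<subseteq> carrier ?F" by (auto simp: S.carrier_syzygy)
  have H: "f \<in> carrier ?H \<longleftrightarrow> f \<in> lmod_hom R ?Om S \<and> f \<in> extensional (carrier ?Om)" for f
    by (simp add: hom_group_def)
  have B: "?B = carrier ?H"
  proof (intro Set.set_eqI iffI)
    fix f assume f: "f \<in> carrier ?H"
    then obtain g where g: "g \<in> lmod_hom R ?F S" "\<forall>u\<in>carrier ?Om. g u = f u"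
      using * by (auto simp: H S.extends_def)
    \<comment> \<open>The elements of \<open>hom_group\<close> are extensional functions, so an
      extension found on the free module has to be cut off outside its carrier.\<close>
    let ?g = "restrict g (carrier ?F)"
    have "?g \<in> carrier (hom_group R ?F S)"
      using g(1) left_module.smult_closed[OF S.left_module_F]
        abelian_group.axioms(1)[OF left_module_abelian_group[OF S.left_module_F]]
      by (auto simp: hom_group_def lmod_hom_def abelian_monoid.a_closed)
    moreover have "f = restrict ?g (carrier ?Om)"
      using f g(2) OmF by (auto simp: H extensional_def fun_eq_iff subset_iff)
    ultimately show "f \<in> ?B" by blast
  next
    fix f assume "f \<in> ?B"
    then obtain g where g: "g \<in> lmod_hom R ?F S" "f = restrict g (carrier ?Om)"
      by (auto simp: hom_group_def)
    note closed = Om.smult_closed Om.M.a_closed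
    show "f \<in> carrier ?H"
      unfolding H g(2)
      using lmod_homD[OF g(1)] OmF closed
      by (auto intro!: lmod_homI simp: S.syzygy_simps subset_iff)
  qed
  have "carrier (Ext1 R S S) = (\<lambda>f. ?B #>\<^bsub>?H\<^esub> f) ` carrier ?H"
    by (auto simp: Ext1_def FactGroup_def RCOSETS_def)
  also have "\<dots> = (\<lambda>_. ?B) ` carrier ?H"
  proof (rule image_cong[OF refl])
    fix f assume f: "f \<in> carrier ?H"
    show "?B #>\<^bsub>?H\<^esub> f = ?B"
      unfolding B
    proof (intro Set.set_eqI iffI)
      fix k assume "k \<in> carrier ?H #>\<^bsub>?H\<^esub> f"
      then obtain g where g: "g \<in> carrier ?H" "k = (\<lambda>x\<in>carrier ?Om. g x \<oplus>\<^bsub>S\<^esub> f x)"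
        by (auto simp: r_coset_def hom_group_def)
      have "k \<in> lmod_hom R ?Om S"
        unfolding g(2)
        by (rule lmod_homI) (use f g(1) in \<open>auto simp: H lmod_homD S.M.a_ac S.smult_r_distr Om.smult_closed S.smult_closed\<close>)
      then show "k \<in> carrier ?H" by (simp add: H g(2))
    next
      fix k assume k: "k \<in> carrier ?H"
      define g where "g = (\<lambda>x\<in>carrier ?Om. k x \<ominus>\<^bsub>S\<^esub> f x)"
      have "g \<in> lmod_hom R ?Om S"
        unfolding g_def
        by (rule lmod_homI) (use f k in \<open>auto simp: H lmod_homD S.M.a_ac S.smult_r_distr Om.smult_closed
            abelian_group_hom.hom_a_inv[OF S.smult_hom]
            S.smult_closed a_minus_def S.M.minus_add\<close>)
      then have "g \<in> carrier ?H" by (simp add: H g_def)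
      moreover have "k = g \<otimes>\<^bsub>?H\<^esub> f"
        using k f by (auto simp: g_def hom_group_def fun_eq_iff extensional_def lmod_homD S.M.minus_eq
            S.M.a_assoc S.M.l_neg)
      ultimately show "k \<in> carrier ?H #>\<^bsub>?H\<^esub> f" by (auto simp: r_coset_def)
    qed
  qed
  also have "(\<lambda>x\<in>carrier ?Om. \<zero>\<^bsub>S\<^esub>) \<in> carrier ?H"
    by (auto simp: H intro!: lmod_homI Om.smult_closed simp: S.smult_zero)
  then have "(\<lambda>_. ?B) ` carrier ?H = {?B}" by (rule image_constant)
  finally have "carrier (Ext1 R S S) = {?B}" .
  moreover have "\<one>\<^bsub>Ext1 R S S\<^esub> = ?B" by (simp add: Ext1_def FactGroup_def)
  ultimately show False using ext by simp
qed

text \<open>As an additive group the free module is the sum of the syzygy and the image of the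
  section \<sigma>. An additive extension of \<open>f\<close> is thus an arbitrary additive \<mu> on
  the second summand, and \<open>cob\<close> is exactly what makes the result linear over the ring:
  the derivation attached to \<open>f\<close> and \<sigma> is the inner one given by \<mu>.\<close>

lemma (in covered_module) extendsI:
  assumes f: "f \<in> lmod_hom R (syzygy R M) M"
    and \<sigma>: "abelian_group_hom M F \<sigma>" "\<And>x. x \<in> carrier M \<Longrightarrow> cover (\<sigma> x) = x"
    and \<mu>: "abelian_group_hom M M \<mu>"
    and cob: "\<And>a x. \<lbrakk>a \<in> carrier R; x \<in> carrier M\<rbrakk> \<Longrightarrow>
      f (a \<odot>\<^bsub>F\<^esub> \<sigma> x \<ominus>\<^bsub>F\<^esub> \<sigma> (a \<odot>\<^bsub>M\<^esub> x)) \<oplus>\<^bsub>M\<^esub> \<mu> (a \<odot>\<^bsub>M\<^esub> x) = a \<odot>\<^bsub>M\<^esub> \<mu> x"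
  shows "extends f"
proof -
  interpret F: left_module R F by (rule left_module_F)
  interpret Om: left_module R "syzygy R M" by (rule left_module_syzygy)
  interpret \<sigma>: abelian_group_hom M F \<sigma> by fact
  interpret \<mu>: abelian_group_hom M M \<mu> by fact
  interpret cover: abelian_group_hom F M cover
    by (rule lmod_hom_abelian_group_hom[OF cover_hom left_module_F left_module_axioms])
  note f' = lmod_homD[OF f, unfolded syzygy_simps carrier_syzygy]
  note cover_smult = lmod_homD(4)[OF cover_hom]
  define g where "g u = f (u \<ominus>\<^bsub>F\<^esub> \<sigma> (cover u)) \<oplus>\<^bsub>M\<^esub> \<mu> (cover u)" for u
  have ker: "u \<ominus>\<^bsub>F\<^esub> \<sigma> (cover u) \<in> carrier F" "cover (u \<ominus>\<^bsub>F\<^esub> \<sigma> (cover u)) = \<zero>\<^bsub>M\<^esub>" if "u \<in> carrier F" for u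
    using that by (simp_all add: cover.hom_minus \<sigma>(2) M.minus_eq M.r_neg)
  have "g \<in> lmod_hom R F M"
  proof (rule lmod_homI)
    fix u assume u: "u \<in> carrier F"
    then show "g u \<in> carrier M" using ker f' by (simp add: g_def)
    fix a assume a: "a \<in> carrier R"
    let ?x = "cover u"
    let ?k = "a \<odot>\<^bsub>F\<^esub> \<sigma> ?x \<ominus>\<^bsub>F\<^esub> \<sigma> (a \<odot>\<^bsub>M\<^esub> ?x)"
    have x: "?x \<in> carrier M" using u by simp
    have k: "?k \<in> carrier F" "cover ?k = \<zero>\<^bsub>M\<^esub>"
      using a u by (simp_all add: F.smult_closed smult_closed cover.hom_minus cover_smult \<sigma>(2) M.minus_eq M.r_neg)
    \<comment> \<open>The term \<open>a \<odot> \<sigma> ?x\<close> is subtracted and added again,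
      which splits the left side into two elements of the syzygy.\<close>
    have "a \<odot>\<^bsub>F\<^esub> u \<ominus>\<^bsub>F\<^esub> \<sigma> (cover (a \<odot>\<^bsub>F\<^esub> u)) = a \<odot>\<^bsub>F\<^esub> (u \<ominus>\<^bsub>F\<^esub> \<sigma> ?x) \<oplus>\<^bsub>F\<^esub> ?k"
      using a u by (simp add: cover_smult F.smult_minus F.smult_closed smult_closed F.M.minus_telescope)
    then have "g (a \<odot>\<^bsub>F\<^esub> u) = f (a \<odot>\<^bsub>F\<^esub> (u \<ominus>\<^bsub>F\<^esub> \<sigma> ?x) \<oplus>\<^bsub>F\<^esub> ?k) \<oplus>\<^bsub>M\<^esub> \<mu> (a \<odot>\<^bsub>M\<^esub> ?x)"
      using a u by (simp add: g_def cover_smult)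
    also have "f (a \<odot>\<^bsub>F\<^esub> (u \<ominus>\<^bsub>F\<^esub> \<sigma> ?x) \<oplus>\<^bsub>F\<^esub> ?k) = a \<odot>\<^bsub>M\<^esub> f (u \<ominus>\<^bsub>F\<^esub> \<sigma> ?x) \<oplus>\<^bsub>M\<^esub> f ?k"
      using ker[OF u] k a f' by (simp add: F.smult_closed cover_smult smult_zero)
    also have "\<dots> \<oplus>\<^bsub>M\<^esub> \<mu> (a \<odot>\<^bsub>M\<^esub> ?x) = a \<odot>\<^bsub>M\<^esub> f (u \<ominus>\<^bsub>F\<^esub> \<sigma> ?x) \<oplus>\<^bsub>M\<^esub> (f ?k \<oplus>\<^bsub>M\<^esub> \<mu> (a \<odot>\<^bsub>M\<^esub> ?x))"
      using ker[OF u] k a f' x by (simp add: smult_closed M.a_assoc)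
    also have "\<dots> = a \<odot>\<^bsub>M\<^esub> g u"
      using ker[OF u] a f' x by (simp add: cob g_def smult_r_distr)
    finally show "g (a \<odot>\<^bsub>F\<^esub> u) = a \<odot>\<^bsub>M\<^esub> g u" .
  next
    fix u v assume u: "u \<in> carrier F" "v \<in> carrier F"
    have "u \<oplus>\<^bsub>F\<^esub> v \<ominus>\<^bsub>F\<^esub> \<sigma> (cover (u \<oplus>\<^bsub>F\<^esub> v)) = (u \<ominus>\<^bsub>F\<^esub> \<sigma> (cover u)) \<oplus>\<^bsub>F\<^esub> (v \<ominus>\<^bsub>F\<^esub> \<sigma> (cover v))"
      using u by (simp add: F.M.minus_eq F.M.minus_add F.M.a_ac)
    then have "f (u \<oplus>\<^bsub>F\<^esub> v \<ominus>\<^bsub>F\<^esub> \<sigma> (cover (u \<oplus>\<^bsub>F\<^esub> v))) = f (u \<ominus>\<^bsub>F\<^esub> \<sigma> (cover u)) \<oplus>\<^bsub>M\<^esub> f (v \<ominus>\<^bsub>F\<^esub> \<sigma> (cover v))"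
      using u ker f' by simp
    then show "g (u \<oplus>\<^bsub>F\<^esub> v) = g u \<oplus>\<^bsub>M\<^esub> g v"
      unfolding g_def using u ker[OF u(1)] ker[OF u(2)] f'(2) by (simp add: M.a_ac)
  qed
  moreover have "g u = f u" if "u \<in> carrier (syzygy R M)" for u
    using that f'(2) by (simp add: g_def carrier_syzygy F.M.minus_zero_right)
  ultimately show ?thesis unfolding extends_def by blast
qed

text \<open>For a section that is a module homomorphism the derivation vanishes, so the zero map
  serves as \<mu>.\<close>

lemma extends_of_section:
  assumes S: "left_module R S" and f: "f \<in> lmod_hom R (syzygy R S) S"
    and \<sigma>: "\<sigma> \<in> lmod_hom R S (free_module R (carrier S))"
      "\<And>x. x \<in> carrier S \<Longrightarrow> free_cover R S (\<sigma> x) = x"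
  shows "covered_module.extends R S f"
proof -
  interpret S: covered_module R S by (rule covered_module.intro[OF S])
  interpret F: left_module R S.F by (rule S.left_module_F)
  interpret \<sigma>: abelian_group_hom S S.F \<sigma> by (rule lmod_hom_abelian_group_hom[OF \<sigma>(1) S S.left_module_F])
  interpret f: abelian_group_hom "syzygy R S" S f
    by (rule lmod_hom_abelian_group_hom[OF f S.left_module_syzygy S])
  have "abelian_group_hom S S (\<lambda>_. \<zero>\<^bsub>S\<^esub>)"
    by (intro abelian_group_homI' S.M.abelian_group_axioms) auto
  then show ?thesis
    using f.hom_zero
    by (intro S.extendsI[OF f \<sigma>.abelian_group_hom_axioms \<sigma>(2)])
      (auto simp: lmod_homD(4)[OF \<sigma>(1)] F.M.minus_eq F.M.r_neg F.smult_closed S.syzygy_simps S.smult_zero)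
qed

text \<open>A left ideal generated by an idempotent is projective. The section is explicit: with
  \<open>u\<close> the element that \<phi> sends to the vertex, \<open>x\<close> goes to the basis
  element at \<open>u\<close> with coefficient \<open>\<phi> x\<close>.\<close>

lemma (in fin_digraph) sink_extends:
  assumes w: "w \<in> verts G" and S: "left_module (LPA G) S"
    and iso: "lmod_iso (LPA G) S (principal_left_ideal (LPA G) (lpa_vertex G w :: ('a, 'b, 'k::field) lpa_elem))"
    and f: "f \<in> lmod_hom (LPA G) (syzygy (LPA G) S) S"
  shows "covered_module.extends (LPA G) S f"
proof -
  let ?R = "LPA G :: ('a, 'b, 'k) lpa_elem ring" and ?w = "lpa_vertex G w :: ('a, 'b, 'k) lpa_elem"
  let ?P = "principal_left_ideal ?R ?w"
  interpret S: covered_module ?R S by (rule covered_module.intro[OF S])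
  obtain \<phi> where \<phi>: "\<phi> \<in> lmod_hom ?R S ?P" and bij: "bij_betw \<phi> (carrier S) (carrier ?P)"
    using iso by (auto simp: lmod_iso_def)
  have w_class: "?w = lpa_class G (gen (Vertex w))" by (simp add: lpa_vertex_def lpa_class_def)
  have wR: "?w \<in> carrier ?R" using w by (simp add: w_class lpa_class_closed free_algebra_gen)
  have "lpa_class G (gen (Vertex w) * gen (Vertex w)) = lpa_class G (gen (Vertex w) :: _ \<Rightarrow>\<^sub>0 'k)"
    by (rule lpa_class_eqI) (use w in \<open>auto simp: lpa_relations_def free_algebra_gen free_algebra_closed\<close>)
  then have idem: "?w \<otimes>\<^bsub>?R\<^esub> ?w = ?w"
    using w by (simp add: w_class lpa_class_simps free_algebra_gen)
  have P: "carrier ?P = {b \<otimes>\<^bsub>?R\<^esub> ?w |b. b \<in> carrier ?R}" "add ?P = add ?R" "smult ?P = mult ?R"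
    by (simp_all add: principal_left_ideal_def)
  have "?w \<in> carrier ?P" unfolding P using wR idem by force
  then obtain u where u: "u \<in> carrier S" "\<phi> u = ?w"
    using bij_betw_imp_surj_on[OF bij] by (metis imageE)
  have \<phi>w: "\<phi> x \<in> carrier ?R" "\<phi> x \<otimes>\<^bsub>?R\<^esub> ?w = \<phi> x" if x: "x \<in> carrier S" for x
  proof -
    obtain b where "b \<in> carrier ?R" "\<phi> x = b \<otimes>\<^bsub>?R\<^esub> ?w" using lmod_homD(2)[OF \<phi> x] unfolding P by auto
    then show "\<phi> x \<in> carrier ?R" "\<phi> x \<otimes>\<^bsub>?R\<^esub> ?w = \<phi> x" using wR idem by (simp_all add: S.R.m_assoc)
  qed
  \<comment> \<open>Both sides have the same image under the injective map \<phi>, since right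
    multiplication by the idempotent fixes \<open>\<phi> x\<close>.\<close>
  have \<phi>u: "\<phi> x \<odot>\<^bsub>S\<^esub> u = x" if x: "x \<in> carrier S" for x
  proof -
    have "\<phi> (\<phi> x \<odot>\<^bsub>S\<^esub> u) = \<phi> x" using lmod_homD(4)[OF \<phi>] \<phi>w[OF x] u by (simp add: P)
    then show ?thesis
      using bij S.smult_closed[OF \<phi>w(1)[OF x] u(1)] x by (auto simp: bij_betw_def inj_on_def)
  qed
  show ?thesis
  proof (rule extends_of_section[OF S f])
    show "(\<lambda>x. S.point u (\<phi> x)) \<in> lmod_hom ?R S S.F"
    proof (rule lmod_homI)
      show "S.point u (\<phi> x) \<in> carrier S.F" if "x \<in> carrier S" for x
        by (rule S.point(1)[OF u(1) \<phi>w(1)[OF that]])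
    qed (use \<phi>w lmod_homD(3,4)[OF \<phi>] in \<open>auto simp: free_module_simps(3,4) P S.point_def fun_eq_iff\<close>)
    show "free_cover ?R S (S.point u (\<phi> x)) = x" if "x \<in> carrier S" for x
      using S.point(2)[OF u(1) \<phi>w(1)[OF that]] \<phi>u[OF that] by simp
  qed
qed

section \<open>Twisted direct sums\<close>

definition prod_module :: "('r, 'l) module \<Rightarrow> ('r, 's) module \<Rightarrow> ('r, 'l \<times> 's) module" where
  "prod_module L S = \<lparr>carrier = carrier L \<times> carrier S, mult = undefined, one = undefined,
     zero = (\<zero>\<^bsub>L\<^esub>, \<zero>\<^bsub>S\<^esub>), add = (\<lambda>(a, b) (c, d). (a \<oplus>\<^bsub>L\<^esub> c, b \<oplus>\<^bsub>S\<^esub> d)),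
     smult = (\<lambda>r (a, b). (r \<odot>\<^bsub>L\<^esub> a, r \<odot>\<^bsub>S\<^esub> b))\<rparr>"

lemma prod_module_simps [simp]:
  "carrier (prod_module L S) = carrier L \<times> carrier S" "\<zero>\<^bsub>prod_module L S\<^esub> = (\<zero>\<^bsub>L\<^esub>, \<zero>\<^bsub>S\<^esub>)"
  "(a, b) \<oplus>\<^bsub>prod_module L S\<^esub> (c, d) = (a \<oplus>\<^bsub>L\<^esub> c, b \<oplus>\<^bsub>S\<^esub> d)"
  "r \<odot>\<^bsub>prod_module L S\<^esub> (a, b) = (r \<odot>\<^bsub>L\<^esub> a, r \<odot>\<^bsub>S\<^esub> b)"
  by (simp_all add: prod_module_def)

lemma left_module_prod_module:
  assumes "left_module R L" "left_module R S"
  shows "left_module R (prod_module L S)"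
proof -
  interpret L: left_module R L by fact
  interpret S: left_module R S by fact
  show ?thesis
  proof (intro left_module.intro left_module_axioms.intro abelian_groupI L.R.ring_axioms)
    fix x assume "x \<in> carrier (prod_module L S)"
    then show "\<exists>y\<in>carrier (prod_module L S). y \<oplus>\<^bsub>prod_module L S\<^esub> x = \<zero>\<^bsub>prod_module L S\<^esub>"
      by (intro bexI[of _ "(\<ominus>\<^bsub>L\<^esub> fst x, \<ominus>\<^bsub>S\<^esub> snd x)"]) (auto simp: L.M.l_neg S.M.l_neg)
  qed (auto simp: L.M.a_ac S.M.a_ac L.smult_closed S.smult_closed L.smult_l_distr S.smult_l_distr
      L.smult_r_distr S.smult_r_distr L.smult_assoc S.smult_assoc L.smult_one S.smult_one)
qed

text \<open>Residue classes act through any representative, as in \<open>path_module\<close>;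
  \<open>the_elem_alg_act\<close> shows that the choice does not matter when the data satisfy
  \<open>lpa_rep\<close>.\<close>

definition rep_module :: "('a, 'x) ring_scheme \<Rightarrow> ('k::field \<Rightarrow> 'a \<Rightarrow> 'a) \<Rightarrow>
    (('v, 'e) lpa_gen \<Rightarrow> 'a \<Rightarrow> 'a) \<Rightarrow> (('v, 'e, 'k) lpa_elem, 'a) module" where
  "rep_module M sc act = \<lparr>carrier = carrier M, mult = undefined, one = undefined,
     zero = \<zero>\<^bsub>M\<^esub>, add = add M, smult = (\<lambda>U x. the_elem ((\<lambda>f. lpa_rep.alg_act M sc act f x) ` U))\<rparr>"

lemma rep_module_simps [simp]:
  "carrier (rep_module M sc act) = carrier M" "\<zero>\<^bsub>rep_module M sc act\<^esub> = \<zero>\<^bsub>M\<^esub>"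
  "add (rep_module M sc act) = add M"
  by (simp_all add: rep_module_def)

lemma lpa_module_rep_module:
  assumes "lpa_rep E M sc act"
  shows "lpa_module E (rep_module M sc act)"
    "\<And>c x. x \<in> carrier M \<Longrightarrow> lpa_module.scal E (rep_module M sc act) c x = sc c x"
    "\<And>g x. \<lbrakk>g \<in> lpa_gens E; x \<in> carrier M\<rbrakk> \<Longrightarrow> lpa_module.gact E (rep_module M sc act) g x = act g x"
proof -
  interpret rep: lpa_rep E M sc act by fact
  have smult: "lpa_class E f \<odot>\<^bsub>rep_module M sc act\<^esub> x = rep.alg_act f x"
    if "f \<in> rep.FA" "x \<in> carrier M" for f x
    using rep.the_elem_alg_act[OF that] by (simp add: rep_module_def)
  show "lpa_module E (rep_module M sc act)"
    by (intro lpa_module.intro rep.fin_digraph_axioms left_module_of_rep[OF assms] smult) auto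
  then interpret N: lpa_module E "rep_module M sc act" .
  show "N.scal c x = sc c x" if "x \<in> carrier M" for c x
    using that by (simp add: N.scal_def smult N.single0_FA rep.alg_act_scalar)
  show "N.gact g x = act g x" if "g \<in> lpa_gens E" "x \<in> carrier M" for g x
    using that by (simp add: N.gact_def smult free_algebra_gen rep.alg_act_gen)
qed

locale twisted_sum = L: lpa_module E L + S: lpa_module E S
  for E :: "('v, 'e) pre_digraph" and L :: "(('v, 'e, 'k::field) lpa_elem, 'l) module"
    and S :: "(('v, 'e, 'k) lpa_elem, 's) module" +
  fixes h :: "'s \<Rightarrow> 'l"
  assumes h_hom: "abelian_group_hom S L h"
    and h_scal: "x \<in> carrier S \<Longrightarrow> h (S.scal c x) = L.scal c (h x)"
    and h_vertex: "\<lbrakk>v \<in> verts E; x \<in> carrier S\<rbrakk> \<Longrightarrow>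
      h (S.gact (Vertex v) x) = L.gact (Vertex v) (h x)"
begin

sublocale Z: lpa_module E "prod_module L S"
  by (intro lpa_module.intro L.fin_digraph_axioms left_module_prod_module
      L.left_module_axioms S.left_module_axioms)

sublocale h: abelian_group_hom S L h
  by (rule h_hom)

lemma prod_scal: "Z.scal c (l, x) = (L.scal c l, S.scal c x)"
  by (simp add: Z.scal_def L.scal_def S.scal_def)

lemma prod_gact: "Z.gact g (l, x) = (L.gact g l, S.gact g x)"
  by (simp add: Z.gact_def L.gact_def S.gact_def)

definition shear :: "'l \<times> 's \<Rightarrow> 'l \<times> 's" where
  "shear = (\<lambda>(l, x). (l \<oplus>\<^bsub>L\<^esub> h x, x))"

definition unshear :: "'l \<times> 's \<Rightarrow> 'l \<times> 's" where
  "unshear = (\<lambda>(l, x). (l \<ominus>\<^bsub>L\<^esub> h x, x))"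

text \<open>
  Multiplying the edges on the left by an automorphism that commutes with the vertices, and the ghost
  edges on the right by its inverse, preserves (CK1) and (CK2) because both pair an edge with a
  ghost edge.
\<close>

fun twisted_act :: "('v, 'e) lpa_gen \<Rightarrow> 'l \<times> 's \<Rightarrow> 'l \<times> 's" where
  "twisted_act (Vertex v) m = Z.gact (Vertex v) m"
| "twisted_act (Edge e) m = shear (Z.gact (Edge e) m)"
| "twisted_act (Ghost e) m = Z.gact (Ghost e) (unshear m)"

lemma lpa_rep_twisted_act: "lpa_rep E (prod_module L S) Z.scal twisted_act"
proof (rule Z.rep.lpa_rep_twist)
  show "abelian_group_hom (prod_module L S) (prod_module L S) shear"
    by (intro abelian_group_homI' Z.M.abelian_group_axioms)
      (auto simp: shear_def L.M.a_ac)
  show "abelian_group_hom (prod_module L S) (prod_module L S) unshear"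
    by (intro abelian_group_homI' Z.M.abelian_group_axioms)
      (auto simp: unshear_def L.M.a_ac L.M.minus_eq L.M.minus_add)
qed (auto simp: shear_def unshear_def prod_scal prod_gact h_scal h_vertex L.rep.sc_add L.rep.act_add
    L.M.minus_eq L.M.a_assoc L.M.l_neg L.M.r_neg)

section \<open>The extension carried by the twisted sum\<close>

definition ext :: "(('v, 'e, 'k) lpa_elem, 'l \<times> 's) module" where
  "ext = rep_module (prod_module L S) Z.scal twisted_act"

sublocale X: lpa_module E ext
  unfolding ext_def by (rule lpa_module_rep_module[OF lpa_rep_twisted_act])

lemma ext_simps [simp]:
  "carrier ext = carrier L \<times> carrier S" "\<zero>\<^bsub>ext\<^esub> = (\<zero>\<^bsub>L\<^esub>, \<zero>\<^bsub>S\<^esub>)"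
  "(a, b) \<oplus>\<^bsub>ext\<^esub> (c, d) = (a \<oplus>\<^bsub>L\<^esub> c, b \<oplus>\<^bsub>S\<^esub> d)"
  by (simp_all add: ext_def)

lemma ext_act:
  assumes "l \<in> carrier L" "x \<in> carrier S"
  shows "X.scal c (l, x) = (L.scal c l, S.scal c x)"
    "v \<in> verts E \<Longrightarrow> X.gact (Vertex v) (l, x) = (L.gact (Vertex v) l, S.gact (Vertex v) x)"
    "e \<in> arcs E \<Longrightarrow> X.gact (Edge e) (l, x) =
      (L.gact (Edge e) l \<oplus>\<^bsub>L\<^esub> h (S.gact (Edge e) x), S.gact (Edge e) x)"
    "e \<in> arcs E \<Longrightarrow> X.gact (Ghost e) (l, x) =
      (L.gact (Ghost e) (l \<ominus>\<^bsub>L\<^esub> h x), S.gact (Ghost e) x)"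
  using lpa_module_rep_module(2,3)[OF lpa_rep_twisted_act, folded ext_def] assms
  by (simp_all add: prod_scal prod_gact shear_def unshear_def)

lemma lpa_gens_cases:
  assumes "g \<in> lpa_gens E"
  obtains v where "g = Vertex v" "v \<in> verts E" | e where "g = Edge e" "e \<in> arcs E"
    | e where "g = Ghost e" "e \<in> arcs E"
  using assms by (cases g) auto

text \<open>The shear alters only the first component, so the second component sees the original
  action on \<open>S\<close>.\<close>

lemma snd_hom: "snd \<in> lmod_hom (LPA E) ext S"
proof (rule lmod_hom_gensI)
  show "abelian_group_hom ext S snd"
    by (intro abelian_group_homI' X.M.abelian_group_axioms S.M.abelian_group_axioms) auto
  show "snd (X.gact g m) = S.gact g (snd m)" if "g \<in> lpa_gens E" "m \<in> carrier ext" for g m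
    using that by (elim lpa_gens_cases) (auto simp: ext_act)
qed (auto simp: ext_act intro: X.lpa_module_axioms S.lpa_module_axioms)

text \<open>On elements with second component zero the correction term is a value of
  \<open>h\<close> at zero, so the twist leaves the action on \<open>L\<close> untouched.\<close>

lemma inl_hom: "(\<lambda>l. (l, \<zero>\<^bsub>S\<^esub>)) \<in> lmod_hom (LPA E) L ext"
proof (rule lmod_hom_gensI)
  show "abelian_group_hom L ext (\<lambda>l. (l, \<zero>\<^bsub>S\<^esub>))"
    by (intro abelian_group_homI' X.M.abelian_group_axioms L.M.abelian_group_axioms) auto
  have zero: "S.gact g \<zero>\<^bsub>S\<^esub> = \<zero>\<^bsub>S\<^esub>" if "g \<in> lpa_gens E" for g
    by (rule abelian_group_hom.hom_zero[OF S.rep.act_hom[OF that]])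
  show "(L.gact g l, \<zero>\<^bsub>S\<^esub>) = X.gact g (l, \<zero>\<^bsub>S\<^esub>)" if "g \<in> lpa_gens E" "l \<in> carrier L" for g l
    using that by (elim lpa_gens_cases)
      (auto simp: ext_act zero L.M.minus_zero_right L.rep.act_closed)
qed (auto simp: ext_act S.rep.sc_zero intro: X.lpa_module_axioms L.lpa_module_axioms)

lemma is_extension_ext: "is_extension (LPA E) ext L S"
  unfolding is_extension_def
proof (intro conjI bexI[OF _ inl_hom] bexI[OF _ snd_hom])
  show "(\<lambda>l. (l, \<zero>\<^bsub>S\<^esub>)) ` carrier L = a_kernel ext S snd"
    by (auto simp: a_kernel_eq)
  show "snd ` carrier ext = carrier S"
    using L.M.zero_closed by force
qed (auto intro: inj_onI X.left_module_axioms L.left_module_axioms S.left_module_axioms)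

end

section \<open>Lifting uniserial modules\<close>

text \<open>\<open>\<pi>\<close> identifies \<open>S\<close> with the top of the uniserial module \<open>L\<close>.\<close>

definition uniserial_top ::
  "('r, 'x) ring_scheme \<Rightarrow> ('r, 'l) module \<Rightarrow> ('r, 's) module \<Rightarrow> ('l \<Rightarrow> 's) \<Rightarrow> bool" where
  "uniserial_top R L S \<pi> \<longleftrightarrow> uniserial R L \<and> \<pi> \<in> lmod_hom R L S \<and> \<pi> ` carrier L = carrier S \<and>
     (\<forall>N. submodule N R L \<longrightarrow> N \<subseteq> a_kernel L S \<pi> \<or> N = carrier L)"

text \<open>
  \<open>d\<close> is the derivation of \<open>L\<^sub>K(E)\<close> into the additive endomorphisms of \<open>S\<close> that describes the
  quotient of the twisted sum by the kernel of \<open>\<pi>\<close>, an extension of \<open>S\<close> by \<open>S\<close>; the last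
  assumption says that this extension does not split.
\<close>

locale twisted_top = twisted_sum E L S h
  for E :: "('v, 'e) pre_digraph" and L :: "(('v, 'e, 'k::field) lpa_elem, 'l) module"
    and S :: "(('v, 'e, 'k) lpa_elem, 's) module" and h :: "'s \<Rightarrow> 'l" +
  fixes \<pi> :: "'l \<Rightarrow> 's" and d :: "('v, 'e, 'k) lpa_elem \<Rightarrow> 's \<Rightarrow> 's"
  assumes top: "uniserial_top (LPA E) L S \<pi>"
    and d_closed: "\<lbrakk>a \<in> carrier (LPA E); x \<in> carrier S\<rbrakk> \<Longrightarrow> d a x \<in> carrier S"
    and d_add: "\<lbrakk>a \<in> carrier (LPA E); b \<in> carrier (LPA E); x \<in> carrier S\<rbrakk> \<Longrightarrow>
      d (a \<oplus>\<^bsub>LPA E\<^esub> b) x = d a x \<oplus>\<^bsub>S\<^esub> d b x"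
    and d_mult: "\<lbrakk>a \<in> carrier (LPA E); b \<in> carrier (LPA E); x \<in> carrier S\<rbrakk> \<Longrightarrow>
      d (a \<otimes>\<^bsub>LPA E\<^esub> b) x = a \<odot>\<^bsub>S\<^esub> d b x \<oplus>\<^bsub>S\<^esub> d a (b \<odot>\<^bsub>S\<^esub> x)"
    and d_scalar: "x \<in> carrier S \<Longrightarrow> d (lpa_class E (Poly_Mapping.single 0 c)) x = \<zero>\<^bsub>S\<^esub>"
    and d_vertex: "\<lbrakk>v \<in> verts E; x \<in> carrier S\<rbrakk> \<Longrightarrow> d (lpa_class E (gen (Vertex v))) x = \<zero>\<^bsub>S\<^esub>"
    and d_edge: "\<lbrakk>e \<in> arcs E; x \<in> carrier S\<rbrakk> \<Longrightarrow>
      d (lpa_class E (gen (Edge e))) x = \<pi> (h (S.gact (Edge e) x))"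
    and d_ghost: "\<lbrakk>e \<in> arcs E; x \<in> carrier S\<rbrakk> \<Longrightarrow>
      d (lpa_class E (gen (Ghost e))) x = \<ominus>\<^bsub>S\<^esub> S.gact (Ghost e) (\<pi> (h x))"
    and not_cob: "\<not> (\<exists>\<mu>. abelian_group_hom S S \<mu> \<and> (\<forall>a\<in>carrier (LPA E). \<forall>x\<in>carrier S.
      d a x \<oplus>\<^bsub>S\<^esub> \<mu> (a \<odot>\<^bsub>S\<^esub> x) = a \<odot>\<^bsub>S\<^esub> \<mu> x))"
begin

lemma pi_hom: "\<pi> \<in> lmod_hom (LPA E) L S" and pi_surj: "\<pi> ` carrier L = carrier S"
  and L_top: "submodule N (LPA E) L \<Longrightarrow> N \<subseteq> a_kernel L S \<pi> \<or> N = carrier L"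
  and L_chain: "\<lbrakk>submodule N (LPA E) L; submodule N' (LPA E) L\<rbrakk> \<Longrightarrow> N \<subseteq> N' \<or> N' \<subseteq> N"
  using top by (auto simp: uniserial_top_def uniserial_def)

sublocale pi: abelian_group_hom L S \<pi>
  by (rule lmod_hom_abelian_group_hom[OF pi_hom L.left_module_axioms S.left_module_axioms])

text \<open>The formula is stable under products because the derivation rule \<open>d_mult\<close>
  is precisely what results from letting \<open>b\<close> and then \<open>a\<close> act. On
  generators it restates how \<open>d\<close> was matched with \<open>h\<close>, so
  \<open>LPA_induct\<close> gives it everywhere.\<close>

lemma pi_fst_smult:
  assumes "a \<in> carrier (LPA E)" "m \<in> carrier ext"
  shows "\<pi> (fst (a \<odot>\<^bsub>ext\<^esub> m)) = a \<odot>\<^bsub>S\<^esub> \<pi> (fst m) \<oplus>\<^bsub>S\<^esub> d a (snd m)"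
  using assms
proof (induction arbitrary: m rule: L.LPA_induct)
  case (scalar c)
  obtain l x where m: "m = (l, x)" "l \<in> carrier L" "x \<in> carrier S" using scalar by (cases m) auto
  have "\<pi> (L.scal c l) = S.scal c (\<pi> l)"
    using m lmod_homD(4)[OF pi_hom] by (simp add: L.scal_def S.scal_def lpa_class_closed L.single0_FA)
  then show ?case
    using ext_act(1)[OF m(2,3), of c] m d_scalar
    by (simp add: X.scal_def S.scal_def S.smult_closed lpa_class_closed L.single0_FA)
next
  case (gen g)
  obtain l x where m: "m = (l, x)" "l \<in> carrier L" "x \<in> carrier S" using gen by (cases m) auto
  have pi_gact: "\<pi> (L.gact g y) = S.gact g (\<pi> y)" if "y \<in> carrier L" for y
    using that gen lmod_homD(4)[OF pi_hom] by (simp add: L.gact_def S.gact_def lpa_class_closed free_algebra_gen)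
  have closed: "S.gact g y \<in> carrier S" if "y \<in> carrier S" for y
    using S.rep.act_closed[OF gen(1) that] .
  have "\<pi> (fst (X.gact g m)) = S.gact g (\<pi> (fst m)) \<oplus>\<^bsub>S\<^esub> d (lpa_class E (gen g)) (snd m)"
    using gen(1)
  proof (cases rule: lpa_gens_cases)
    case (1 v)
    then show ?thesis using m pi_gact closed by (simp add: ext_act d_vertex)
  next
    case (2 e)
    then show ?thesis
      using m pi_gact closed by (simp add: ext_act d_edge L.rep.act_closed)
  next
    \<comment> \<open>The twisted ghost edge acts on \<open>l\<close> minus \<open>h x\<close>; this
      is the origin of the minus sign in \<open>d_ghost\<close>.\<close>
    case (3 e)
    have "S.gact g (\<pi> l \<ominus>\<^bsub>S\<^esub> \<pi> (h x)) = S.gact g (\<pi> l) \<ominus>\<^bsub>S\<^esub> S.gact g (\<pi> (h x))"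
      using m by (intro abelian_group_hom.hom_minus[OF S.rep.act_hom[OF gen(1)]]) auto
    then show ?thesis
      using 3 m pi_gact by (simp add: ext_act d_ghost pi.hom_minus S.M.minus_eq)
  qed
  then show ?case by (simp add: X.gact_def S.gact_def)
next
  case (add U V)
  then have c: "fst (U \<odot>\<^bsub>ext\<^esub> m) \<in> carrier L" "fst (V \<odot>\<^bsub>ext\<^esub> m) \<in> carrier L"
    "fst m \<in> carrier L" "snd m \<in> carrier S"
    using X.smult_closed[of U m] X.smult_closed[of V m] by auto
  have "fst ((U \<oplus>\<^bsub>LPA E\<^esub> V) \<odot>\<^bsub>ext\<^esub> m) = fst (U \<odot>\<^bsub>ext\<^esub> m) \<oplus>\<^bsub>L\<^esub> fst (V \<odot>\<^bsub>ext\<^esub> m)"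
    using add X.smult_l_distr[of U V m]
    by (cases "U \<odot>\<^bsub>ext\<^esub> m"; cases "V \<odot>\<^bsub>ext\<^esub> m") simp
  then show ?case
    using add c by (simp add: S.smult_l_distr d_add S.smult_closed d_closed S.M.a_ac)
next
  case (mult U V)
  have snd: "snd (V \<odot>\<^bsub>ext\<^esub> m) = V \<odot>\<^bsub>S\<^esub> snd m" using lmod_homD(4)[OF snd_hom] mult by auto
  have c: "fst m \<in> carrier L" "snd m \<in> carrier S" "V \<odot>\<^bsub>ext\<^esub> m \<in> carrier ext"
    using mult X.smult_closed[of V m] by auto
  then show ?case
    using mult by (simp add: X.smult_assoc S.smult_assoc d_mult snd S.smult_closed d_closed
        S.smult_r_distr S.M.a_assoc del: ext_simps(1))
qed

end

context twisted_top
begin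

text \<open>\<open>S\<close> inherits simplicity from the shape of \<open>L\<close>: the preimage of
  \<open>W\<close> under \<pi> is either contained in the kernel or all of \<open>L\<close>, and
  \<pi> is onto.\<close>

lemma submodule_S_trivial:
  assumes "submodule W (LPA E) S"
  shows "W = {\<zero>\<^bsub>S\<^esub>} \<or> W = carrier S"
proof -
  have W: "W \<subseteq> carrier S" "\<zero>\<^bsub>S\<^esub> \<in> W" using submoduleD[OF assms] by auto
  let ?N = "{l \<in> carrier L. \<pi> l \<in> W}"
  have "?N \<subseteq> a_kernel L S \<pi> \<or> ?N = carrier L"
    by (rule L_top[OF submodule_vimage[OF pi_hom L.left_module_axioms S.left_module_axioms assms]])
  then show ?thesis
  proof
    assume *: "?N \<subseteq> a_kernel L S \<pi>"
    have "x = \<zero>\<^bsub>S\<^esub>" if x: "x \<in> W" for x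
    proof -
      have "x \<in> \<pi> ` carrier L" using x W pi_surj by auto
      then obtain l where "l \<in> carrier L" "x = \<pi> l" by blast
      with x have "l \<in> ?N" by simp
      with * have "l \<in> a_kernel L S \<pi>" by (rule subsetD)
      then have "\<pi> l = \<zero>\<^bsub>S\<^esub>" unfolding a_kernel_eq by blast
      with \<open>x = \<pi> l\<close> show ?thesis by (rule trans)
    qed
    with W have "W = {\<zero>\<^bsub>S\<^esub>}" by blast
    then show ?thesis ..
  next
    assume "?N = carrier L"
    then have "\<pi> ` carrier L \<subseteq> W" by blast
    with W pi_surj show ?thesis by auto
  qed
qed

lemma minus_ext:
  assumes "a \<in> carrier L" "b \<in> carrier L" "x \<in> carrier S"
  shows "(a, x) \<ominus>\<^bsub>ext\<^esub> (b, x) = (a \<ominus>\<^bsub>L\<^esub> b, \<zero>\<^bsub>S\<^esub>)"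
proof -
  have "\<ominus>\<^bsub>ext\<^esub> (b, x) = (\<ominus>\<^bsub>L\<^esub> b, \<ominus>\<^bsub>S\<^esub> x)"
    by (rule X.M.minus_equality) (use assms in \<open>auto simp: L.M.l_neg S.M.l_neg\<close>)
  then show ?thesis using assms by (simp add: X.M.minus_eq L.M.minus_eq S.M.r_neg)
qed

text \<open>
  If a submodule \<open>N\<close> projects onto \<open>S\<close> but meets \<open>L\<close> inside the kernel of \<open>\<pi>\<close>, then the first
  components of its elements, taken modulo that kernel, define a splitting of the derivation.
\<close>

lemma ext_top:
  assumes N: "submodule N (LPA E) ext"
  shows "N \<subseteq> a_kernel ext S snd \<or> N = carrier ext"
proof (rule ccontr)
  assume "\<not> ?thesis"
  then have no: "\<not> N \<subseteq> a_kernel ext S snd" "N \<noteq> carrier ext" by auto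
  have sub: "N \<subseteq> carrier L \<times> carrier S" using submoduleD(1)[OF N] by simp
  have "snd ` N = {\<zero>\<^bsub>S\<^esub>} \<or> snd ` N = carrier S"
    by (rule submodule_S_trivial[OF submodule_image[OF snd_hom X.left_module_axioms S.left_module_axioms N]])
  moreover have "snd ` N \<noteq> {\<zero>\<^bsub>S\<^esub>}"
  proof
    assume "snd ` N = {\<zero>\<^bsub>S\<^esub>}"
    then have "N \<subseteq> a_kernel ext S snd" using sub by (auto simp: a_kernel_eq)
    with no(1) show False ..
  qed
  ultimately have surj: "snd ` N = carrier S" by blast
  have ex: "\<exists>l. (l, x) \<in> N" if "x \<in> carrier S" for x
  proof -
    have "x \<in> snd ` N" using that surj by simp
    then show ?thesis by force
  qed
  let ?N0 = "{l \<in> carrier L. (l, \<zero>\<^bsub>S\<^esub>) \<in> N}"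
  \<comment> \<open>Two elements of \<open>N\<close> over the same \<open>x\<close> differ by an
    element of \<open>N\<close> inside \<open>L\<close>. This controls both cases below.\<close>
  have diff: "a \<ominus>\<^bsub>L\<^esub> b \<in> ?N0" if "(a, x) \<in> N" "(b, x) \<in> N" for a b x
  proof -
    have "a \<in> carrier L" "b \<in> carrier L" "x \<in> carrier S" using that sub by auto
    then show ?thesis using submodule_diff[OF N that] minus_ext[of a b x] by simp
  qed
  have "?N0 \<subseteq> a_kernel L S \<pi> \<or> ?N0 = carrier L"
    by (rule L_top[OF submodule_vimage[OF inl_hom L.left_module_axioms X.left_module_axioms N]])
  then show False
  proof
    assume N0: "?N0 = carrier L"
    have "(l, x) \<in> N" if l: "l \<in> carrier L" and x: "x \<in> carrier S" for l x
    proof -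
      obtain l' where l': "(l', x) \<in> N" "l' \<in> carrier L" using ex[OF x] sub by auto
      have "l \<ominus>\<^bsub>L\<^esub> l' \<in> ?N0" unfolding N0 using l l' by simp
      then have "(l \<ominus>\<^bsub>L\<^esub> l', \<zero>\<^bsub>S\<^esub>) \<oplus>\<^bsub>ext\<^esub> (l', x) \<in> N" using l' submoduleD(3)[OF N] by blast
      moreover have "l \<ominus>\<^bsub>L\<^esub> l' \<oplus>\<^bsub>L\<^esub> l' = l"
        using l l' by (simp add: L.M.minus_eq L.M.a_assoc L.M.l_neg)
      ultimately show ?thesis using x by simp
    qed
    then have "N = carrier ext" using sub by auto
    with no(2) show False ..
  next
    assume N0: "?N0 \<subseteq> a_kernel L S \<pi>"
    \<comment> \<open>The choice of \<open>l\<close> is immaterial after applying \<pi>: by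
      \<open>diff\<close>, any two candidates differ by an element of \<open>?N0\<close>, which now
      lies in the kernel.\<close>
    define \<nu> where "\<nu> x = \<pi> (SOME l. (l, x) \<in> N)" for x
    have \<nu>: "\<nu> x = \<pi> l" if "(l, x) \<in> N" for l x
    proof -
      let ?l = "SOME l. (l, x) \<in> N"
      have l': "(?l, x) \<in> N" by (rule someI[of "\<lambda>l. (l, x) \<in> N", OF that])
      have c: "?l \<in> carrier L" "l \<in> carrier L" using l' that sub by auto
      have "\<pi> (?l \<ominus>\<^bsub>L\<^esub> l) = \<zero>\<^bsub>S\<^esub>" using diff[OF l' that] N0 unfolding a_kernel_eq by blast
      then have "\<pi> ?l \<ominus>\<^bsub>S\<^esub> \<pi> l = \<zero>\<^bsub>S\<^esub>" using c pi.hom_minus by simp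
      moreover have "\<pi> ?l = (\<pi> ?l \<ominus>\<^bsub>S\<^esub> \<pi> l) \<oplus>\<^bsub>S\<^esub> \<pi> l"
        using c by (simp add: S.M.minus_eq S.M.a_assoc S.M.l_neg)
      ultimately show ?thesis unfolding \<nu>_def using c by simp
    qed
    have \<nu>_closed: "\<nu> x \<in> carrier S" if "x \<in> carrier S" for x
    proof -
      from ex[OF that] obtain l where "(l, x) \<in> N" ..
      then show ?thesis using \<nu> sub by auto
    qed
    have \<nu>_add: "\<nu> (x \<oplus>\<^bsub>S\<^esub> y) = \<nu> x \<oplus>\<^bsub>S\<^esub> \<nu> y" if x: "x \<in> carrier S" and y: "y \<in> carrier S" for x y
    proof -
      obtain l l' where l: "(l, x) \<in> N" "(l', y) \<in> N" using ex x y by blast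
      then have "l \<in> carrier L" "l' \<in> carrier L" using sub by auto
      then show ?thesis using \<nu>[OF l(1)] \<nu>[OF l(2)] submoduleD(3)[OF N l] \<nu>[of "l \<oplus>\<^bsub>L\<^esub> l'"] by simp
    qed
    have \<nu>_smult: "\<nu> (a \<odot>\<^bsub>S\<^esub> x) = a \<odot>\<^bsub>S\<^esub> \<nu> x \<oplus>\<^bsub>S\<^esub> d a x" if a: "a \<in> carrier (LPA E)" and x: "x \<in> carrier S" for a x
    proof -
      obtain l where l: "(l, x) \<in> N" using ex[OF x] by blast
      then have lx: "(l, x) \<in> carrier ext" using sub by auto
      have "snd (a \<odot>\<^bsub>ext\<^esub> (l, x)) = a \<odot>\<^bsub>S\<^esub> x" using lmod_homD(4)[OF snd_hom a lx] by simp
      then have "(fst (a \<odot>\<^bsub>ext\<^esub> (l, x)), a \<odot>\<^bsub>S\<^esub> x) \<in> N"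
        using submoduleD(5)[OF N a l] by (metis prod.collapse)
      then show ?thesis using \<nu> l pi_fst_smult[OF a lx] by simp
    qed
    \<comment> \<open>The sign is reversed because \<open>\<nu>_smult\<close> has the derivation on
      the side of \<open>a \<odot> \<nu> x\<close>, whereas \<open>not_cob\<close> has it on the
      other side.\<close>
    have "abelian_group_hom S S (\<lambda>x. \<ominus>\<^bsub>S\<^esub> \<nu> x)"
      by (intro abelian_group_homI' S.M.abelian_group_axioms)
        (auto simp: \<nu>_closed \<nu>_add S.M.minus_add)
    moreover have "d a x \<oplus>\<^bsub>S\<^esub> \<ominus>\<^bsub>S\<^esub> \<nu> (a \<odot>\<^bsub>S\<^esub> x) = a \<odot>\<^bsub>S\<^esub> (\<ominus>\<^bsub>S\<^esub> \<nu> x)"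
      if "a \<in> carrier (LPA E)" "x \<in> carrier S" for a x
      using that S.M.a_lcomm[of "d a x" "\<ominus>\<^bsub>S\<^esub> (a \<odot>\<^bsub>S\<^esub> \<nu> x)" "\<ominus>\<^bsub>S\<^esub> d a x"]
      by (simp add: \<nu>_smult \<nu>_closed S.smult_closed d_closed S.M.minus_add
          abelian_group_hom.hom_a_inv[OF S.smult_hom] S.M.r_neg)
    ultimately show False using not_cob by blast
  qed
qed

text \<open>By \<open>ext_top\<close>, proper submodules lie in the copy of \<open>L\<close>, where
  the chain condition of \<open>L\<close> compares them. The conclusion has the form of the
  assumption on \<open>L\<close>, with \<open>snd\<close> in place of \<pi>, so the construction can
  be repeated.\<close>

lemma uniserial_top_ext: "uniserial_top (LPA E) ext S snd"
  unfolding uniserial_top_def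
proof (intro conjI allI impI)
  show "snd ` carrier ext = carrier S" using L.M.zero_closed by force
  show "uniserial (LPA E) ext"
    unfolding uniserial_def
  proof (intro conjI allI impI X.left_module_axioms)
    fix N N' assume N: "submodule N (LPA E) ext" and N': "submodule N' (LPA E) ext"
    let ?N = "\<lambda>N. {l \<in> carrier L. (l, \<zero>\<^bsub>S\<^esub>) \<in> N}"
    have sub: "N \<subseteq> carrier L \<times> carrier S" "N' \<subseteq> carrier L \<times> carrier S"
      using submoduleD(1)[OF N] submoduleD(1)[OF N'] by auto
    have chain: "?N N \<subseteq> ?N N' \<or> ?N N' \<subseteq> ?N N"
      by (intro L_chain submodule_vimage[OF inl_hom L.left_module_axioms X.left_module_axioms] N N')
    have "N = carrier ext \<or> N' = carrier ext \<or> N \<subseteq> a_kernel ext S snd \<and> N' \<subseteq> a_kernel ext S snd"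
      using ext_top[OF N] ext_top[OF N'] by blast
    then show "N \<subseteq> N' \<or> N' \<subseteq> N"
    proof (elim disjE conjE)
      assume k: "N \<subseteq> a_kernel ext S snd" "N' \<subseteq> a_kernel ext S snd"
      have "U \<subseteq> U'" if "U \<subseteq> a_kernel ext S snd" "?N U \<subseteq> ?N U'" for U U'
      proof
        fix m assume m: "m \<in> U"
        then have "m \<in> carrier ext" "snd m = \<zero>\<^bsub>S\<^esub>" using that(1) by (auto simp: a_kernel_eq)
        then obtain l where "m = (l, \<zero>\<^bsub>S\<^esub>)" "l \<in> carrier L" by (cases m) auto
        with m that(2) show "m \<in> U'" by auto
      qed
      with chain k show ?thesis by blast
    qed (use sub in auto)
  qed
qed (use snd_hom ext_top in auto)

end

section \<open>Bases of Chen modules\<close>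

text \<open>\<open>S\<close> is only isomorphic to a path module and may have any carrier type; the
  basis of paths is carried over to it along \<phi>.\<close>

locale path_basis = lpa_module E S
  for E :: "('v, 'e) pre_digraph" and S :: "(('v, 'e, 'k::field) lpa_elem, 's) module" +
  fixes p :: "nat \<Rightarrow> 'e" and \<phi> :: "'s \<Rightarrow> (nat \<Rightarrow> 'e) \<Rightarrow>\<^sub>0 'k"
  assumes \<phi>: "\<phi> \<in> lmod_hom (LPA E) S (path_module E p)"
    and bij: "bij_betw \<phi> (carrier S) (carrier (path_module E p :: (('v, 'e, 'k) lpa_elem, _) module))"
begin

abbreviation "T \<equiv> tail_class E p"

abbreviation (input) "P \<equiv> path_module E p :: (('v, 'e, 'k) lpa_elem, _) module"

sublocale P: lpa_module E P
  by (rule lpa_module_path_module)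

definition \<psi> :: "((nat \<Rightarrow> 'e) \<Rightarrow>\<^sub>0 'k) \<Rightarrow> 's" where
  "\<psi> = inv_into (carrier S) \<phi>"

definition base :: "(nat \<Rightarrow> 'e) \<Rightarrow> 's" where
  "base q = \<psi> (Poly_Mapping.single q 1)"

lemma \<psi>: "\<psi> \<in> lmod_hom (LPA E) P S"
  unfolding \<psi>_def by (rule lmod_hom_inv[OF \<phi> bij left_module_axioms])

lemma \<phi>_\<psi>: "y \<in> carrier P \<Longrightarrow> \<phi> (\<psi> y) = y"
  unfolding \<psi>_def using bij by (simp add: bij_betw_def f_inv_into_f del: path_module_simps(1))

lemma \<psi>_\<phi>: "x \<in> carrier S \<Longrightarrow> \<psi> (\<phi> x) = x"
  unfolding \<psi>_def using bij by (simp add: bij_betw_def)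

sublocale \<phi>: abelian_group_hom S P \<phi>
  by (rule lmod_hom_abelian_group_hom[OF \<phi> left_module_axioms P.left_module_axioms])

sublocale \<psi>: abelian_group_hom P S \<psi>
  by (rule lmod_hom_abelian_group_hom[OF \<psi> P.left_module_axioms left_module_axioms])

lemma single_P: "q \<in> T \<Longrightarrow> Poly_Mapping.single q c \<in> carrier P"
  by simp

lemma base_closed: "q \<in> T \<Longrightarrow> base q \<in> carrier S"
  unfolding base_def by (rule \<psi>.hom_closed[OF single_P])

lemma \<phi>_scal: "x \<in> carrier S \<Longrightarrow> \<phi> (scal c x) = Poly_Mapping.map ((*) c) (\<phi> x)"
  using lmod_homD(4)[OF \<phi> lpa_class_closed[OF single0_FA[of c]], of x]
    path_module_gact(1)[OF \<phi>.hom_closed, of x c]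
  by (simp add: scal_def P.scal_def)

lemma \<phi>_gact: "\<lbrakk>g \<in> lpa_gens E; x \<in> carrier S\<rbrakk> \<Longrightarrow> \<phi> (gact g x) = gen_act E g (\<phi> x)"
  using lmod_homD(4)[OF \<phi> lpa_class_closed[OF free_algebra_gen], of g x]
    path_module_gact(2)[OF \<phi>.hom_closed, of x g]
  by (simp add: gact_def P.gact_def)

lemma \<psi>_single: "q \<in> T \<Longrightarrow> \<psi> (Poly_Mapping.single q c) = scal c (base q)"
  using \<phi>_scal[OF base_closed[of q], of c] \<psi>_\<phi>[OF rep.sc_closed[OF base_closed[of q]], of c]
  by (simp add: base_def \<phi>_\<psi>[OF single_P])

lemma gact_base:
  assumes "g \<in> lpa_gens E" "q \<in> T"
  shows "gact g (base q) = \<psi> (path_act E g q 1)"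
  using \<phi>_gact[OF assms(1) base_closed[OF assms(2)]] \<psi>_\<phi>[OF rep.act_closed[OF assms(1) base_closed[OF assms(2)]]]
  by (simp add: base_def \<phi>_\<psi>[OF single_P[OF assms(2)]])

lemma gact_base_simps:
  assumes "q \<in> T"
  shows "v \<in> verts E \<Longrightarrow> gact (Vertex v) (base q) = (if v = tail E (q 0) then base q else \<zero>\<^bsub>S\<^esub>)"
    "e \<in> arcs E \<Longrightarrow> gact (Edge e) (base q) = (if head E e = tail E (q 0) then base (case_nat e q) else \<zero>\<^bsub>S\<^esub>)"
    "e \<in> arcs E \<Longrightarrow> gact (Ghost e) (base q) = (if e = q 0 then base (path_tail 1 q) else \<zero>\<^bsub>S\<^esub>)"
  using \<psi>.hom_zero by (simp_all add: gact_base assms) (simp_all add: base_def)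

text \<open>Here \<open>A\<close> and \<open>B\<close> are merely K-linear. This is the form needed
  for the section, for \<open>h\<close> and for the derivation, none of which has to be a module
  homomorphism.\<close>

lemma basis_ext:
  fixes W :: "(('v, 'e, 'k) lpa_elem, 'w) module"
  assumes W: "lpa_module E W" and A: "abelian_group_hom S W A" and B: "abelian_group_hom S W B"
    and "\<And>c x. x \<in> carrier S \<Longrightarrow> A (scal c x) = lpa_module.scal E W c (A x)"
    and "\<And>c x. x \<in> carrier S \<Longrightarrow> B (scal c x) = lpa_module.scal E W c (B x)"
    and "\<And>q. q \<in> T \<Longrightarrow> A (base q) = B (base q)" and x: "x \<in> carrier S"
  shows "A x = B x"
proof -
  interpret A: abelian_group_hom S W A by fact
  interpret B: abelian_group_hom S W B by fact
  have "A (\<psi> y) = B (\<psi> y)" if "Poly_Mapping.keys y \<subseteq> T" for y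
    using that
  proof (induction y rule: poly_mapping_single_induct)
    case zero
    then show ?case using \<psi>.hom_zero by simp
  next
    case (add q c f)
    have f: "\<psi> f \<in> carrier S" using add \<psi>.hom_closed[of f] by simp
    have b: "base q \<in> carrier S" "scal c (base q) \<in> carrier S"
      using add by (simp_all add: base_closed rep.sc_closed)
    have "\<psi> (Poly_Mapping.single q c + f) = scal c (base q) \<oplus>\<^bsub>S\<^esub> \<psi> f"
      using \<psi>.hom_add[OF single_P[OF add(1)], of f c] add by (simp add: \<psi>_single)
    then show ?case
      using add.IH f b assms(4)[OF b(1)] assms(5)[OF b(1)] assms(6)[OF add(1)] by simp
  qed
  then show ?thesis using \<phi>.hom_closed[OF x] \<psi>_\<phi>[OF x] by (metis path_module_simps(1))
qed

text \<open>A basis path is fixed by its source vertex and killed by the other vertices, so a linear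
  map commutes with all vertices as soon as each value \<open>z q\<close> is fixed by the source
  vertex of \<open>q\<close>.\<close>

lemma linear_extension:
  fixes W :: "(('v, 'e, 'k) lpa_elem, 'w) module"
  assumes W: "lpa_module E W" and z: "\<And>q. q \<in> T \<Longrightarrow> z q \<in> carrier W"
    "\<And>q. q \<in> T \<Longrightarrow> lpa_module.gact E W (Vertex (tail E (q 0))) (z q) = z q"
  obtains h where "abelian_group_hom S W h"
    "\<And>c x. x \<in> carrier S \<Longrightarrow> h (scal c x) = lpa_module.scal E W c (h x)"
    "\<And>v x. \<lbrakk>v \<in> verts E; x \<in> carrier S\<rbrakk> \<Longrightarrow> h (gact (Vertex v) x) = lpa_module.gact E W (Vertex v) (h x)"
    "\<And>q. q \<in> T \<Longrightarrow> h (base q) = z q"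
proof
  interpret W: lpa_module E W by fact
  define h where "h x = W.rep.lincomb z (\<phi> x)" for x
  have keys: "z \<in> Poly_Mapping.keys (\<phi> x) \<rightarrow> carrier W" if "x \<in> carrier S" for x
    using \<phi>.hom_closed[OF that] z(1) by auto
  show hom: "abelian_group_hom S W h"
  proof (intro abelian_group_homI' M.abelian_group_axioms W.M.abelian_group_axioms)
    show "h \<in> carrier S \<rightarrow> carrier W"
      using W.rep.lincomb_closed[OF keys] by (auto simp: h_def)
    show "h (x \<oplus>\<^bsub>S\<^esub> y) = h x \<oplus>\<^bsub>W\<^esub> h y" if "x \<in> carrier S" "y \<in> carrier S" for x y
      using W.rep.lincomb_add[OF keys keys, OF that] \<phi>.hom_add[OF that] by (simp add: h_def)
  qed
  then interpret h: abelian_group_hom S W h .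
  show scal: "h (scal c x) = W.scal c (h x)" if "x \<in> carrier S" for c x
    using W.rep.lincomb_scale[OF keys[OF that], of c] by (simp add: h_def \<phi>_scal[OF that])
  show base: "h (base q) = z q" if "q \<in> T" for q
    using W.rep.lincomb_single[of z q 1] z(1)[OF that]
    by (simp add: h_def base_def \<phi>_\<psi>[OF single_P[OF that]] W.rep.sc_one)
  fix v x assume v: "v \<in> verts E" and x: "x \<in> carrier S"
  have g: "Vertex v \<in> lpa_gens E" using v by simp
  show "h (gact (Vertex v) x) = W.gact (Vertex v) (h x)"
  proof (rule basis_ext[OF W _ _ _ _ _ x])
    show "abelian_group_hom S W (\<lambda>x. h (gact (Vertex v) x))"
      by (intro abelian_group_homI' M.abelian_group_axioms W.M.abelian_group_axioms)
        (auto simp: rep.act_closed rep.act_add v)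
    show "abelian_group_hom S W (\<lambda>x. W.gact (Vertex v) (h x))"
      by (intro abelian_group_homI' M.abelian_group_axioms W.M.abelian_group_axioms)
        (auto simp: W.rep.act_closed W.rep.act_add v)
    show "h (gact (Vertex v) (base q)) = W.gact (Vertex v) (h (base q))" if q: "q \<in> T" for q
    proof -
      have "tail E (q 0) \<in> verts E" using tail_classD[OF q] by simp
      \<comment> \<open>A value fixed by one vertex is killed by all others, by orthogonality of the
        vertices.\<close>
      then have "W.gact (Vertex v) (z q) = (if v = tail E (q 0) then z q else \<zero>\<^bsub>W\<^esub>)"
        using W.rep.V[OF v _ z(1)[OF q], of "tail E (q 0)"] z(2)[OF q] by (auto split: if_splits)
      then show ?thesis by (simp add: gact_base_simps[OF q] v base[OF q])
    qed
  qed (use g in \<open>auto simp: rep.act_closed scal rep.act_sc W.rep.act_sc\<close>)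
qed

end

text \<open>The class of \<open>f\<close> is turned into a derivation \<open>d\<close> through a
  linear section, and \<open>h\<close> is read off from \<open>d\<close> by splitting each path into
  its first edge and the rest. A preimage under \<pi> for each basis value then replaces a map into
  \<open>S\<close> by a map into \<open>L\<close>.\<close>

lemma (in path_basis) twisted_top_exists:
  fixes L :: "(('v, 'e, 'k) lpa_elem, 'l) module"
  assumes f: "f \<in> lmod_hom (LPA E) (syzygy (LPA E) S) S" and no_ext: "\<not> covered_module.extends (LPA E) S f"
    and L: "left_module (LPA E) L" and top: "uniserial_top (LPA E) L S \<pi>"
  obtains h d where "twisted_top E L S h \<pi> d"
proof -
  interpret L: lpa_module E L by (intro lpa_module.intro L fin_digraph_axioms)
  interpret S: covered_module "LPA E" S by (rule covered_module.intro[OF left_module_axioms])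
  interpret F: lpa_module E S.F by (intro lpa_module.intro S.left_module_F fin_digraph_axioms)
  note lm = left_module_axioms
  interpret Om: left_module "LPA E" "syzygy (LPA E) S" by (rule S.left_module_syzygy)
  interpret cover: abelian_group_hom S.F S S.cover
    by (rule lmod_hom_abelian_group_hom[OF S.cover_hom S.left_module_F lm])
  have \<pi>: "\<pi> \<in> lmod_hom (LPA E) L S" "\<pi> ` carrier L = carrier S"
    using top by (auto simp: uniserial_top_def)
  interpret \<pi>: abelian_group_hom L S \<pi> by (rule lmod_hom_abelian_group_hom[OF \<pi>(1) L lm])
  note f' = lmod_homD[OF f, unfolded S.syzygy_simps S.carrier_syzygy]
  have f_zero: "f \<zero>\<^bsub>S.F\<^esub> = \<zero>\<^bsub>S\<^esub>"
    using abelian_group_hom.hom_zero[OF lmod_hom_abelian_group_hom[OF f S.left_module_syzygy lm]]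
    by (simp add: S.syzygy_simps)
  have cls: "lpa_class E (gen g) \<in> carrier (LPA E :: ('v, 'e, 'k) lpa_elem ring)" if "g \<in> lpa_gens E" for g
    using that by (simp add: lpa_class_closed free_algebra_gen)
  have cls0: "lpa_class E (Poly_Mapping.single 0 c) \<in> carrier (LPA E :: ('v, 'e, 'k) lpa_elem ring)" for c
    by (simp add: lpa_class_closed single0_FA)
  have tail: "Vertex (tail E (q 0)) \<in> lpa_gens E" "q 0 \<in> arcs E" "tail E (q 0) \<in> verts E" if "q \<in> T" for q
    using tail_classD[OF that] by auto
  define pt where "pt q = S.point (base q) \<one>\<^bsub>LPA E\<^esub>" for q
  have pt: "pt q \<in> carrier S.F" "S.cover (pt q) = base q" if "q \<in> T" for q
    using S.point[OF base_closed[OF that] R.one_closed] smult_one[OF base_closed[OF that]]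
    by (simp_all add: pt_def)
  \<comment> \<open>The free generator over \<open>base q\<close> need not be fixed by the source
    vertex of \<open>q\<close>; multiplying it by that vertex enforces this and still gives a
    preimage of \<open>base q\<close>.\<close>
  obtain \<sigma> where \<sigma>: "abelian_group_hom S S.F \<sigma>"
      "\<And>c x. x \<in> carrier S \<Longrightarrow> \<sigma> (scal c x) = F.scal c (\<sigma> x)"
      "\<And>v x. \<lbrakk>v \<in> verts E; x \<in> carrier S\<rbrakk> \<Longrightarrow> \<sigma> (gact (Vertex v) x) = F.gact (Vertex v) (\<sigma> x)"
      "\<And>q. q \<in> T \<Longrightarrow> \<sigma> (base q) = F.gact (Vertex (tail E (q 0))) (pt q)"
  proof (rule linear_extension[OF F.lpa_module_axioms])
    fix q assume q: "q \<in> T"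
    show "F.gact (Vertex (tail E (q 0))) (pt q) \<in> carrier S.F"
      by (rule F.rep.act_closed[OF tail(1)[OF q] pt(1)[OF q]])
    show "F.gact (Vertex (tail E (q 0))) (F.gact (Vertex (tail E (q 0))) (pt q)) =
      F.gact (Vertex (tail E (q 0))) (pt q)"
      using F.rep.V[OF tail(3)[OF q] tail(3)[OF q] pt(1)[OF q]] by simp
  qed (rule that)
  interpret \<sigma>: abelian_group_hom S S.F \<sigma> by fact
  have cover_gact: "S.cover (F.gact g u) = gact g (S.cover u)" if "g \<in> lpa_gens E" "u \<in> carrier S.F" for g u
    using lmod_homD(4)[OF S.cover_hom cls[OF that(1)] that(2)] by (simp add: F.gact_def gact_def)
  have cover_scal: "S.cover (F.scal c u) = scal c (S.cover u)" if "u \<in> carrier S.F" for c u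
    using lmod_homD(4)[OF S.cover_hom cls0 that] by (simp add: F.scal_def scal_def)
  have cover_\<sigma>: "S.cover (\<sigma> x) = x" if "x \<in> carrier S" for x
  proof (rule basis_ext[OF lpa_module_axioms _ _ _ _ _ that])
    show "abelian_group_hom S S (\<lambda>x. S.cover (\<sigma> x))" "abelian_group_hom S S (\<lambda>x. x)"
      by (intro abelian_group_homI' M.abelian_group_axioms; simp)+
    show "S.cover (\<sigma> (base q)) = base q" if "q \<in> T" for q
      using cover_gact[OF tail(1)[OF that] pt(1)[OF that]] tail[OF that]
      by (simp add: \<sigma>(4)[OF that] pt[OF that] gact_base_simps[OF that])
  qed (simp_all add: \<sigma>(2) cover_scal)
  \<comment> \<open>The defect of linearity of the section. The cover kills it, so it lies in the
    syzygy, where \<open>f\<close> is defined.\<close>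
  define k where "k a x = a \<odot>\<^bsub>S.F\<^esub> \<sigma> x \<ominus>\<^bsub>S.F\<^esub> \<sigma> (a \<odot>\<^bsub>S\<^esub> x)" for a x
  have k: "k a x \<in> carrier S.F" "S.cover (k a x) = \<zero>\<^bsub>S\<^esub>" if "a \<in> carrier (LPA E)" "x \<in> carrier S" for a x
    using that lmod_homD(4)[OF S.cover_hom that(1), of "\<sigma> x"]
    by (simp_all add: k_def F.smult_closed smult_closed cover.hom_minus cover_\<sigma> M.minus_eq M.r_neg)
  define d where "d a x = f (k a x)" for a x
  have k_gen: "k (lpa_class E (gen g)) x = F.gact g (\<sigma> x) \<ominus>\<^bsub>S.F\<^esub> \<sigma> (gact g x)" for g x
    by (simp add: k_def F.gact_def gact_def)
  have k_add: "k a (x \<oplus>\<^bsub>S\<^esub> y) = k a x \<oplus>\<^bsub>S.F\<^esub> k a y" if "a \<in> carrier (LPA E)" "x \<in> carrier S" "y \<in> carrier S" for a x y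
    using that by (simp add: k_def smult_r_distr F.smult_r_distr smult_closed F.smult_closed
        F.M.minus_eq F.M.minus_add F.M.a_ac)
  have d_closed: "d a x \<in> carrier S" if "a \<in> carrier (LPA E)" "x \<in> carrier S" for a x
    using k[OF that] f'(2) by (simp add: d_def)
  have d_hom: "abelian_group_hom S S (d a)" if "a \<in> carrier (LPA E)" for a
    by (intro abelian_group_homI' M.abelian_group_axioms)
      (use that k f'(3) d_closed[OF that] in \<open>auto simp: k_add d_def\<close>)
  have d_scal: "d (lpa_class E (gen g)) (scal c x) = scal c (d (lpa_class E (gen g)) x)"
    if g: "g \<in> lpa_gens E" and x: "x \<in> carrier S" for g c x
  proof -
    have "k (lpa_class E (gen g)) (scal c x) = F.scal c (k (lpa_class E (gen g)) x)"
      using abelian_group_hom.hom_minus[OF F.rep.sc_hom, of "F.gact g (\<sigma> x)" "\<sigma> (gact g x)" c] g x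
      by (simp add: k_gen \<sigma>(2) F.rep.act_sc rep.act_sc rep.act_closed F.rep.act_closed)
    then show ?thesis
      using k[OF cls[OF g] x] f'(4)[OF cls0] by (simp add: d_def F.scal_def scal_def)
  qed
  have edge: "Edge (q 0) \<in> lpa_gens E" if "q \<in> T" for q using tail(2)[OF that] by simp
  \<comment> \<open>The value that \<open>\<pi> (h (base q))\<close> must take: \<open>q\<close>
    arises in just one way by prepending an edge, so \<open>d_edge\<close> leaves no other
    choice.\<close>
  define w where "w q = d (lpa_class E (gen (Edge (q 0)))) (base (path_tail 1 q))" for q
  have T1: "path_tail 1 q \<in> T" if "q \<in> T" for q using path_tail_tail_class[OF that] .
  have edge_base: "gact (Edge (q 0)) (base (path_tail 1 q)) = base q" if "q \<in> T" for q
    using gact_base_simps(2)[OF T1[OF that] tail(2)[OF that]] tail_classD(2)[OF that, of 0] by simp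
  have w_eq: "w q = f (F.gact (Edge (q 0)) (\<sigma> (base (path_tail 1 q))) \<ominus>\<^bsub>S.F\<^esub> \<sigma> (base q))" if "q \<in> T" for q
    by (simp only: w_def d_def k_gen edge_base[OF that])
  have w_closed: "w q \<in> carrier S" if "q \<in> T" for q
    unfolding w_def using d_closed[OF cls base_closed[OF T1[OF that]], of "Edge (q 0)"] tail(2)[OF that] by simp
  have f_gact: "f (F.gact g u) = gact g (f u)" if "g \<in> lpa_gens E" "u \<in> carrier S.F" "S.cover u = \<zero>\<^bsub>S\<^esub>" for g u
    using f'(4)[OF cls[OF that(1)], of u] that by (simp add: F.gact_def gact_def)
  \<comment> \<open>Both terms of the difference in \<open>w_eq\<close> are fixed by the source
    vertex of \<open>q\<close>, the first by (E1) and the second because \<sigma> commutes with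
    vertices.\<close>
  have w_vertex: "gact (Vertex (tail E (q 0))) (w q) = w q" if q: "q \<in> T" for q
  proof -
    let ?v = "Vertex (tail E (q 0))" and ?y = "\<sigma> (base (path_tail 1 q))"
    let ?u = "F.gact (Edge (q 0)) ?y \<ominus>\<^bsub>S.F\<^esub> \<sigma> (base q)"
    have c: "?y \<in> carrier S.F" "\<sigma> (base q) \<in> carrier S.F"
      using base_closed[OF T1[OF q]] base_closed[OF q] by auto
    have ku: "k (lpa_class E (gen (Edge (q 0)))) (base (path_tail 1 q)) = ?u"
      by (simp only: k_gen edge_base[OF q])
    have u: "?u \<in> carrier S.F" "S.cover ?u = \<zero>\<^bsub>S\<^esub>"
      using k[OF cls[OF edge[OF q]] base_closed[OF T1[OF q]]] by (simp_all only: ku)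
    have "F.gact ?v ?u = F.gact ?v (F.gact (Edge (q 0)) ?y) \<ominus>\<^bsub>S.F\<^esub> F.gact ?v (\<sigma> (base q))"
      by (rule abelian_group_hom.hom_minus[OF F.rep.act_hom])
        (use tail[OF q] c in \<open>simp_all add: F.rep.act_closed\<close>)
    also have "\<dots> = ?u"
      using c tail[OF q] gact_base_simps(1)[OF q tail(3)[OF q]]
      by (simp add: F.rep.E1_tail base_closed[OF q] flip: \<sigma>(3))
    finally show ?thesis using f_gact[OF tail(1)[OF q] u] by (simp add: w_eq[OF q])
  qed
  have "\<exists>l. l \<in> carrier L \<and> \<pi> l = w q" if "q \<in> T" for q
    using w_closed[OF that] \<pi>(2) by (metis imageE)
  then obtain l where l: "\<And>q. q \<in> T \<Longrightarrow> l q \<in> carrier L \<and> \<pi> (l q) = w q" by metis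
  have \<pi>_gact: "\<pi> (L.gact g u) = gact g (\<pi> u)" if "g \<in> lpa_gens E" "u \<in> carrier L" for g u
    using lmod_homD(4)[OF \<pi>(1) cls[OF that(1)] that(2)] by (simp add: L.gact_def gact_def)
  have \<pi>_scal: "\<pi> (L.scal c u) = scal c (\<pi> u)" if "u \<in> carrier L" for c u
    using lmod_homD(4)[OF \<pi>(1) cls0 that] by (simp add: L.scal_def scal_def)
  \<comment> \<open>An arbitrary lift \<open>l q\<close> need not be fixed by the source vertex.
    Replacing it by its component there keeps the image under \<pi>, by
    \<open>w_vertex\<close>.\<close>
  obtain h where h: "abelian_group_hom S L h"
      "\<And>c x. x \<in> carrier S \<Longrightarrow> h (scal c x) = L.scal c (h x)"
      "\<And>v x. \<lbrakk>v \<in> verts E; x \<in> carrier S\<rbrakk> \<Longrightarrow> h (gact (Vertex v) x) = L.gact (Vertex v) (h x)"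
      "\<And>q. q \<in> T \<Longrightarrow> h (base q) = L.gact (Vertex (tail E (q 0))) (l q)"
  proof (rule linear_extension[OF L.lpa_module_axioms])
    fix q assume q: "q \<in> T"
    show "L.gact (Vertex (tail E (q 0))) (l q) \<in> carrier L"
      using L.rep.act_closed[OF tail(1)[OF q]] l[OF q] by blast
    show "L.gact (Vertex (tail E (q 0))) (L.gact (Vertex (tail E (q 0))) (l q)) =
      L.gact (Vertex (tail E (q 0))) (l q)"
      using L.rep.V[OF tail(3)[OF q] tail(3)[OF q]] l[OF q] by simp
  qed (rule that)
  interpret h: abelian_group_hom S L h by fact
  have \<pi>h: "\<pi> (h (base q)) = w q" if "q \<in> T" for q
    using \<pi>_gact[OF tail(1)[OF that]] l[OF that] w_vertex[OF that] by (simp add: h(4)[OF that])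
  have "twisted_top E L S h \<pi> d"
  proof (unfold_locales)
    fix a b :: "('v, 'e, 'k) lpa_elem" and x assume a: "a \<in> carrier (LPA E)" and b: "b \<in> carrier (LPA E)" and x: "x \<in> carrier S"
    have "k (a \<oplus>\<^bsub>LPA E\<^esub> b) x = k a x \<oplus>\<^bsub>S.F\<^esub> k b x"
      using a b x by (simp add: k_def smult_l_distr F.smult_l_distr smult_closed F.smult_closed
          F.M.minus_eq F.M.minus_add F.M.a_ac)
    then show "d (a \<oplus>\<^bsub>LPA E\<^esub> b) x = d a x \<oplus>\<^bsub>S\<^esub> d b x"
      using a b x k f'(3) by (simp add: d_def)
    \<comment> \<open>The cocycle identity: \<open>a \<odot> \<sigma> (b \<odot> x)\<close> is
      subtracted and added again. Applying \<open>f\<close> turns it into the derivation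
      rule.\<close>
    have "k (a \<otimes>\<^bsub>LPA E\<^esub> b) x = a \<odot>\<^bsub>S.F\<^esub> k b x \<oplus>\<^bsub>S.F\<^esub> k a (b \<odot>\<^bsub>S\<^esub> x)"
      using a b x by (simp add: k_def smult_assoc F.smult_assoc smult_closed F.smult_closed
          F.smult_minus F.M.minus_telescope)
    moreover have "S.cover (a \<odot>\<^bsub>S.F\<^esub> k b x) = \<zero>\<^bsub>S\<^esub>"
      using lmod_homD(4)[OF S.cover_hom a] k[OF b x] a by (simp add: smult_zero)
    ultimately show "d (a \<otimes>\<^bsub>LPA E\<^esub> b) x = a \<odot>\<^bsub>S\<^esub> d b x \<oplus>\<^bsub>S\<^esub> d a (b \<odot>\<^bsub>S\<^esub> x)"
      using a b x k k[OF a smult_closed[OF b x]] f'(3,4) by (simp add: d_def F.smult_closed)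
  next
    fix x and c :: 'k assume x: "x \<in> carrier S"
    have "k (lpa_class E (Poly_Mapping.single 0 c)) x = F.scal c (\<sigma> x) \<ominus>\<^bsub>S.F\<^esub> \<sigma> (scal c x)"
      by (simp add: k_def F.scal_def scal_def)
    then show "d (lpa_class E (Poly_Mapping.single 0 c)) x = \<zero>\<^bsub>S\<^esub>"
      using x f_zero by (simp add: d_def \<sigma>(2) F.M.minus_eq F.M.r_neg F.rep.sc_closed)
  next
    fix v x assume "v \<in> verts E" "x \<in> carrier S"
    then show "d (lpa_class E (gen (Vertex v))) x = \<zero>\<^bsub>S\<^esub>"
      using f_zero by (simp add: d_def k_gen \<sigma>(3) F.M.minus_eq F.M.r_neg F.rep.act_closed)
  next
    fix e x assume e: "e \<in> arcs E" and x: "x \<in> carrier S"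
    have g: "Edge e \<in> lpa_gens E" "Ghost e \<in> lpa_gens E" using e by auto
    show "d (lpa_class E (gen (Edge e))) x = \<pi> (h (gact (Edge e) x))"
    proof (rule basis_ext[OF lpa_module_axioms d_hom[OF cls[OF g(1)]] _ d_scal[OF g(1)] _ _ x])
      show "abelian_group_hom S S (\<lambda>x. \<pi> (h (gact (Edge e) x)))"
        by (intro abelian_group_homI' M.abelian_group_axioms) (auto simp: rep.act_closed rep.act_add e)
      show "\<pi> (h (gact (Edge e) (scal c x))) = scal c (\<pi> (h (gact (Edge e) x)))" if "x \<in> carrier S" for c x
        using that e by (simp add: rep.act_sc rep.act_closed h(2) \<pi>_scal)
      fix q assume q: "q \<in> T"
      show "d (lpa_class E (gen (Edge e))) (base q) = \<pi> (h (gact (Edge e) (base q)))"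
      proof (cases "head E e = tail E (q 0)")
        case True
        then have q': "case_nat e q \<in> T" using case_nat_tail_class[OF q e] by simp
        have "gact (Edge e) (base q) = base (case_nat e q)" using True gact_base_simps(2)[OF q e] by simp
        then show ?thesis using \<pi>h[OF q'] by (simp add: w_def)
      next
        \<comment> \<open>Here both sides vanish: \<open>base q\<close> is killed by
          \<open>e\<close>, and so is its lift, which lies in the component of a vertex different
          from the range of \<open>e\<close>.\<close>
        case False
        have \<sigma>q: "\<sigma> (base q) = F.gact (Vertex (tail E (q 0))) (pt q)" by (rule \<sigma>(4)[OF q])
        have "F.gact (Edge e) (\<sigma> (base q)) = F.gact (Edge e) (F.gact (Vertex (head E e)) (\<sigma> (base q)))"
          using F.rep.E1_head[OF e \<sigma>.hom_closed[OF base_closed[OF q]]] by simp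
        also have "F.gact (Vertex (head E e)) (\<sigma> (base q)) = \<zero>\<^bsub>S.F\<^esub>"
          unfolding \<sigma>q using F.rep.V[of "head E e" "tail E (q 0)" "pt q"] False e tail[OF q] pt[OF q] by simp
        also have "F.gact (Edge e) \<zero>\<^bsub>S.F\<^esub> = \<zero>\<^bsub>S.F\<^esub>"
          by (rule abelian_group_hom.hom_zero[OF F.rep.act_hom[OF g(1)]])
        finally show ?thesis
          using False gact_base_simps(2)[OF q e] f_zero
          by (simp add: d_def k_gen F.M.minus_zero_right)
      qed
    qed
    show "d (lpa_class E (gen (Ghost e))) x = \<ominus>\<^bsub>S\<^esub> gact (Ghost e) (\<pi> (h x))"
    proof (rule basis_ext[OF lpa_module_axioms d_hom[OF cls[OF g(2)]] _ d_scal[OF g(2)] _ _ x])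
      show "abelian_group_hom S S (\<lambda>x. \<ominus>\<^bsub>S\<^esub> gact (Ghost e) (\<pi> (h x)))"
        by (intro abelian_group_homI' M.abelian_group_axioms)
          (auto simp: rep.act_closed rep.act_add e M.minus_add)
      show "\<ominus>\<^bsub>S\<^esub> gact (Ghost e) (\<pi> (h (scal c x))) = scal c (\<ominus>\<^bsub>S\<^esub> gact (Ghost e) (\<pi> (h x)))"
        if "x \<in> carrier S" for c x
        using that e by (simp add: rep.act_sc rep.act_closed h(2) \<pi>_scal
            abelian_group_hom.hom_a_inv[OF rep.sc_hom])
      \<comment> \<open>Write \<open>q\<close> as its first edge followed by
        \<open>path_tail 1 q\<close>. Applying the ghost edge of \<open>e\<close> to the defect
        \<open>?u\<close> of that first edge, (CK1) turns the first term into the lift of the ghost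
        edge applied to \<open>q\<close>, and what remains is the negative of the defect
        \<open>?k\<close>.\<close>
      fix q assume q: "q \<in> T"
      let ?y = "\<sigma> (base (path_tail 1 q))"
      let ?u = "F.gact (Edge (q 0)) ?y \<ominus>\<^bsub>S.F\<^esub> \<sigma> (base q)"
      have c: "?y \<in> carrier S.F" "\<sigma> (base q) \<in> carrier S.F"
        using base_closed[OF T1[OF q]] base_closed[OF q] by auto
      have ku: "k (lpa_class E (gen (Edge (q 0)))) (base (path_tail 1 q)) = ?u"
        by (simp only: k_gen edge_base[OF q])
      have u: "?u \<in> carrier S.F" "S.cover ?u = \<zero>\<^bsub>S\<^esub>"
        using k[OF cls[OF edge[OF q]] base_closed[OF T1[OF q]]] by (simp_all only: ku)
      let ?k = "F.gact (Ghost e) (\<sigma> (base q)) \<ominus>\<^bsub>S.F\<^esub> \<sigma> (gact (Ghost e) (base q))"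
      have kk: "?k \<in> carrier S.F" "S.cover ?k = \<zero>\<^bsub>S\<^esub>"
        using k[OF cls[OF g(2)] base_closed[OF q]] by (simp_all add: k_gen)
      have "head E (q 0) = tail E (path_tail 1 q 0)" using tail_classD(2)[OF q, of 0] by simp
      then have "F.gact (Vertex (head E (q 0))) ?y = \<sigma> (gact (Vertex (head E (q 0))) (base (path_tail 1 q)))"
        and "gact (Vertex (head E (q 0))) (base (path_tail 1 q)) = base (path_tail 1 q)"
        using \<sigma>(3)[of "head E (q 0)" "base (path_tail 1 q)"] base_closed[OF T1[OF q]] tail(2)[OF q]
          gact_base_simps(1)[OF T1[OF q], of "head E (q 0)"] tail(3)[OF T1[OF q]] by simp_all
      then have "F.gact (Ghost e) (F.gact (Edge (q 0)) ?y) = \<sigma> (gact (Ghost e) (base q))"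
        using F.rep.CK1[OF e tail(2)[OF q] c(1)] gact_base_simps(3)[OF q e] by simp
      then have "F.gact (Ghost e) ?u = \<sigma> (gact (Ghost e) (base q)) \<ominus>\<^bsub>S.F\<^esub> F.gact (Ghost e) (\<sigma> (base q))"
        using abelian_group_hom.hom_minus[OF F.rep.act_hom[OF g(2)] F.rep.act_closed[OF _ c(1)] c(2), of "Edge (q 0)"]
          tail(2)[OF q] by simp
      also have "\<dots> = \<ominus>\<^bsub>S.F\<^esub> ?k"
        using c g rep.act_closed[OF g(2) base_closed[OF q]]
        by (simp add: F.M.minus_eq F.M.minus_add F.M.minus_minus F.rep.act_closed F.M.a_comm)
      finally have "gact (Ghost e) (w q) = f (\<ominus>\<^bsub>S.F\<^esub> ?k)"
        using f_gact[OF g(2) u] by (simp add: w_eq[OF q])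
      also have "\<dots> = \<ominus>\<^bsub>S\<^esub> f ?k"
      proof -
        have "f (\<ominus>\<^bsub>S.F\<^esub> ?k) \<oplus>\<^bsub>S\<^esub> f ?k = f (\<ominus>\<^bsub>S.F\<^esub> ?k \<oplus>\<^bsub>S.F\<^esub> ?k)"
          using f'(3)[of "\<ominus>\<^bsub>S.F\<^esub> ?k" ?k] kk cover.hom_a_inv[of ?k] M.minus_zero_right by simp
        also have "\<dots> = \<zero>\<^bsub>S\<^esub>" using kk f_zero by (simp add: F.M.l_neg)
        finally show ?thesis
          using f'(2)[of ?k] f'(2)[of "\<ominus>\<^bsub>S.F\<^esub> ?k"] kk cover.hom_a_inv[of ?k]
          by (intro M.minus_equality[symmetric]) simp_all
      qed
      finally show "d (lpa_class E (gen (Ghost e))) (base q) = \<ominus>\<^bsub>S\<^esub> gact (Ghost e) (\<pi> (h (base q)))"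
        using f'(2)[of ?k] kk \<pi>h[OF q] by (simp add: d_def k_gen M.minus_minus)
    qed
  next
    show "\<not> (\<exists>\<mu>. abelian_group_hom S S \<mu> \<and> (\<forall>a\<in>carrier (LPA E). \<forall>x\<in>carrier S.
        d a x \<oplus>\<^bsub>S\<^esub> \<mu> (a \<odot>\<^bsub>S\<^esub> x) = a \<odot>\<^bsub>S\<^esub> \<mu> x))"
    proof
      assume "\<exists>\<mu>. abelian_group_hom S S \<mu> \<and> (\<forall>a\<in>carrier (LPA E). \<forall>x\<in>carrier S.
        d a x \<oplus>\<^bsub>S\<^esub> \<mu> (a \<odot>\<^bsub>S\<^esub> x) = a \<odot>\<^bsub>S\<^esub> \<mu> x)"
      \<comment> \<open>A map that makes the derivation inner would yield an extension of
        \<open>f\<close> by \<open>extendsI\<close>, contrary to the choice of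
        \<open>f\<close>.\<close>
      then obtain \<mu> where "abelian_group_hom S S \<mu>" "\<And>a x. \<lbrakk>a \<in> carrier (LPA E); x \<in> carrier S\<rbrakk> \<Longrightarrow>
        d a x \<oplus>\<^bsub>S\<^esub> \<mu> (a \<odot>\<^bsub>S\<^esub> x) = a \<odot>\<^bsub>S\<^esub> \<mu> x" by blast
      then have "S.extends f"
        by (intro S.extendsI[OF f \<sigma>(1) cover_\<sigma>]) (auto simp: d_def k_def)
      with no_ext show False ..
    qed
  qed (use top d_closed h in auto)
  then show ?thesis by (rule that)
qed

text \<open>At a sink every homomorphism on the syzygy extends, so a nonzero class rules this case
  out and leaves an infinite path.\<close>

lemma chen_simple_path:
  fixes E :: "('v, 'e) pre_digraph" and S :: "(('v, 'e, 'k::field) lpa_elem, 's) module"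
  assumes E: "fin_digraph E" and S: "chen_simple E S"
    and ext: "carrier (Ext1 (LPA E) S S) \<noteq> {\<one>\<^bsub>Ext1 (LPA E) S S\<^esub>}"
  obtains f p where "left_module (LPA E) S" "f \<in> lmod_hom (LPA E) (syzygy (LPA E) S) S"
    "\<not> covered_module.extends (LPA E) S f"
    "infinite_path E p" "lmod_iso (LPA E) S (path_module E p)"
proof -
  interpret fin_digraph E by fact
  have lm: "left_module (LPA E) S" using S by (simp add: chen_simple_def)
  obtain f where f: "f \<in> lmod_hom (LPA E) (syzygy (LPA E) S) S" "\<not> covered_module.extends (LPA E) S f"
    using Ext1_nonzeroD[OF lm ext] by blast
  then have "\<not> (\<exists>w. sink E w \<and> lmod_iso (LPA E) S (principal_left_ideal (LPA E) (lpa_vertex E w)))"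
    using sink_extends[OF _ lm _ f(1)] by (auto simp: sink_def)
  then obtain p where "infinite_path E p" "lmod_iso (LPA E) S (path_module E p)"
    using S by (auto simp: chen_simple_def)
  with lm f show ?thesis by (rule that)
qed

text \<open>Besides \<open>is_extension\<close>, the embedding \<open>i\<close> is exhibited
  together with \<open>snd\<close>: adding a factor to a series requires exactness at the same
  surjection that occurs in \<open>uniserial_top\<close>.\<close>

lemma uniserial_extension:
  fixes E :: "('v, 'e) pre_digraph" and S :: "(('v, 'e, 'k::field) lpa_elem, 's) module"
    and L :: "(('v, 'e, 'k) lpa_elem, 'l) module"
  assumes E: "fin_digraph E" and S: "chen_simple E S"
    and ext: "carrier (Ext1 (LPA E) S S) \<noteq> {\<one>\<^bsub>Ext1 (LPA E) S S\<^esub>}"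
    and top: "uniserial_top (LPA E) L S \<pi>"
  obtains M :: "(('v, 'e, 'k) lpa_elem, 'l \<times> 's) module" and i
  where "uniserial_top (LPA E) M S snd" "is_extension (LPA E) M L S"
    "i \<in> lmod_hom (LPA E) L M" "inj_on i (carrier L)" "i ` carrier L = a_kernel M S snd"
proof -
  interpret fin_digraph E by fact
  have L: "left_module (LPA E) L" using top by (simp add: uniserial_top_def uniserial_def)
  obtain f p where lm: "left_module (LPA E) S"
    and f: "f \<in> lmod_hom (LPA E) (syzygy (LPA E) S) S" "\<not> covered_module.extends (LPA E) S f"
    and "lmod_iso (LPA E) S (path_module E p)"
    by (rule chen_simple_path[OF E S ext])
  then obtain \<phi> where "\<phi> \<in> lmod_hom (LPA E) S (path_module E p)"
    "bij_betw \<phi> (carrier S) (carrier (path_module E p :: (('v, 'e, 'k) lpa_elem, _) module))"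
    by (auto simp: lmod_iso_def)
  then interpret path_basis E S p \<phi>
    by (intro path_basis.intro lpa_module.intro E lm path_basis_axioms.intro)
  obtain h d where "twisted_top E L S h \<pi> d"
    by (rule twisted_top_exists[OF f L top])
  then interpret twisted_top E L S h \<pi> d .
  have "(\<lambda>l. (l, \<zero>\<^bsub>S\<^esub>)) ` carrier L = a_kernel ext S snd"
    by (auto simp: a_kernel_eq)
  then show ?thesis
    by (intro that[OF uniserial_top_ext is_extension_ext inl_hom]) (auto intro: inj_onI)
qed

text \<open>A submodule \<open>N\<close> not contained in the radical misses some maximal submodule
  \<open>P\<close>, that is, \<open>N\<close> is not below \<open>P\<close>. By the chain condition
  \<open>P\<close> is below \<open>N\<close>, and maximality leaves only
  \<open>N = L\<close>.\<close>

lemma top_of_uniserial: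
  assumes L: "uniserial R L" and S: "left_module R S" and iso: "lmod_iso R (quot_module L (module_rad R L)) S"
  obtains \<pi> where "uniserial_top R L S \<pi>"
proof -
  have lm: "left_module R L" using L by (simp add: uniserial_def)
  interpret left_module R L by fact
  let ?K = "module_rad R L"
  have max: "submodule N R L" if "maximal_submodule R L N" for N
    using that by (simp add: maximal_submodule_def)
  have K: "submodule ?K R L"
    by (rule submoduleI)
      (auto simp: module_rad_def intro: submoduleD(2,3,5)[OF max] smult_closed)
  obtain q where q: "q \<in> lmod_hom R (quot_module L ?K) S"
    "bij_betw q (carrier (quot_module L ?K)) (carrier S)"
    using iso by (auto simp: lmod_iso_def)
  note proj = quot_module_proj[OF lm K]
  \<comment> \<open>The projection modulo the radical followed by the given isomorphism.\<close>
  let ?\<pi> = "q \<circ> (\<lambda>x. ?K +>\<^bsub>L\<^esub> x)"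
  have \<pi>: "?\<pi> \<in> lmod_hom R L S" by (rule lmod_hom_comp[OF proj(1) q(1)])
  have "N \<subseteq> a_kernel L S ?\<pi> \<or> N = carrier L" if N: "submodule N R L" for N
  proof (cases "N \<subseteq> ?K")
    case True
    have "?K +>\<^bsub>L\<^esub> x = ?K" if "x \<in> ?K" for x using proj(3) that by blast
    then have "?\<pi> x = ?\<pi> \<zero>\<^bsub>L\<^esub>" if "x \<in> N" for x
      using that True submoduleD(2)[OF K] by auto
    also have "?\<pi> \<zero>\<^bsub>L\<^esub> = \<zero>\<^bsub>S\<^esub>"
      by (rule abelian_group_hom.hom_zero[OF lmod_hom_abelian_group_hom[OF \<pi> lm S]])
    finally have "N \<subseteq> a_kernel L S ?\<pi>"
      using submoduleD(1)[OF N] unfolding a_kernel_eq by blast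
    then show ?thesis ..
  next
    case False
    then obtain P where P: "maximal_submodule R L P" "\<not> N \<subseteq> P"
      using submoduleD(1)[OF N] by (auto simp: module_rad_def)
    then have "P \<subseteq> N" using L max[OF P(1)] N by (auto simp: uniserial_def)
    with P N show ?thesis by (auto simp: maximal_submodule_def)
  qed
  moreover have "?\<pi> ` carrier L = carrier S"
    by (simp only: image_comp[symmetric] proj(2) bij_betw_imp_surj_on[OF q(2)])
  ultimately have "uniserial_top R L S ?\<pi>"
    unfolding uniserial_top_def using L \<pi> by blast
  then show ?thesis by (rule that)
qed

section \<open>Transport and composition series\<close>

text \<open>Renames the elements along an injection. Every extension passes to a product type;
  renaming its elements as lists keeps the carrier type fixed, so that an induction on the length
  can be stated.\<close>

definition transport :: "('m \<Rightarrow> 'n) \<Rightarrow> ('r, 'm) module \<Rightarrow> ('r, 'n) module" where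
  "transport j M = \<lparr>carrier = j ` carrier M, mult = undefined, one = undefined, zero = j \<zero>\<^bsub>M\<^esub>,
     add = (\<lambda>x y. j (inv_into (carrier M) j x \<oplus>\<^bsub>M\<^esub> inv_into (carrier M) j y)),
     smult = (\<lambda>a x. j (a \<odot>\<^bsub>M\<^esub> inv_into (carrier M) j x))\<rparr>"

lemma transport:
  assumes M: "left_module R M" and inj: "inj_on j (carrier M)"
  shows "left_module R (transport j M)" "j \<in> lmod_hom R M (transport j M)"
    "bij_betw j (carrier M) (carrier (transport j M))"
proof -
  interpret left_module R M by fact
  let ?i = "inv_into (carrier M) j"
  have i: "?i (j x) = x" if "x \<in> carrier M" for x using inj that by simp
  show bij: "bij_betw j (carrier M) (carrier (transport j M))"
    using inj by (simp add: bij_betw_def transport_def)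
  show "left_module R (transport j M)"
  proof (rule left_module_pullback[OF M, of ?i])
    show "bij_betw ?i (carrier (transport j M)) (carrier M)" by (rule bij_betw_inv_into[OF bij])
  qed (auto simp: transport_def i smult_closed)
  show "j \<in> lmod_hom R M (transport j M)"
    by (rule lmod_homI) (auto simp: transport_def i)
qed

text \<open>Taking preimages under the bijection \<open>j\<close> reflects inclusions of submodules,
  so both lattice conditions may be tested in \<open>M\<close>.\<close>

lemma uniserial_top_iso:
  assumes top: "uniserial_top R M S \<pi>" and M': "left_module R M'"
    and j: "j \<in> lmod_hom R M M'" and bij: "bij_betw j (carrier M) (carrier M')"
  shows "uniserial_top R M' S (\<pi> \<circ> inv_into (carrier M) j)"
proof -
  have M: "left_module R M" and \<pi>: "\<pi> \<in> lmod_hom R M S" "\<pi> ` carrier M = carrier S"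
    using top by (auto simp: uniserial_top_def uniserial_def)
  let ?i = "inv_into (carrier M) j" and ?V = "\<lambda>N. {x \<in> carrier M. j x \<in> N}"
  have i: "?i \<in> lmod_hom R M' M" by (rule lmod_hom_inv[OF j bij M])
  have ji: "j (?i y) = y" "?i y \<in> carrier M" if "y \<in> carrier M'" for y
    using that bij by (auto simp: bij_betw_def f_inv_into_f inv_into_into)
  have V: "submodule (?V N) R M" if "submodule N R M'" for N
    by (rule submodule_vimage[OF j M M' that])
  have mono: "N \<subseteq> N'" if "submodule N R M'" "?V N \<subseteq> ?V N'" for N N'
  proof
    fix y assume "y \<in> N"
    moreover from this have "y \<in> carrier M'" using submoduleD(1)[OF that(1)] by auto
    ultimately have "?i y \<in> ?V N" using ji by simp
    with that(2) have "j (?i y) \<in> N'" by blast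
    then show "y \<in> N'" using ji[OF \<open>y \<in> carrier M'\<close>] by simp
  qed
  show ?thesis
    unfolding uniserial_top_def uniserial_def
  proof (intro conjI allI impI M' lmod_hom_comp[OF i \<pi>(1)])
    fix N N' assume N: "submodule N R M'" "submodule N' R M'"
    have "?V N \<subseteq> ?V N' \<or> ?V N' \<subseteq> ?V N"
      using top V[OF N(1)] V[OF N(2)] unfolding uniserial_top_def uniserial_def by blast
    then show "N \<subseteq> N' \<or> N' \<subseteq> N" using mono N by blast
  next
    have "?i ` carrier M' = carrier M" using bij_betw_inv_into[OF bij] by (simp add: bij_betw_def)
    then show "(\<pi> \<circ> ?i) ` carrier M' = carrier S" by (simp only: image_comp[symmetric] \<pi>(2))
  next
    fix N assume N: "submodule N R M'"
    have "?V N \<subseteq> a_kernel M S \<pi> \<or> ?V N = carrier M"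
      using top V[OF N] unfolding uniserial_top_def by blast
    then show "N \<subseteq> a_kernel M' S (\<pi> \<circ> ?i) \<or> N = carrier M'"
    proof
      assume *: "?V N \<subseteq> a_kernel M S \<pi>"
      have "y \<in> a_kernel M' S (\<pi> \<circ> ?i)" if y: "y \<in> N" for y
      proof -
        have y': "y \<in> carrier M'" using y submoduleD(1)[OF N] by auto
        then have "?i y \<in> ?V N" using ji y by simp
        then have "?i y \<in> a_kernel M S \<pi>" using * by (rule rev_subsetD)
        then show ?thesis using y' unfolding a_kernel_eq by simp
      qed
      then show ?thesis by blast
    next
      assume *: "?V N = carrier M"
      have "?V (carrier M') \<subseteq> ?V N" unfolding * by auto
      then have "carrier M' \<subseteq> N" by (rule mono[OF left_module.submodule_carrier[OF M']])
      then show ?thesis using submoduleD(1)[OF N] by blast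
    qed
  qed
qed

text \<open>The factors are witnessed by surjections onto \<open>S\<close> and not by quotient
  modules; in this form a series moves along an embedding without any computation with
  cosets.\<close>

definition factor_series ::
  "('r, 'x) ring_scheme \<Rightarrow> ('r, 'm) module \<Rightarrow> ('r, 's) module \<Rightarrow> nat \<Rightarrow> (nat \<Rightarrow> 'm set) \<Rightarrow> bool" where
  "factor_series R M S n N \<longleftrightarrow> N 0 = {\<zero>\<^bsub>M\<^esub>} \<and> N n = carrier M \<and> (\<forall>i\<le>n. submodule (N i) R M) \<and>
     (\<forall>i<n. \<exists>g\<in>lmod_hom R (M\<lparr>carrier := N (Suc i)\<rparr>) S.
        g ` N (Suc i) = carrier S \<and> N i = a_kernel (M\<lparr>carrier := N (Suc i)\<rparr>) S g)"

text \<open>The series of \<open>L\<close> is moved into \<open>M\<close> along \<open>i\<close>,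
  its surjections being composed with the inverse of \<open>i\<close>, and \<open>M\<close> itself
  is added on top. The new factor is \<open>S\<close> because the image of \<open>i\<close> is the
  kernel of \<pi>.\<close>

lemma factor_series_extend:
  assumes series: "factor_series R L S n N" and L: "left_module R L" and M: "left_module R M"
    and i: "i \<in> lmod_hom R L M" "inj_on i (carrier L)"
    and \<pi>: "\<pi> \<in> lmod_hom R M S" "\<pi> ` carrier M = carrier S"
    and exact: "i ` carrier L = a_kernel M S \<pi>"
  shows "\<exists>N'. factor_series R M S (Suc n) N'"
proof -
  let ?N = "\<lambda>k. if k \<le> n then i ` N k else carrier M"
  let ?r = "inv_into (carrier L) i"
  interpret i: abelian_group_hom L M i by (rule lmod_hom_abelian_group_hom[OF i(1) L M])
  have N: "submodule (N k) R L" if "k \<le> n" for k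
    using series that by (simp add: factor_series_def)
  have r: "?r (i x) = x" if "x \<in> carrier L" for x using i(2) that by simp
  have "factor_series R M S (Suc n) ?N"
    unfolding factor_series_def
  proof (intro conjI allI impI)
    show "?N 0 = {\<zero>\<^bsub>M\<^esub>}" using series by (simp add: factor_series_def)
    show "?N (Suc n) = carrier M" by simp
    show "submodule (?N k) R M" for k
      using submodule_image[OF i(1) L M N] left_module.submodule_carrier[OF M] by simp
  next
    fix k assume k: "k < Suc n"
    show "\<exists>g\<in>lmod_hom R (M\<lparr>carrier := ?N (Suc k)\<rparr>) S.
      g ` ?N (Suc k) = carrier S \<and> ?N k = a_kernel (M\<lparr>carrier := ?N (Suc k)\<rparr>) S g"
    proof (cases "k = n")
      case True
      have "M\<lparr>carrier := carrier M\<rparr> = M" by simp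
      moreover have "N n = carrier L" using series by (simp add: factor_series_def)
      ultimately show ?thesis using True \<pi> exact by (auto intro!: bexI[of _ \<pi>])
    next
      case False
      then have k: "k < n" using k by simp
      then obtain g where g: "g \<in> lmod_hom R (L\<lparr>carrier := N (Suc k)\<rparr>) S"
        "g ` N (Suc k) = carrier S" "N k = a_kernel (L\<lparr>carrier := N (Suc k)\<rparr>) S g"
        using series unfolding factor_series_def by blast
      note sub = submoduleD[OF N[of "Suc k"]]
      have NL: "N (Suc k) \<subseteq> carrier L" using sub(1) k by simp
      have rN: "?r (i x) = x" "x \<in> carrier L" if "x \<in> N (Suc k)" for x using r NL that by auto
      have "g \<circ> ?r \<in> lmod_hom R (M\<lparr>carrier := i ` N (Suc k)\<rparr>) S"
      proof (rule lmod_homI)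
        fix x y assume "x \<in> carrier (M\<lparr>carrier := i ` N (Suc k)\<rparr>)" "y \<in> carrier (M\<lparr>carrier := i ` N (Suc k)\<rparr>)"
        then obtain u v where uv: "x = i u" "y = i v" "u \<in> N (Suc k)" "v \<in> N (Suc k)" by auto
        moreover have "i u \<oplus>\<^bsub>M\<^esub> i v = i (u \<oplus>\<^bsub>L\<^esub> v)" "u \<oplus>\<^bsub>L\<^esub> v \<in> N (Suc k)"
          using uv rN sub(3) k by auto
        ultimately show "(g \<circ> ?r) (x \<oplus>\<^bsub>M\<lparr>carrier := i ` N (Suc k)\<rparr>\<^esub> y) = (g \<circ> ?r) x \<oplus>\<^bsub>S\<^esub> (g \<circ> ?r) y"
          using lmod_homD(3)[OF g(1), of u v] rN by (simp del: i.hom_add)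
      next
        fix a x assume a: "a \<in> carrier R" and "x \<in> carrier (M\<lparr>carrier := i ` N (Suc k)\<rparr>)"
        then obtain u where u: "x = i u" "u \<in> N (Suc k)" by auto
        moreover have "a \<odot>\<^bsub>M\<^esub> i u = i (a \<odot>\<^bsub>L\<^esub> u)" "a \<odot>\<^bsub>L\<^esub> u \<in> N (Suc k)"
          using u rN sub(5) k a lmod_homD(4)[OF i(1) a] by auto
        ultimately show "(g \<circ> ?r) (a \<odot>\<^bsub>M\<lparr>carrier := i ` N (Suc k)\<rparr>\<^esub> x) = a \<odot>\<^bsub>S\<^esub> (g \<circ> ?r) x"
          using lmod_homD(4)[OF g(1) a, of u] rN by simp
      qed (use lmod_homD(2)[OF g(1)] rN in auto)
      moreover have "(g \<circ> ?r) ` i ` N (Suc k) = carrier S"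
        unfolding g(2)[symmetric] image_image by (rule image_cong) (simp_all add: rN)
      moreover have "i ` N k = a_kernel (M\<lparr>carrier := i ` N (Suc k)\<rparr>) S (g \<circ> ?r)"
        unfolding g(3) unfolding a_kernel_eq by (auto simp: rN)
      ultimately show ?thesis using k by (intro bexI[of _ "g \<circ> ?r"]) simp_all
    qed
  qed
  then show ?thesis by blast
qed

lemma submodule_restrict:
  assumes M: "left_module R M" and A: "submodule A R M" and U: "submodule U R M" "U \<subseteq> A"
  shows "submodule U R (M\<lparr>carrier := A\<rparr>)"
  by (rule left_module.submoduleI[OF left_module_submodule[OF M A]]) (use submoduleD[OF U(1)] U(2) in auto)

text \<open>Simplicity of the quotient is used as a statement about the lattice of submodules:
  \<open>A\<close> covers \<open>B\<close>. The image of an intermediate \<open>U\<close> in the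
  quotient is zero or everything.\<close>

lemma simple_subquot_cover:
  assumes M: "left_module R M" and A: "submodule A R M" and B: "submodule B R M" "B \<subseteq> A"
    and simple: "simple_module R (subquot M A B)"
  shows "A \<noteq> B" "\<And>U. \<lbrakk>submodule U R M; B \<subseteq> U; U \<subseteq> A\<rbrakk> \<Longrightarrow> U = B \<or> U = A"
proof -
  let ?A = "M\<lparr>carrier := A\<rparr>" and ?Q = "subquot M A B"
  have MA: "left_module R ?A" by (rule left_module_submodule[OF M A])
  have Q: "left_module R ?Q" using simple by (simp add: simple_module_def)
  interpret A: left_module R ?A by fact
  note proj = quot_module_proj[OF MA submodule_restrict[OF M A B], folded subquot_def]
  define q where "q x = B +>\<^bsub>?A\<^esub> x" for x
  have q: "q \<in> lmod_hom R ?A ?Q" "q ` A = carrier ?Q" "{x \<in> A. q x = B} = B"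
    using proj unfolding q_def by simp_all
  interpret q: abelian_group_hom ?A ?Q q by (rule lmod_hom_abelian_group_hom[OF q(1) MA Q])
  have zero: "\<zero>\<^bsub>?Q\<^esub> = B" by (simp add: subquot_def quot_module_def)
  show "A \<noteq> B"
  proof
    assume "A = B"
    then have "q ` A \<subseteq> {B}" using q(3) by blast
    moreover have "A \<noteq> {}" using submoduleD(2)[OF A] by blast
    ultimately have "q ` A = {B}" by blast
    then show False using simple by (simp add: simple_module_def zero q(2))
  qed
  fix U assume U: "submodule U R M" "B \<subseteq> U" "U \<subseteq> A"
  have "q ` U = {B} \<or> q ` U = carrier ?Q"
    using simple submodule_image[OF q(1) MA Q submodule_restrict[OF M A U(1,3)]]
    by (simp add: simple_module_def zero)
  then show "U = B \<or> U = A"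
  proof
    assume "q ` U = {B}"
    then have "U \<subseteq> {x \<in> A. q x = B}" using U(3) by blast
    then show ?thesis using q(3) U(2) by blast
  next
    assume *: "q ` U = carrier ?Q"
    \<comment> \<open>Modulo \<open>B\<close> the element \<open>a\<close> agrees with some
      \<open>u\<close> in \<open>U\<close>, and \<open>B\<close> lies in \<open>U\<close>, so
      \<open>a\<close> is a sum of two elements of \<open>U\<close>.\<close>
    have "a \<in> U" if a: "a \<in> A" for a
    proof -
      have "q a \<in> q ` U" using a q(2) * by blast
      then obtain u where u: "u \<in> U" "q a = q u" by blast
      then have uA: "u \<in> A" using U(3) by blast
      have "q (a \<ominus>\<^bsub>?A\<^esub> u) = q u \<ominus>\<^bsub>?Q\<^esub> q u" using a uA u(2) q.hom_minus[of a u] by simp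
      also have "\<dots> = B" using uA q.hom_closed[of u] by (simp add: q.H.minus_eq q.H.r_neg zero)
      finally have "a \<ominus>\<^bsub>?A\<^esub> u \<in> U" using q(3) U(2) A.M.minus_closed[of a u] a uA by auto
      then have "(a \<ominus>\<^bsub>?A\<^esub> u) \<oplus>\<^bsub>?A\<^esub> u \<in> U" using submoduleD(3)[OF U(1)] u(1) by simp
      moreover have "(a \<ominus>\<^bsub>?A\<^esub> u) \<oplus>\<^bsub>?A\<^esub> u = a"
        using a uA A.M.a_assoc[of a "\<ominus>\<^bsub>?A\<^esub> u" u] A.M.l_neg[of u] A.M.a_inv_closed[of u] A.M.r_zero[of a]
        by (simp add: A.M.minus_eq)
      ultimately show ?thesis by simp
    qed
    then show ?thesis using U(3) by blast
  qed
qed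

lemma factor_series_subquot:
  assumes M: "left_module R M" and S: "simple_module R S" and series: "factor_series R M S n N" and i: "i < n"
  shows "N i \<subseteq> N (Suc i)" "lmod_iso R (subquot M (N (Suc i)) (N i)) S"
    "simple_module R (subquot M (N (Suc i)) (N i))"
proof -
  have lmS: "left_module R S" using S by (simp add: simple_module_def)
  have N: "submodule (N (Suc i)) R M" using series i by (simp add: factor_series_def)
  obtain g where g: "g \<in> lmod_hom R (M\<lparr>carrier := N (Suc i)\<rparr>) S"
    "g ` carrier (M\<lparr>carrier := N (Suc i)\<rparr>) = carrier S" "N i = a_kernel (M\<lparr>carrier := N (Suc i)\<rparr>) S g"
    using series i unfolding factor_series_def by auto
  show "N i \<subseteq> N (Suc i)" unfolding g(3) a_kernel_eq by auto
  note iso = quot_module_iso[OF left_module_submodule[OF M N] lmS g(1,2), folded g(3) subquot_def]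
  show "lmod_iso R (subquot M (N (Suc i)) (N i)) S" by (rule iso(2))
  show "simple_module R (subquot M (N (Suc i)) (N i))" by (rule simple_module_iso[OF iso(2,1) S])
qed

text \<open>\<open>composition_factors\<close> ranges over all composition series, so the given one
  must be compared with every other. In a uniserial module two covers of the same submodule are
  comparable and hence equal, which makes the series unique.\<close>

lemma uniserial_factors:
  assumes M: "uniserial R M" and S: "simple_module R S" and series: "factor_series R M S n N"
  shows "has_length R M n" "\<forall>Q\<in>composition_factors R M. lmod_iso R Q S"
proof -
  have lm: "left_module R M" using M by (simp add: uniserial_def)
  note sq = factor_series_subquot[OF lm S series]
  have N: "N 0 = {\<zero>\<^bsub>M\<^esub>}" "N n = carrier M" "\<And>i. i \<le> n \<Longrightarrow> submodule (N i) R M"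
    using series by (auto simp: factor_series_def)
  show "has_length R M n"
    unfolding has_length_def composition_series_def
    by (intro exI[of _ N] conjI allI impI lm N sq(1) sq(3))
  have uniq: "i \<le> n \<and> N' i = N i" if C: "composition_series R M m N'" and "i \<le> m" for m N' i
    using that(2)
  proof (induction i)
    case 0
    then show ?case using C N(1) by (simp add: composition_series_def)
  next
    case (Suc i)
    then have IH: "i \<le> n" "N' i = N i" and im: "i < m" by auto
    have N': "submodule (N' i) R M" "submodule (N' (Suc i)) R M" "N' i \<subseteq> N' (Suc i)"
      "simple_module R (subquot M (N' (Suc i)) (N' i))"
      using C im by (auto simp: composition_series_def)
    note cov' = simple_subquot_cover[OF lm N'(2,1,3,4)]
    \<comment> \<open>\<open>N n\<close> is already the whole module, which leaves no room for a
      further strict step.\<close>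
    have "i \<noteq> n"
      using cov'(1) N'(3) submoduleD(1)[OF N'(2)] IH(2) N(2) by auto
    then have i: "i < n" using IH by simp
    note cov = simple_subquot_cover[OF lm N(3) N(3) sq(1,3)[OF i]]
    have "N' (Suc i) \<subseteq> N (Suc i) \<or> N (Suc i) \<subseteq> N' (Suc i)"
      using M N'(2) N(3)[of "Suc i"] i by (simp add: uniserial_def)
    then have "N' (Suc i) = N (Suc i)"
    proof
      assume "N' (Suc i) \<subseteq> N (Suc i)"
      then show ?thesis using cov(2)[of "N' (Suc i)"] cov'(1) N' IH i by auto
    next
      assume "N (Suc i) \<subseteq> N' (Suc i)"
      then show ?thesis using cov'(2)[of "N (Suc i)"] cov(1) N(3)[of "Suc i"] sq(1)[OF i] IH i by auto
    qed
    with i show ?case by simp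
  qed
  show "\<forall>Q\<in>composition_factors R M. lmod_iso R Q S"
  proof
    fix Q assume "Q \<in> composition_factors R M"
    then obtain N' m i where C: "composition_series R M m N'" and i: "i < m"
      and Q: "Q = subquot M (N' (Suc i)) (N' i)" by (auto simp: composition_factors_def)
    have "N' i = N i" "N' (Suc i) = N (Suc i)" "Suc i \<le> n" using uniq[OF C] i by auto
    then show "lmod_iso R Q S" unfolding Q using sq(2)[of i] by simp
  qed
qed

section \<open>Iterating the extension\<close>

lemma uniserial_top_simple:
  assumes "simple_module R S"
  shows "uniserial_top R S S (\<lambda>x. x)"
proof -
  have S: "left_module R S" "\<And>N. submodule N R S \<Longrightarrow> N = {\<zero>\<^bsub>S\<^esub>} \<or> N = carrier S"
    using assms by (auto simp: simple_module_def)
  have "N \<subseteq> N' \<or> N' \<subseteq> N" if "submodule N R S" "submodule N' R S" for N N'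
    using S(2)[OF that(1)] S(2)[OF that(2)] submoduleD(1,2)[OF that(1)] submoduleD(1,2)[OF that(2)] by blast
  moreover have "N \<subseteq> a_kernel S S (\<lambda>x. x) \<or> N = carrier S" if "submodule N R S" for N
    using S(2)[OF that] abelian_group.axioms(1)[OF left_module_abelian_group[OF S(1)]]
    by (auto simp: a_kernel_eq abelian_monoid.zero_closed)
  ultimately show ?thesis
    using S(1) by (auto simp: uniserial_top_def uniserial_def intro: lmod_homI)
qed

text \<open>Each step replaces the pair of an old element and an element of \<open>S\<close> by a
  longer list, so all modules of the tower share one type. The length starts at one because
  \<open>uniserial_top\<close> needs a surjection onto the nonzero module \<open>S\<close>.\<close>

lemma uniserial_tower:
  fixes E :: "('v, 'e) pre_digraph" and S :: "(('v, 'e, 'k::field) lpa_elem, 's) module"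
  assumes E: "fin_digraph E" and S: "chen_simple E S"
    and ext: "carrier (Ext1 (LPA E) S S) \<noteq> {\<one>\<^bsub>Ext1 (LPA E) S S\<^esub>}"
    and simple: "simple_module (LPA E) S"
  shows "\<exists>(M :: (('v, 'e, 'k) lpa_elem, 's list) module) \<pi> N.
    uniserial_top (LPA E) M S \<pi> \<and> factor_series (LPA E) M S (Suc n) N"
proof (induction n)
  case 0
  let ?j = "\<lambda>x. [x]"
  let ?M = "transport ?j S"
  let ?\<pi> = "(\<lambda>x. x) \<circ> inv_into (carrier S) ?j"
  have lm: "left_module (LPA E) S" using simple by (simp add: simple_module_def)
  have inj: "inj_on ?j (carrier S)" by (rule inj_onI) simp
  note tr = transport[OF lm inj]
  have top: "uniserial_top (LPA E) ?M S ?\<pi>"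
    by (rule uniserial_top_iso[OF uniserial_top_simple[OF simple] tr])
  \<comment> \<open>The single factor is obtained by extending the empty series of the zero module,
    so no separate construction is needed for length one.\<close>
  let ?Z = "S\<lparr>carrier := {\<zero>\<^bsub>S\<^esub>}\<rparr>"
  have Z: "left_module (LPA E) ?Z"
    by (rule left_module_submodule[OF lm left_module.submodule_zero[OF lm]])
  have "factor_series (LPA E) ?Z S 0 (\<lambda>_. carrier ?Z)"
    using left_module.submodule_carrier[OF Z] by (simp add: factor_series_def)
  moreover have zero: "\<zero>\<^bsub>S\<^esub> \<in> carrier S"
    using submoduleD(2)[OF left_module.submodule_carrier[OF lm]] .
  then have "?j \<in> lmod_hom (LPA E) ?Z ?M"
    using tr(2) by (auto simp: lmod_hom_def)
  moreover have "inv_into (carrier S) ?j [x] = x" if "x \<in> carrier S" for x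
    by (rule inv_into_f_f[OF inj that])
  then have "?j ` carrier ?Z = a_kernel ?M S ?\<pi>"
    using zero by (auto simp: a_kernel_eq transport_def)
  ultimately have "\<exists>N. factor_series (LPA E) ?M S (Suc 0) N"
    using top by (intro factor_series_extend[OF _ Z tr(1)]) (auto simp: uniserial_top_def)
  with top show ?case by blast
next
  case (Suc n)
  then obtain L :: "(('v, 'e, 'k) lpa_elem, 's list) module" and \<pi> N
    where top: "uniserial_top (LPA E) L S \<pi>" and series: "factor_series (LPA E) L S (Suc n) N"
    by blast
  obtain M :: "(('v, 'e, 'k) lpa_elem, 's list \<times> 's) module" and i
    where M: "uniserial_top (LPA E) M S snd" "i \<in> lmod_hom (LPA E) L M"
      "inj_on i (carrier L)" "i ` carrier L = a_kernel M S snd"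
    by (rule uniserial_extension[OF E S ext top])
  \<comment> \<open>Prepending is injective on pairs, so nothing is identified by the
    renaming.\<close>
  let ?j = "\<lambda>(l, x). x # l"
  let ?M = "transport ?j M"
  let ?\<pi> = "snd \<circ> inv_into (carrier M) ?j"
  have lm: "left_module (LPA E) M" "left_module (LPA E) L"
    using M(1) top by (simp_all add: uniserial_top_def uniserial_def)
  have inj: "inj_on ?j (carrier M)" by (rule inj_onI) auto
  note tr = transport[OF lm(1) inj]
  have top': "uniserial_top (LPA E) ?M S ?\<pi>" by (rule uniserial_top_iso[OF M(1) tr])
  have iM: "i x \<in> carrier M" if "x \<in> carrier L" for x by (rule lmod_homD(2)[OF M(2) that])
  have "(?j \<circ> i) ` carrier L = ?j ` a_kernel M S snd" by (simp only: image_comp[symmetric] M(4))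
  also have "\<dots> = a_kernel ?M S ?\<pi>"
  proof -
    have "inv_into (carrier M) ?j (?j m) = m" if "m \<in> carrier M" for m
      by (rule inv_into_f_f[OF inj that])
    then show ?thesis unfolding a_kernel_eq by (force simp: transport_def)
  qed
  finally have "(?j \<circ> i) ` carrier L = a_kernel ?M S ?\<pi>" .
  moreover have "inj_on (?j \<circ> i) (carrier L)"
    by (rule comp_inj_on[OF M(3)]) (rule inj_on_subset[OF inj], use iM in blast)
  ultimately have "\<exists>N. factor_series (LPA E) ?M S (Suc (Suc n)) N"
    using top' by (intro factor_series_extend[OF series lm(2) tr(1) lmod_hom_comp[OF M(2) tr(2)]])
      (auto simp: uniserial_top_def)
  with top' show ?case by blast
qed

theorem corollary3p25:
  fixes E :: "('v, 'e) pre_digraph"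
    and S :: "(('v, 'e, 'k::field) lpa_elem, 's) module"
  assumes "fin_digraph E"
    and "chen_simple E S"
    and "carrier (Ext1 (LPA E) S S) \<noteq> {\<one>\<^bsub>Ext1 (LPA E) S S\<^esub>}"
  shows "(\<forall>L :: (('v, 'e, 'k) lpa_elem, 'l) module.
            uniserial (LPA E) L \<and>
            lmod_iso (LPA E) (quot_module L (module_rad (LPA E) L)) S \<longrightarrow>
            (\<exists>M :: (('v, 'e, 'k) lpa_elem, 'l \<times> 's) module.
               uniserial (LPA E) M \<and> is_extension (LPA E) M L S)) \<and>
         (\<forall>n. \<exists>M :: (('v, 'e, 'k) lpa_elem, 's list) module.
            uniserial (LPA E) M \<and> has_length (LPA E) M n \<and>
            (\<forall>Q \<in> composition_factors (LPA E) M. lmod_iso (LPA E) Q S))"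
proof (intro conjI allI impI; (elim conjE)?)
  fix L :: "(('v, 'e, 'k) lpa_elem, 'l) module"
  assume "uniserial (LPA E) L" "lmod_iso (LPA E) (quot_module L (module_rad (LPA E) L)) S"
  moreover have "left_module (LPA E) S" using assms(2) by (simp add: chen_simple_def)
  ultimately obtain \<pi> where "uniserial_top (LPA E) L S \<pi>" by (metis top_of_uniserial)
  then obtain M :: "(('v, 'e, 'k) lpa_elem, 'l \<times> 's) module"
    where "uniserial_top (LPA E) M S snd" "is_extension (LPA E) M L S"
    by (rule uniserial_extension[OF assms])
  then show "\<exists>M :: (('v, 'e, 'k) lpa_elem, 'l \<times> 's) module.
      uniserial (LPA E) M \<and> is_extension (LPA E) M L S"
    by (auto simp: uniserial_top_def)
next
  fix n
  interpret fin_digraph E by fact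
  obtain p where lm: "left_module (LPA E) S"
    and p: "infinite_path E p" "lmod_iso (LPA E) S (path_module E p)"
    by (rule chen_simple_path[OF assms])
  have simple: "simple_module (LPA E) S"
    by (rule simple_module_iso[OF p(2) lm simple_path_module[OF p(1)]])
  show "\<exists>M :: (('v, 'e, 'k) lpa_elem, 's list) module.
      uniserial (LPA E) M \<and> has_length (LPA E) M n \<and>
      (\<forall>Q \<in> composition_factors (LPA E) M. lmod_iso (LPA E) Q S)"
  proof (cases n)
    case 0
    \<comment> \<open>Length zero lies outside the tower. The zero module is realised on the type of
      lists with the empty list as its only element.\<close>
    let ?Z = "S\<lparr>carrier := {\<zero>\<^bsub>S\<^esub>}\<rparr>"
    have Z: "left_module (LPA E) ?Z"
      by (rule left_module_submodule[OF lm left_module.submodule_zero[OF lm]])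
    let ?M = "transport (\<lambda>_. []) ?Z :: (('v, 'e, 'k) lpa_elem, 's list) module"
    have M: "left_module (LPA E) ?M" by (rule transport(1)[OF Z]) simp
    have carr: "carrier ?M = {\<zero>\<^bsub>?M\<^esub>}" by (auto simp: transport_def)
    have "N = carrier ?M" if "submodule N (LPA E) ?M" for N
      using submoduleD(1,2)[OF that] unfolding carr by blast
    then have "uniserial (LPA E) ?M" unfolding uniserial_def using M by blast
    moreover have "factor_series (LPA E) ?M S 0 (\<lambda>_. carrier ?M)"
      using left_module.submodule_carrier[OF M] carr by (simp add: factor_series_def)
    ultimately show ?thesis using uniserial_factors[OF _ simple] 0 by blast
  next
    case (Suc m)
    obtain M :: "(('v, 'e, 'k) lpa_elem, 's list) module" and \<pi> N
      where "uniserial_top (LPA E) M S \<pi>" "factor_series (LPA E) M S (Suc m) N"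
      using uniserial_tower[OF assms simple] by blast
    then show ?thesis
      using uniserial_factors[OF _ simple, of M "Suc m" N] Suc
      by (intro exI[of _ M]) (simp add: uniserial_top_def)
  qed
qed

end
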